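(* Let $\theta=\begin{bmatrix}\alpha&\gamma\\ \beta&\delta\end{bmatrix}\in GL_2(\mathbb{Z})$ and $G=(\mathbb{Z}\oplus\mathbb{Z})\rtimes_\theta\mathbb{Z}$, and let $m_1,m_2,n_1,n_2$ and the integers $S(\alpha,\gamma)$, $S(\beta,\delta)$ be as defined in the context. The cohomology ring $H^*(G,\mathbb{Z}_2)$ is given by: 1. If $\theta\equiv\begin{bmatrix}1&0\\0&1\end{bmatrix}\pmod 2$, then $H^*(G,\mathbb{Z}_2)$ is isomorphic to the quotient of $\mathbb{Z}_2[\zeta_1,\zeta_2,\zeta_3]$ by the relations $$\zeta_1^2=\Big(\frac{1+m_1}{2}\Big)\zeta_1\zeta_3+\frac{m_2}{2}\zeta_2\zeta_3,\quad \zeta_2^2=\frac{n_1}{2}\zeta_1\zeta_3+\Big(1+\frac{n_2-1}{2}\Big)\zeta_2\zeta_3,\quad \zeta_3^2=0,$$ where $\dim\zeta_1=\dim\zeta_2=\dim\zeta_3=1$. 2. If $\theta\equiv\begin{bmatrix}0&1\\1&0\end{bmatrix}\pmod 2$, then $H^*(G,\mathbb{Z}_2)$ is isomorphic to the quotient of $\mathbb{Z}_2[\zeta_1,\zeta_2,\xi_1,\xi_2]$ by the relations $$\zeta_1^2=\Big(1+\frac{\alpha+\delta+m_2+n_1}{2}\Big)\xi_1,\quad \zeta_2^2=0,\quad \zeta_1\zeta_2=0,\quad \zeta_1\xi_1=\zeta_2\xi_2,$$ $$\zeta_1\xi_2=(S(\alpha,\gamma)+S(\beta,\delta))\zeta_1\xi_1,\quad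 \xi_1^2=0,\quad \xi_2^2=0,\quad \xi_1\xi_2=0,$$ where $\dim\zeta_1=\dim\zeta_2=1$ and $\dim\xi_1=\dim\xi_2=2$. 3. If $\theta\equiv\begin{bmatrix}1&1\\1&0\end{bmatrix}\pmod 2$, then $H^*(G,\mathbb{Z}_2)\cong\dfrac{\mathbb{Z}_2[\zeta,\xi]}{(\zeta^2=0,\ \xi^2=0)}$, where $\dim\zeta=1$ and $\dim\xi=2$. 4. If $\theta\equiv\begin{bmatrix}1&0\\1&1\end{bmatrix}\pmod 2$, then $H^*(G,\mathbb{Z}_2)$ is isomorphic to the quotient of $\mathbb{Z}_2[\zeta_1,\zeta_2,\xi_1,\xi_2]$ by the relations $$\zeta_1^2=\frac{\gamma}{2}\xi_1,\quad \zeta_2^2=0,\quad \zeta_1\zeta_2=0,\quad \zeta_1\xi_2=S(\alpha,\gamma)\zeta_1\xi_1,$$ $$\zeta_2\xi_1=0,\quad \zeta_2\xi_2=\zeta_1\xi_1,\quad \xi_1^2=0,\quad \xi_2^2=0,\quad \xi_1\xi_2=0,$$ where $\dim\zeta_1=\dim\zeta_2=1$ and $\dim\xi_1=\dim\xi_2=2$. 5. If $\theta\equiv\begin{bmatrix}1&1\\0&1\end{bmatrix}\pmod 2$, then $H^*(G,\mathbb{Z}_2)$ is isomorphic to the quotient of $\mathbb{Z}_2[\zeta_1,\zeta_2,\xi_1,\xi_2]$ by the relations $$\zeta_1^2=\frac{\beta}{2}\xi_1,\quad \zeta_2^2=0,\quad \zeta_1\zeta_2=0,\quad \zeta_1\xi_2=S(\beta,\delta)\zeta_1\xi_1,$$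 $$\zeta_2\xi_1=0,\quad \zeta_2\xi_2=\zeta_1\xi_1,\quad \xi_1^2=0,\quad \xi_2^2=0,\quad \xi_1\xi_2=0,$$ where $\dim\zeta_1=\dim\zeta_2=1$ and $\dim\xi_1=\dim\xi_2=2$. 6. If $\theta\equiv\begin{bmatrix}0&1\\1&1\end{bmatrix}\pmod 2$, then $H^*(G,\mathbb{Z}_2)\cong\dfrac{\mathbb{Z}_2[\zeta,\xi]}{(\zeta^2=0,\ \xi^2=0)}$, where $\dim\zeta=1$ and $\dim\xi=2$.
   Context: Write $\mathbb{Z}\oplus\mathbb{Z}=\langle a,b\mid ab=ba\rangle$ and $\mathbb{Z}=\langle t\rangle$; $t$ acts on $\mathbb{Z}\oplus\mathbb{Z}$ by $a\mapsto a^\alpha b^\beta$, $b\mapsto a^\gamma b^\delta$ (this automorphism is also denoted $\theta$). $G=(\mathbb{Z}\oplus\mathbb{Z})\rtimes_\theta\mathbb{Z}=\{(a^mb^n,t^k):m,n,k\in\mathbb{Z}\}$ with product $(g,t^k)(h,t^l)=(g\,\theta^k(h),t^{k+l})$; it is the fundamental group of the torus bundle over $S^1$ determined by $\theta$. $\mathbb{Z}_2=\mathbb{Z}/2\mathbb{Z}$ is the trivial module. $\begin{bmatrix}m_1&m_2\\ n_1&n_2\end{bmatrix}=-\theta^{-1}=\frac{1}{\alpha\delta-\beta\gamma}\begin{bmatrix}-\delta&\gamma\\ \beta&-\alpha\end{bmatrix}$. $S(\alpha,\gamma)=\frac{1-\alpha-\gamma-\alpha\gamma}{2}$ and $S(\beta,\delta)=\frac{1-\beta-\delta+\beta\delta}{2}$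 if $\det\theta=1$; $S(\alpha,\gamma)=\frac{-1+\alpha+\gamma-\alpha\gamma}{2}$ and $S(\beta,\delta)=\frac{-1+\beta+\delta+\beta\delta}{2}$ if $\det\theta=-1$. These are integers. $\mathbb{Z}_2[\ldots]$ is the (graded) commutative polynomial ring on generators of the assigned degrees ($\dim$), the quotient is by the ideal generated by the listed relations, integer coefficients are read mod $2$, and isomorphisms are of graded rings under cup product.
   Formalization: In item 2 the relation ζ₂ξ₁=0 is added: as printed, item 2 fails when the coefficient of ξ₁ in ζ₁² is even (e.g. θ=[[0,1],[1,0]]: degree 3 of the quotient has dimension 2, but H³ has dimension 1); when it is odd, the relation already follows. *)

theory Defs
  imports
    "HOL-Analysis.Analysis"
    "HOL-Algebra.Algebraic_Closure_Type"
    "HOL-Number_Theory.Cong"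
    "HOL-Library.Poly_Mapping"
    "HOL-Library.Z2"
begin

unbundle no fps_syntax

section \<open>Group cohomology with trivial coefficients\<close>

text \<open>
  The inhomogeneous bar complex. An $n$-cochain is a function $G^n \to R$, and $G^n$ is the set of
  lists of length $n$, so an element of $\bigoplus_n C^n(G,R)$ is a single function on lists over
  the carrier that vanishes on all sufficiently long lists; its degree $n$ component is its
  restriction to lists of length $n$.
\<close>

definition cochains :: "('g, 'm) monoid_scheme \<Rightarrow> ('g list \<Rightarrow> 'r::comm_ring_1) set" where
  "cochains G = {f. (\<forall>xs. xs \<notin> lists (carrier G) \<longrightarrow> f xs = 0) \<and>
                    (\<exists>N. \<forall>xs. length xs > N \<longrightarrow> f xs = 0)}"

definition cochain_degree :: "nat \<Rightarrow> ('g list \<Rightarrow> 'r::comm_ring_1) \<Rightarrow> bool" where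
  "cochain_degree n f \<longleftrightarrow> (\<forall>xs. length xs \<noteq> n \<longrightarrow> f xs = 0)"

text \<open>
  On $n$-cochains this is $(df)(g_1,\dots,g_{n+1}) = f(g_2,\dots,g_{n+1})
  + \sum_{i=1}^{n} (-1)^i f(g_1,\dots,g_i g_{i+1},\dots,g_{n+1}) + (-1)^{n+1} f(g_1,\dots,g_n)$;
  list positions start at $0$, so $g_i$ is \<open>xs ! (i - 1)\<close>.
\<close>

definition coboundary ::
  "('g, 'm) monoid_scheme \<Rightarrow> ('g list \<Rightarrow> 'r::comm_ring_1) \<Rightarrow> 'g list \<Rightarrow> 'r" where
  "coboundary G f xs =
     (if xs = [] \<or> xs \<notin> lists (carrier G) then 0
      else f (tl xs)
         + (\<Sum>i = 1..<length xs. (-1) ^ i *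
              f (take (i - 1) xs @ [xs ! (i - 1) \<otimes>\<^bsub>G\<^esub> xs ! i] @ drop (i + 1) xs))
         + (-1) ^ length xs * f (butlast xs))"

definition cup_product ::
  "('g list \<Rightarrow> 'r::comm_ring_1) \<Rightarrow> ('g list \<Rightarrow> 'r) \<Rightarrow> 'g list \<Rightarrow> 'r" where
  "cup_product f g xs = (\<Sum>k\<le>length xs. f (take k xs) * g (drop k xs))"

definition cocycles :: "('g, 'm) monoid_scheme \<Rightarrow> ('g list \<Rightarrow> 'r::comm_ring_1) set" where
  "cocycles G = {f \<in> cochains G. coboundary G f = (\<lambda>xs. 0)}"

definition coboundaries :: "('g, 'm) monoid_scheme \<Rightarrow> ('g list \<Rightarrow> 'r::comm_ring_1) set" where
  "coboundaries G = coboundary G ` cochains G"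

definition cocycle_ring :: "('g, 'm) monoid_scheme \<Rightarrow> ('g list \<Rightarrow> 'r::comm_ring_1) ring" where
  "cocycle_ring G =
     \<lparr>carrier = cocycles G,
      mult = cup_product,
      one = (\<lambda>xs. if xs = [] then 1 else 0),
      zero = (\<lambda>xs. 0),
      add = (\<lambda>f g xs. f xs + g xs)\<rparr>"

definition cohomology_ring ::
  "('g, 'm) monoid_scheme \<Rightarrow> ('g list \<Rightarrow> 'r::comm_ring_1) set ring" where
  "cohomology_ring G = cocycle_ring G Quot coboundaries G"

definition cohomology_component ::
  "('g, 'm) monoid_scheme \<Rightarrow> nat \<Rightarrow> ('g list \<Rightarrow> 'r::comm_ring_1) set set" where
  "cohomology_component G n =
     {coboundaries G +>\<^bsub>cocycle_ring G\<^esub> f | f. f \<in> cocycles G \<and> cochain_degree n f}"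


section \<open>Graded-commutative presentations over the field with two elements\<close>

datatype gen = Zeta nat | Xi nat

fun gen_dim :: "gen \<Rightarrow> nat" where
  "gen_dim (Zeta i) = 1"
| "gen_dim (Xi i) = 2"

type_synonym gen_poly = "(gen \<Rightarrow>\<^sub>0 nat) \<Rightarrow>\<^sub>0 bit"

definition gen_var :: "gen \<Rightarrow> gen_poly" where
  "gen_var x = Poly_Mapping.single (Poly_Mapping.single x 1) 1"

abbreviation zeta_var :: "nat \<Rightarrow> gen_poly" ("\<zeta>") where "\<zeta> i \<equiv> gen_var (Zeta i)"
abbreviation xi_var :: "nat \<Rightarrow> gen_poly" ("\<xi>") where "\<xi> i \<equiv> gen_var (Xi i)"

definition poly_ring :: "gen set \<Rightarrow> gen_poly ring" where
  "poly_ring V = ring_of_type_algebra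
     \<lparr>carrier := {p. \<forall>m \<in> Poly_Mapping.keys p. Poly_Mapping.keys m \<subseteq> V}\<rparr>"

definition poly_homogeneous :: "nat \<Rightarrow> gen_poly \<Rightarrow> bool" where
  "poly_homogeneous n p \<longleftrightarrow>
     (\<forall>m \<in> Poly_Mapping.keys p.
        (\<Sum>x \<in> Poly_Mapping.keys m. gen_dim x * Poly_Mapping.lookup m x) = n)"

text \<open>A relation \<open>l = r\<close> between polynomials enters the ideal as \<open>l - r\<close>.\<close>

abbreviation relation :: "gen_poly \<Rightarrow> gen_poly \<Rightarrow> gen_poly" (infix "\<doteq>" 50) where
  "l \<doteq> r \<equiv> l - r"

definition presented_ring :: "gen set \<Rightarrow> gen_poly set \<Rightarrow> gen_poly set ring" where
  "presented_ring V rels = poly_ring V Quot (Idl\<^bsub>poly_ring V\<^esub> rels)"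

definition presented_component :: "gen set \<Rightarrow> gen_poly set \<Rightarrow> nat \<Rightarrow> gen_poly set set" where
  "presented_component V rels n =
     {(Idl\<^bsub>poly_ring V\<^esub> rels) +>\<^bsub>poly_ring V\<^esub> p | p.
        p \<in> carrier (poly_ring V) \<and> poly_homogeneous n p}"

definition mod2_cohomology_presented_by ::
  "('g, 'm) monoid_scheme \<Rightarrow> gen set \<Rightarrow> gen_poly set \<Rightarrow> bool" where
  "mod2_cohomology_presented_by G V rels \<longleftrightarrow>
     (\<exists>h \<in> ring_iso (cohomology_ring G :: ('g list \<Rightarrow> bit) set ring) (presented_ring V rels).
        \<forall>n. h ` cohomology_component G n = presented_component V rels n)"


section \<open>Torus bundle groups\<close>

definition mat2 :: "int \<Rightarrow> int \<Rightarrow> int \<Rightarrow> int \<Rightarrow> int^2^2" where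
  "mat2 a b c d = vector [vector [a, b], vector [c, d]]"

definition mat_cong :: "int^2^2 \<Rightarrow> int^2^2 \<Rightarrow> int \<Rightarrow> bool" where
  "mat_cong A B n \<longleftrightarrow> (\<forall>i j. [A $ i $ j = B $ i $ j] (mod n))"

definition aut_power :: "int^2^2 \<Rightarrow> int \<Rightarrow> int^2 \<Rightarrow> int^2" where
  "aut_power A k = (if k \<ge> 0 then (\<lambda>v. A *v v) ^^ nat k
                             else (\<lambda>v. matrix_inv A *v v) ^^ nat (- k))"

text \<open>
  The element $(a^m b^n, t^k)$ is \<open>(vector [m, n], k)\<close>. The columns of the matrix are the images of
  $a$ and $b$.
\<close>

definition torus_bundle_group :: "int^2^2 \<Rightarrow> ((int^2) \<times> int) monoid" where
  "torus_bundle_group A =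
     \<lparr>carrier = UNIV,
      mult = (\<lambda>(g, k) (h, l). (g + aut_power A k h, k + l)),
      one = (0, 0)\<rparr>"

text \<open>
  For an invertible matrix \<open>A\<close> the first argument of each function below runs over $\det A = \pm 1$.
  The other two are a row of \<open>A\<close>, so one of them is odd, the numerators are even and \<open>div\<close> is
  exact.
\<close>

definition S_alpha_gamma :: "int \<Rightarrow> int \<Rightarrow> int \<Rightarrow> int" where
  "S_alpha_gamma D \<alpha> \<gamma> = (if D = 1 then (1 - \<alpha> - \<gamma> - \<alpha> * \<gamma>) div 2 else (- 1 + \<alpha> + \<gamma> - \<alpha> * \<gamma>) div 2)"

definition S_beta_delta :: "int \<Rightarrow> int \<Rightarrow> int \<Rightarrow> int" where
  "S_beta_delta D \<beta> \<delta> = (if D = 1 then (1 - \<beta> - \<delta> + \<beta> * \<delta>) div 2 else (- 1 + \<beta> + \<delta> + \<beta> * \<delta>) div 2)"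

end

theory Submission
  imports Defs
begin

text \<open>
  The bar complex of $G$ consists of the $G$-invariants of the acyclic complex of cochains with
  values in functions on $G$. Adjoining the generators $a$, $b$, $t$ one at a time gives three Wang
  sequences, because an infinite cyclic group acts freely by translation. They show that
  $H^n(G,\mathbb{Z}_2)$ vanishes for $n \ge 4$, that $H^3$ has dimension at most one and is detected
  by evaluating a transgression on the torus fiber, and that $H^2$ is spanned by an extension of the
  area form of the fiber together with the classes obtained from linear forms on the fiber by
  summing along powers of $\theta$; such a class is trivial iff the linear form lies in the image of
  $\theta^* - 1$. Explicit cocycles for all these classes give the products: the square of a degree
  one class is its Bockstein, and the pairing of degree one with degree two is read off on the
  fiber. In cases 2, 4 and 5 the class $\xi_2$ may be changed by $\xi_1$, so the coefficient in
  $\zeta_1 \xi_2$ can be prescribed. The resulting basis is matched with a spanning set of monomials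
  of the presented ring.
\<close>

text \<open>Modulo 2 the matrix \<theta> lies in GL_2(F_2), which is the symmetric group S_3. The
  identity, the three involutions and the two elements of order 3 give the six cases; \<theta>^* - 1
  has rank 0, 1, 2 on the linear forms of the fiber, so three presentations suffice. For an
  involution the line of invariant forms coincides with the image of \<theta>^* - 1, and this is
  what makes \<zeta>_1 \<zeta>_2 vanish. The determinant is 1 modulo 2 whatever its sign, hence the
  area class of the fiber is invariant and extends to G; the area form itself is not invariant as a
  cochain, so its cocycle needs a quadratic correction. The function n(n-1)/2 modulo 2, whose
  polarization is mn, is behind that correction, behind the vanishing of the square of the class
  dual to t, and behind the Bockstein. Values on generators separate degrees 0 and 1, evaluation on
  the fiber separates degree 3 and the area part of degree 2. The remaining classes of degree 2 have
  fiber evaluation 0, and their independence rests on the analysis of a hypothetical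
  primitive.\<close>

unbundle no fps_syntax

section \<open>Arithmetic in characteristic two\<close>

declare add_bit_eq_xor [simp del] mult_bit_eq_and [simp del]

lemma bit_add_self [simp]: "x + x = (0::bit)" by (cases x) auto
lemma bit_add_self_left [simp]: "x + (x + y) = (y::bit)"
  by (simp flip: add.assoc)
lemma bit_add_self_right [simp]: "x + y + x = (y::bit)"
  by (simp add: add.commute)
lemma bit_uminus [simp]: "- x = (x::bit)" by (cases x) auto
lemma bit_diff [simp]: "x - y = x + (y::bit)" by (cases x; cases y) auto
lemma bit_mult_self [simp]: "x * x = (x::bit)" by (cases x) auto
lemma bit_add_eq_0_iff: "x + y = 0 \<longleftrightarrow> x = (y::bit)" by (cases x; cases y) auto

section \<open>The mod 2 bar complex\<close>

text \<open>The coboundary without its first face. Peeling off the head of the list freezes it as an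
  argument of the cochain, so identities follow by list induction. The singleton clause supplies the
  last face, and no signs occur modulo 2.\<close>

fun inner_bd :: "('g, 'm) monoid_scheme \<Rightarrow> ('g list \<Rightarrow> bit) \<Rightarrow> 'g list \<Rightarrow> bit" where
  "inner_bd G f [] = 0"
| "inner_bd G f [x] = f []"
| "inner_bd G f (x # y # zs) = f ((x \<otimes>\<^bsub>G\<^esub> y) # zs) + inner_bd G (\<lambda>l. f (x # l)) (y # zs)"

lemma inner_bd_add:
  "inner_bd G (\<lambda>l. f l + g l) xs = inner_bd G f xs + inner_bd G g xs"
proof (induction G f xs arbitrary: g rule: inner_bd.induct)
  case (3 G f x y zs)
  show ?case unfolding inner_bd.simps "3.IH" by (simp add: ac_simps)
qed auto

lemma inner_bd_scale: "inner_bd G (\<lambda>l. c * f l) xs = c * inner_bd G f xs"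
  by (induction G f xs rule: inner_bd.induct) (auto simp: algebra_simps)

lemma inner_bd_cong:
  assumes "\<And>l. Suc (length l) = length xs \<Longrightarrow> f l = g l"
  shows "inner_bd G f xs = inner_bd G g xs"
  using assms
proof (induction G f xs arbitrary: g rule: inner_bd.induct)
  case (3 G f x y zs)
  have "inner_bd G (\<lambda>l. f (x # l)) (y # zs) = inner_bd G (\<lambda>l. g (x # l)) (y # zs)"
    by (rule "3.IH") (use "3.prems" in auto)
  then show ?case using "3.prems"[of "(x \<otimes>\<^bsub>G\<^esub> y) # zs"] by simp
qed auto

lemma inner_bd_zero [simp]: "inner_bd G (\<lambda>l. 0) xs = 0"
  using inner_bd_scale[of G 0 "\<lambda>_. 0" xs] by simp

lemma cup_product_Nil [simp]: "cup_product f g [] = f [] * g []"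
  by (simp add: cup_product_def)

lemma cup_product_Cons:
  "cup_product f g (x # xs) = f [] * g (x # xs) + cup_product (\<lambda>l. f (x # l)) g xs"
  unfolding cup_product_def by (simp add: sum.atMost_Suc_shift del: sum.atMost_Suc)

lemma cup_product_add_left:
  "cup_product (\<lambda>l. f l + g l) h xs = cup_product f h xs + cup_product g h xs"
  by (simp add: cup_product_def sum.distrib algebra_simps)

lemma cup_product_add_right:
  "cup_product f (\<lambda>l. g l + h l) xs = cup_product f g xs + cup_product f h xs"
  by (simp add: cup_product_def sum.distrib algebra_simps)

lemma cup_product_scale_left: "cup_product (\<lambda>l. c * f l) g xs = c * cup_product f g xs"
  by (simp add: cup_product_def sum_distrib_left algebra_simps)

lemma cup_product_assoc:
  "cup_product (cup_product f g) h xs = cup_product f (cup_product g h) xs"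
proof (induction xs arbitrary: f)
  case (Cons x xs)
  show ?case
    by (simp add: cup_product_Cons cup_product_add_left cup_product_scale_left Cons.IH algebra_simps)
qed (simp add: algebra_simps)

lemma cup_product_degree:
  assumes "cochain_degree m f" "cochain_degree n g"
  shows "cochain_degree (m + n) (cup_product f g)"
  unfolding cochain_degree_def cup_product_def
proof (intro allI impI sum.neutral ballI)
  fix xs :: "'a list" and k
  assume "length xs \<noteq> m + n" "k \<in> {..length xs}"
  then have "length (take k xs) \<noteq> m \<or> length (drop k xs) \<noteq> n" by auto
  then show "f (take k xs) * g (drop k xs) = 0"
    using assms by (auto simp: cochain_degree_def)
qed

lemma cup_product_split:
  assumes "cochain_degree m f" "length xs = m + n"
  shows "cup_product f g xs = f (take m xs) * g (drop m xs)"
proof -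
  have "cup_product f g xs = (\<Sum>k\<in>{m}. f (take k xs) * g (drop k xs))"
    unfolding cup_product_def
    by (rule sum.mono_neutral_right) (use assms in \<open>auto simp: cochain_degree_def\<close>)
  then show ?thesis by simp
qed

text \<open>With the whole type as carrier every list is a list over the carrier, which removes the
  membership side conditions in \<open>cochains\<close> and \<open>coboundary\<close>.\<close>

locale full_group = group G for G (structure) +
  assumes carrier_UNIV [simp]: "carrier G = UNIV"
begin

abbreviation bd where "bd \<equiv> inner_bd G"

abbreviation cob :: "('a list \<Rightarrow> bit) \<Rightarrow> 'a list \<Rightarrow> bit" where "cob \<equiv> coboundary G"

lemma inner_bd_sum:
  "xs \<noteq> [] \<Longrightarrow> bd f xs = (\<Sum>i = 1..<length xs.
      f (take (i - 1) xs @ [xs ! (i - 1) \<otimes> xs ! i] @ drop (i + 1) xs)) + f (butlast xs)"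
proof (induction xs arbitrary: f)
  case (Cons x xs)
  show ?case
  proof (cases xs)
    case (Cons y zs)
    have "(\<Sum>i = 1..<length (x # xs).
        f (take (i - 1) (x # xs) @ [(x # xs) ! (i - 1) \<otimes> (x # xs) ! i] @ drop (i + 1) (x # xs)))
      = (\<Sum>i = 0..<length xs.
        f (take i (x # xs) @ [(x # xs) ! i \<otimes> xs ! i] @ drop (i + 1) xs))"
      using sum.shift_bounds_Suc_ivl[of "\<lambda>i. f (take (i - 1) (x # xs) @ [(x # xs) ! (i - 1) \<otimes> (x # xs) ! i] @ drop (i + 1) (x # xs))" 0 "length xs"]
      by simp
    also have "\<dots> = f ((x \<otimes> y) # zs) + (\<Sum>i = 1..<length xs.
        f (take i (x # xs) @ [(x # xs) ! i \<otimes> xs ! i] @ drop (i + 1) xs))"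
      using Cons by (subst sum.atLeast_Suc_lessThan) auto
    also have "(\<Sum>i = 1..<length xs.
        f (take i (x # xs) @ [(x # xs) ! i \<otimes> xs ! i] @ drop (i + 1) xs))
        = (\<Sum>i = 1..<length xs.
      f (x # take (i - 1) xs @ [xs ! (i - 1) \<otimes> xs ! i] @ drop (i + 1) xs))"
      by (rule sum.cong) (auto simp: take_Cons nth_Cons split: nat.splits)
    finally show ?thesis
      using Cons.IH[of "\<lambda>l. f (x # l)"] Cons by (simp add: ac_simps)
  qed simp
qed simp

lemma coboundary_Nil [simp]: "coboundary G f [] = 0"
  by (simp add: coboundary_def)

lemma coboundary_Cons: "cob f (x # xs) = f xs + bd f (x # xs)"
  by (subst inner_bd_sum) (simp_all add: coboundary_def lists_eq_set ac_simps)

lemma coboundary_add: "cob (\<lambda>l. f l + g l) xs = cob f xs + cob g xs"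
  by (cases xs) (auto simp: coboundary_Cons inner_bd_add ac_simps)

lemma coboundary_scale: "cob (\<lambda>l. c * f l) xs = c * cob f xs"
  by (cases xs) (auto simp: coboundary_Cons inner_bd_scale algebra_simps)

lemma coboundary_cong:
  assumes "\<And>l. Suc (length l) = length xs \<Longrightarrow> f l = g l"
  shows "cob f xs = cob g xs"
proof (cases xs)
  case (Cons x ys)
  then show ?thesis using inner_bd_cong[of xs f g G, OF assms] assms[of ys]
    by (auto simp: coboundary_Cons)
qed simp

lemma coboundary_zero [simp]: "cob (\<lambda>l. 0) = (\<lambda>xs. 0)"
proof
  fix xs show "cob (\<lambda>l. 0) xs = 0" by (cases xs) (auto simp: coboundary_Cons)
qed

text \<open>Unfolding \<open>bd (bd f)\<close> once on \<open>x # y # zs\<close> gives the sum of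
  the two sides, so this is the vanishing of the square of \<open>bd\<close>. Associativity enters
  where three consecutive entries merge.\<close>

lemma inner_bd_inner_bd: "bd f ((x \<otimes> y) # zs) = bd (\<lambda>l. bd f (x # l)) (y # zs)"
proof (induction zs arbitrary: f x y)
  case (Cons z zs)
  show ?case by (simp add: inner_bd_add Cons.IH[symmetric] m_assoc)
qed simp

lemma coboundary_coboundary: "cob (cob f) xs = 0"
proof (cases xs)
  case (Cons x ys)
  show ?thesis
  proof (cases ys)
    case (Cons y zs)
    then show ?thesis using \<open>xs = x # ys\<close>
      by (simp add: coboundary_Cons inner_bd_inner_bd inner_bd_add)
  qed (simp add: Cons coboundary_Cons)
qed simp

text \<open>The last face of f before the cut and the first face of g after it agree and cancel. The
  first face of the whole list is absent from \<open>bd\<close>, hence only the second factor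
  carries the full coboundary.\<close>

lemma inner_bd_cup_product:
  "bd (cup_product f g) xs = cup_product (bd f) g xs + cup_product f (cob g) xs"
proof (induction xs arbitrary: f rule: induct_list012)
  case (3 x y zs)
  have eq: "cup_product f g (x # l) = f [] * g (x # l) + cup_product (\<lambda>l. f (x # l)) g l" for l
    by (rule cup_product_Cons)
  have "bd (cup_product f g) (x # y # zs) = f [] * g ((x \<otimes> y) # zs)
      + cup_product (\<lambda>l. f ((x \<otimes> y) # l)) g zs + f [] * bd (\<lambda>l. g (x # l)) (y # zs)
      + cup_product (bd (\<lambda>l. f (x # l))) g (y # zs) + cup_product (\<lambda>l. f (x # l)) (cob g) (y # zs)"
    by (simp add: eq inner_bd_add inner_bd_scale "3.IH"(2) cup_product_Cons[of f g "x \<otimes> y"] ac_simps)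
  moreover have "cup_product (bd f) g (x # y # zs) = f [] * g (y # zs)
      + cup_product (\<lambda>l. f ((x \<otimes> y) # l)) g zs + cup_product (bd (\<lambda>l. f (x # l))) g (y # zs)"
    by (simp add: cup_product_Cons cup_product_add_left ac_simps)
  moreover have "cup_product f (cob g) (x # y # zs) = f [] * g (y # zs) + f [] * g ((x \<otimes> y) # zs)
      + f [] * bd (\<lambda>l. g (x # l)) (y # zs) + cup_product (\<lambda>l. f (x # l)) (cob g) (y # zs)"
    by (subst cup_product_Cons) (simp add: coboundary_Cons algebra_simps)
  ultimately show ?case by (simp add: ac_simps)
qed (simp_all add: cup_product_Cons coboundary_Cons)

lemma coboundary_cup_product:
  "cob (cup_product f g) xs = cup_product (cob f) g xs + cup_product f (cob g) xs"
proof (cases xs)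
  case (Cons x ys)
  show ?thesis
    by (simp add: Cons coboundary_Cons inner_bd_cup_product cup_product_Cons[of "cob f"]
        cup_product_Cons[of "bd f"] cup_product_add_left ac_simps)
qed simp

lemma cochain_degree_coboundary:
  "cochain_degree n f \<Longrightarrow> cochain_degree (Suc n) (cob f)"
  unfolding cochain_degree_def
proof (intro allI impI)
  fix xs :: "'a list" assume f: "\<forall>xs. length xs \<noteq> n \<longrightarrow> f xs = 0" and l: "length xs \<noteq> Suc n"
  have "cob f xs = cob (\<lambda>_. 0) xs" by (rule coboundary_cong) (use f l in auto)
  then show "cob f xs = 0" by simp
qed

section \<open>The cohomology ring\<close>

lemma cochains_iff: "f \<in> cochains G \<longleftrightarrow> (\<exists>N. \<forall>xs. length xs > N \<longrightarrow> f xs = 0)"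
  by (simp add: cochains_def lists_eq_set)

lemma cochain_degree_imp_cochains: "cochain_degree n f \<Longrightarrow> f \<in> cochains G"
  unfolding cochains_iff cochain_degree_def by (metis nat_neq_iff)

lemma cochains_add:
  assumes "f \<in> cochains G" "g \<in> cochains G" shows "(\<lambda>xs. f xs + g xs) \<in> cochains G"
proof -
  obtain M N where "\<forall>xs. length xs > M \<longrightarrow> f xs = 0" "\<forall>xs. length xs > N \<longrightarrow> g xs = 0"
    using assms by (auto simp: cochains_iff)
  then have "\<forall>xs. length xs > max M N \<longrightarrow> f xs + g xs = 0" by simp
  then show ?thesis unfolding cochains_iff by blast
qed

lemma cochains_cup_product:
  fixes f g :: "'a list \<Rightarrow> bit"
  assumes "f \<in> cochains G" "g \<in> cochains G" shows "cup_product f g \<in> cochains G"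
proof -
  obtain M N where MN: "\<forall>xs. length xs > M \<longrightarrow> f xs = 0" "\<forall>xs. length xs > N \<longrightarrow> g xs = 0"
    using assms by (auto simp: cochains_iff)
  have "cup_product f g xs = 0" if "length xs > M + N" for xs
    unfolding cup_product_def
  proof (intro sum.neutral ballI)
    fix k assume "k \<in> {..length xs}"
    then have "length (take k xs) > M \<or> length (drop k xs) > N" using that by auto
    then show "f (take k xs) * g (drop k xs) = 0" using MN by auto
  qed
  then show ?thesis unfolding cochains_iff by blast
qed

lemma cochains_coboundary:
  assumes "f \<in> cochains G" shows "cob f \<in> cochains G"
proof -
  obtain N where N: "\<forall>xs. length xs > N \<longrightarrow> f xs = 0" using assms by (auto simp: cochains_iff)
  have "cob f xs = 0" if "length xs > Suc N" for xs
  proof -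
    have "cob f xs = cob (\<lambda>_. 0) xs" by (rule coboundary_cong) (use N that in auto)
    then show ?thesis by simp
  qed
  then show ?thesis unfolding cochains_iff by blast
qed

lemma cocyclesI: "f \<in> cochains G \<Longrightarrow> (\<And>xs. cob f xs = 0) \<Longrightarrow> f \<in> cocycles G"
  by (auto simp: cocycles_def)

lemma cocyclesD: "f \<in> cocycles G \<Longrightarrow> cob f xs = 0"
  by (auto simp: cocycles_def)

lemma cocycles_add:
  fixes f g :: "'a list \<Rightarrow> bit"
  assumes "f \<in> cocycles G" "g \<in> cocycles G" shows "(\<lambda>xs. f xs + g xs) \<in> cocycles G"
  using assms by (intro cocyclesI cochains_add) (auto simp: coboundary_add cocycles_def)

lemma cocycles_cup_product:
  fixes f g :: "'a list \<Rightarrow> bit"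
  assumes "f \<in> cocycles G" "g \<in> cocycles G" shows "cup_product f g \<in> cocycles G"
  using assms by (intro cocyclesI cochains_cup_product)
    (auto simp: coboundary_cup_product cocycles_def cup_product_def)

definition const_cochain :: "bit \<Rightarrow> 'a list \<Rightarrow> bit" where
  "const_cochain c xs = (if xs = [] then c else 0)"

lemma coboundary_const: "cob (const_cochain c) xs = 0"
proof (cases xs)
  case (Cons x ys)
  have "bd (const_cochain c) (x # y # zs) = 0" for y zs
  proof -
    have "(\<lambda>l. const_cochain c (x # l)) = (\<lambda>_. 0)" by (auto simp: const_cochain_def)
    then show ?thesis by (simp add: const_cochain_def)
  qed
  then show ?thesis using Cons by (cases ys) (auto simp: coboundary_Cons const_cochain_def)
qed simp

lemma cochain_degree_const: "cochain_degree 0 (const_cochain c)"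
  by (auto simp: cochain_degree_def const_cochain_def)

lemma const_cocycle: "const_cochain c \<in> cocycles G"
  by (intro cocyclesI cochain_degree_imp_cochains[OF cochain_degree_const] coboundary_const)

lemma cup_product_const_left: "cup_product (const_cochain c) f = (\<lambda>xs. c * f xs)"
proof
  fix xs
  have "cup_product (const_cochain c) f xs = (\<Sum>k\<in>{0}. const_cochain c (take k xs) * f (drop k xs))"
    unfolding cup_product_def by (rule sum.mono_neutral_right) (auto simp: const_cochain_def)
  then show "cup_product (const_cochain c) f xs = c * f xs" by (simp add: const_cochain_def)
qed

lemma cup_product_const_right: "cup_product f (const_cochain c) = (\<lambda>xs. c * f xs)"
proof
  fix xs
  have "cup_product f (const_cochain c) xs
      = (\<Sum>k\<in>{length xs}. f (take k xs) * const_cochain c (drop k xs))"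
    unfolding cup_product_def by (rule sum.mono_neutral_right) (auto simp: const_cochain_def)
  then show "cup_product f (const_cochain c) xs = c * f xs"
    by (simp add: const_cochain_def mult.commute)
qed

abbreviation CR :: "('a list \<Rightarrow> bit) ring" where "CR \<equiv> cocycle_ring G"
abbreviation HR :: "('a list \<Rightarrow> bit) set ring" where "HR \<equiv> cohomology_ring G"
abbreviation B :: "('a list \<Rightarrow> bit) set" where "B \<equiv> coboundaries G"

lemma cocycle_ring_simps [simp]:
  "carrier CR = cocycles G" "f \<otimes>\<^bsub>CR\<^esub> g = cup_product f g" "\<one>\<^bsub>CR\<^esub> = const_cochain 1"
  "\<zero>\<^bsub>CR\<^esub> = (\<lambda>xs. 0)" "f \<oplus>\<^bsub>CR\<^esub> g = (\<lambda>xs. f xs + g xs)"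
  by (auto simp: cocycle_ring_def const_cochain_def)

lemma zero_cocycle: "(\<lambda>xs. 0 :: bit) \<in> cocycles G"
  using const_cocycle[of 0] by (simp add: const_cochain_def[abs_def])

sublocale CR: ring CR
proof (rule ringI)
  show "abelian_group CR"
    by (rule abelian_groupI) (auto simp: cocycles_add zero_cocycle ac_simps
        intro!: bexI[where x = "_ :: 'a list \<Rightarrow> bit"])
  show "Group.monoid CR"
    by (rule monoidI) (auto simp: cocycles_cup_product const_cocycle cup_product_assoc
        cup_product_const_left cup_product_const_right)
qed (auto simp: cup_product_add_left cup_product_add_right)

lemma CR_a_inv [simp]: "f \<in> cocycles G \<Longrightarrow> \<ominus>\<^bsub>CR\<^esub> f = f"
  by (rule CR.minus_equality) auto

lemma coboundaries_subset: "B \<subseteq> cocycles G"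
  by (auto simp: coboundaries_def intro!: cocyclesI cochains_coboundary coboundary_coboundary)

lemma coboundaries_add: "f \<in> B \<Longrightarrow> g \<in> B \<Longrightarrow> (\<lambda>xs. f xs + g xs) \<in> B"
  unfolding coboundaries_def
  by (auto simp: image_iff coboundary_add[symmetric] intro!: bexI[OF _ cochains_add])

lemma zero_coboundary: "(\<lambda>xs. 0) \<in> B"
  unfolding coboundaries_def using coboundary_zero cochain_degree_imp_cochains[of 0 "\<lambda>_. 0"]
  by (force simp: cochain_degree_def)

sublocale B: ideal B CR
proof (rule idealI)
  show "subgroup B (add_monoid CR)"
    using coboundaries_subset zero_coboundary coboundaries_add
    by (intro CR.add.subgroupI) (auto simp: a_inv_def[symmetric] subset_iff)
next
  fix f g assume f: "f \<in> B" and g: "g \<in> carrier CR"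
  then obtain c where c: "c \<in> cochains G" "f = cob c" by (auto simp: coboundaries_def)
  have gc: "g \<in> cochains G" "\<And>xs. cob g xs = 0" "cob g = (\<lambda>xs. 0)" using g by (auto simp: cocycles_def)
  have "g \<otimes>\<^bsub>CR\<^esub> f = cob (cup_product g c)"
    using gc c by (auto simp: fun_eq_iff coboundary_cup_product cup_product_def)
  then show "g \<otimes>\<^bsub>CR\<^esub> f \<in> B" using gc c by (auto simp: coboundaries_def cochains_cup_product)
  have "f \<otimes>\<^bsub>CR\<^esub> g = cob (cup_product c g)"
    using gc c by (auto simp: fun_eq_iff coboundary_cup_product cup_product_def)
  then show "f \<otimes>\<^bsub>CR\<^esub> g \<in> B" using gc c by (auto simp: coboundaries_def cochains_cup_product)
qed (rule CR.ring_axioms)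

sublocale HR: ring HR
  unfolding cohomology_ring_def by (rule B.quotient_is_ring)

definition cls :: "('a list \<Rightarrow> bit) \<Rightarrow> ('a list \<Rightarrow> bit) set" where
  "cls f = B +>\<^bsub>CR\<^esub> f"

sublocale cls: ring_hom_ring CR HR cls
  unfolding cls_def cohomology_ring_def using B.rcos_ring_hom_ring by (simp add: eta_contract_eq)

lemma carrier_HR: "carrier HR = cls ` cocycles G"
  by (auto simp: cohomology_ring_def FactRing_def A_RCOSETS_def' cls_def)

lemma cohomology_component_eq:
  "cohomology_component G n = cls ` {f \<in> cocycles G. cochain_degree n f}"
  by (auto simp: cohomology_component_def cls_def)

lemma cls_eq_iff:
  assumes "f \<in> cocycles G" "g \<in> cocycles G"
  shows "cls f = cls g \<longleftrightarrow> (\<lambda>xs. f xs + g xs) \<in> B"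
  using CR.quotient_eq_iff_same_a_r_cos[OF B.ideal_axioms, of f g] assms
  by (simp add: cls_def a_minus_def)

lemma cls_eq_0_iff:
  assumes "f \<in> cocycles G" shows "cls f = \<zero>\<^bsub>HR\<^esub> \<longleftrightarrow> f \<in> B"
  using cls_eq_iff[OF assms zero_cocycle] cls.hom_zero by simp

lemma HR_add_self: "x \<in> carrier HR \<Longrightarrow> x \<oplus>\<^bsub>HR\<^esub> x = \<zero>\<^bsub>HR\<^esub>"
proof -
  assume "x \<in> carrier HR"
  then obtain f where f: "f \<in> cocycles G" "x = cls f" by (auto simp: carrier_HR)
  have "cls f \<oplus>\<^bsub>HR\<^esub> cls f = cls (f \<oplus>\<^bsub>CR\<^esub> f)" by (rule cls.hom_add[symmetric]) (use f in auto)
  then show ?thesis using f cls.hom_zero by simp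
qed

section \<open>Homogeneous components of cochains\<close>

definition degree_part :: "nat \<Rightarrow> ('a list \<Rightarrow> bit) \<Rightarrow> 'a list \<Rightarrow> bit" where
  "degree_part n f xs = (if length xs = n then f xs else 0)"

lemma cochain_degree_part: "cochain_degree n (degree_part n f)"
  by (simp add: cochain_degree_def degree_part_def)

lemma coboundary_degree_part: "cob (degree_part n f) xs = degree_part (Suc n) (cob f) xs"
proof (cases "length xs = Suc n")
  case True
  then show ?thesis unfolding degree_part_def by (auto intro!: coboundary_cong)
next
  case False
  have "cob (degree_part n f) xs = cob (\<lambda>_. 0) xs"
    by (rule coboundary_cong) (use False in \<open>auto simp: degree_part_def\<close>)
  then show ?thesis using False by (simp add: degree_part_def)
qed

lemma degree_part_cocycle: "f \<in> cocycles G \<Longrightarrow> degree_part n f \<in> cocycles G"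
  by (intro cocyclesI cochain_degree_imp_cochains[OF cochain_degree_part])
    (simp add: coboundary_degree_part, simp add: degree_part_def cocyclesD)

lemma cocycle_degreeI:
  assumes "cochain_degree n f" "\<And>xs. length xs = Suc n \<Longrightarrow> cob f xs = 0"
  shows "f \<in> cocycles G"
  using assms cochain_degree_coboundary[OF assms(1)]
  by (intro cocyclesI cochain_degree_imp_cochains) (auto simp: cochain_degree_def)

text \<open>Only the component of c in degree n - 1 contributes to \<open>cob c\<close> on lists of
  length n, so truncating c yields a primitive in \<open>cochains\<close>. In degree 0 coboundaries
  vanish.\<close>

lemma coboundary_degreeI:
  assumes f: "cochain_degree n f" "\<And>xs. length xs = n \<Longrightarrow> f xs = cob c xs"
  shows "f \<in> B"
proof (cases n)
  case 0
  then have "f xs = 0" for xs using f by (cases "xs = []") (auto simp: cochain_degree_def)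
  then have "f = (\<lambda>_. 0)" by auto
  then show ?thesis using zero_coboundary by simp
next
  case (Suc m)
  have "f = cob (degree_part m c)"
    using f Suc by (auto simp: fun_eq_iff coboundary_degree_part degree_part_def cochain_degree_def)
  then show ?thesis
    unfolding coboundaries_def using cochain_degree_imp_cochains[OF cochain_degree_part] by blast
qed

lemma coboundary_scaleI: "f \<in> B \<Longrightarrow> (\<lambda>xs. c * f xs) \<in> B"
  using zero_coboundary by (cases c) auto

text \<open>The primitives are cup-one products: f(x) w(x) for two homomorphisms and f(xy) w(x, y)
  for a 2-cocycle w. No other positive degrees matter once cohomology vanishes from degree 4
  on.\<close>

lemma hom_cup_commute:
  assumes f: "cochain_degree 1 f" "f \<in> cocycles G" and w: "cochain_degree n w" "w \<in> cocycles G"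
    and n: "n \<in> {1, 2}"
  shows "cls (cup_product f w) = cls (cup_product w f)"
proof -
  have hom: "f [x \<otimes> y] = f [x] + f [y]" for x y
    using cocyclesD[OF f(2), of "[x, y]"] by (simp add: coboundary_Cons bit_add_eq_0_iff ac_simps)
  have deg: "cochain_degree (Suc n) (\<lambda>xs. cup_product f w xs + cup_product w f xs)"
    using cup_product_degree[OF f(1) w(1)] cup_product_degree[OF w(1) f(1)]
    by (simp add: cochain_degree_def)
  have "(\<lambda>xs. cup_product f w xs + cup_product w f xs) \<in> B"
  proof (cases "n = 1")
    case True
    show ?thesis
    proof (rule coboundary_degreeI[OF deg])
      fix xs :: "'a list" assume "length xs = Suc n"
      then obtain x y where xs: "xs = [x, y]" using True by (auto simp: length_Suc_conv)
      have "w [x \<otimes> y] = w [x] + w [y]" 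
        using cocyclesD[OF w(2), of "[x, y]"] by (simp add: coboundary_Cons bit_add_eq_0_iff ac_simps)
      then show "cup_product f w xs + cup_product w f xs = cob (\<lambda>l. f [hd l] * w [hd l]) xs"
        using True w f cup_product_split[of 1 f xs 1 w] cup_product_split[of 1 w xs 1 f]
        by (simp add: xs coboundary_Cons hom algebra_simps)
    qed
  next
    case False
    then have n: "n = 2" using n by simp
    show ?thesis
    proof (rule coboundary_degreeI[OF deg])
      fix xs :: "'a list" assume "length xs = Suc n"
      then obtain x y z where xs: "xs = [x, y, z]"
        using n by (auto simp: length_Suc_conv numeral_eq_Suc)
      have "w [y, z] + w [x \<otimes> y, z] + w [x, y \<otimes> z] + w [x, y] = 0"
        using cocyclesD[OF w(2), of "[x, y, z]"] by (simp add: coboundary_Cons ac_simps)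
      then have "w [y, z] = w [x \<otimes> y, z] + w [x, y \<otimes> z] + w [x, y]"
        by (simp add: bit_add_eq_0_iff add.assoc)
      then show "cup_product f w xs + cup_product w f xs
          = cob (\<lambda>l. f [hd l] * w l + f [l ! 1] * w l) xs"
        using n w f cup_product_split[of 1 f xs 2 w] cup_product_split[of 2 w xs 1 f]
        by (simp add: xs coboundary_Cons hom algebra_simps numeral_eq_Suc)
    qed
  qed
  then show ?thesis using cls_eq_iff cocycles_cup_product f w by blast
qed

end

section \<open>Sums over integer intervals\<close>

text \<open>For negative k this is the sum from k to -1. The minus sign of the oriented sum
  disappears modulo 2, and so \<open>isum_step\<close> holds for every integer.\<close>

definition isum :: "(int \<Rightarrow> bit) \<Rightarrow> int \<Rightarrow> bit" where
  "isum e k = (if 0 \<le> k then \<Sum>i\<in>{0..<k}. e i else \<Sum>i\<in>{k..<0}. e i)"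

lemma isum_0 [simp]: "isum e 0 = 0"
  by (simp add: isum_def)

lemma isum_step: "isum e (k + 1) = isum e k + e k"
proof (cases "0 \<le> k")
  case True
  then have "{0..<k + 1} = insert k {0..<k}" by auto
  then show ?thesis using True by (simp add: isum_def ac_simps)
next
  case False
  then have *: "{k..<0} = insert k {k + 1..<0}" by auto
  have "isum e k = isum e (k + 1) + e k"
    using False unfolding isum_def by (subst *) (auto simp: ac_simps)
  then show ?thesis by (simp add: ac_simps)
qed

lemma isum_1 [simp]: "isum e 1 = e 0"
  using isum_step[of e 0] by simp

lemma int_step_eqI:
  fixes f g :: "int \<Rightarrow> bit"
  assumes "f 0 = g 0" "\<And>k. f (k + 1) + f k = g (k + 1) + g k"
  shows "f k = g k"
proof (induction k rule: int_induct[of _ 0])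
  case (step1 i)
  then show ?case using assms(2)[of i] by simp
next
  case (step2 i)
  then show ?case using assms(2)[of "i - 1"] by simp
qed (fact assms(1))

lemma isum_add: "isum e (l + k) = isum e l + isum (\<lambda>i. e (l + i)) k"
proof (rule int_step_eqI[of "\<lambda>k. isum e (l + k)"])
  fix k
  show "isum e (l + (k + 1)) + isum e (l + k) = isum e l + isum (\<lambda>i. e (l + i)) (k + 1)
      + (isum e l + isum (\<lambda>i. e (l + i)) k)"
    using isum_step[of e "l + k"] isum_step[of "\<lambda>i. e (l + i)" k]
    by (simp add: ac_simps)
qed simp

lemma isum_telescope: "isum (\<lambda>i. e (i + 1) + e i) k = e k + e 0"
  by (rule int_step_eqI[of _ "\<lambda>k. e k + e 0"]) (simp_all add: isum_step ac_simps)

lemma isum_distrib: "isum (\<lambda>i. e i + e' i) k = isum e k + isum e' k"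
  by (simp add: isum_def sum.distrib)

lemma isum_const: "isum (\<lambda>i. c) k = of_int k * c"
  by (rule int_step_eqI[of _ "\<lambda>k. of_int k * c"]) (simp_all add: isum_step algebra_simps)

lemma additive_int_eq:
  fixes f :: "int \<Rightarrow> bit"
  assumes "\<And>i j. f (i + j) = f i + f j"
  shows "f k = of_int k * f 1"
proof (rule int_step_eqI[of _ "\<lambda>k. of_int k * f 1"])
  show "f 0 = of_int 0 * f 1" using assms[of 0 0] by simp
qed (simp add: assms algebra_simps)

context full_group
begin

section \<open>Cochains with values in functions on the group\<close>

text \<open>A cochain \<open>\<Phi> g xs\<close> takes values in the functions of \<open>g\<close>, on which the group acts by left
  translation. Functions not depending on \<open>g\<close> form the bar complex with trivial coefficients,
  functions invariant under a subgroup compute the cohomology of that subgroup.\<close>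

definition cbd :: "('a \<Rightarrow> 'a list \<Rightarrow> bit) \<Rightarrow> 'a \<Rightarrow> 'a list \<Rightarrow> bit" where
  "cbd \<Phi> g xs = (case xs of [] \<Rightarrow> 0 | x # ys \<Rightarrow> \<Phi> (g \<otimes> x) ys + bd (\<Phi> g) xs)"

lemma cbd_Nil [simp]: "cbd \<Phi> g [] = 0"
  and cbd_Cons [simp]: "cbd \<Phi> g (x # ys) = \<Phi> (g \<otimes> x) ys + bd (\<Phi> g) (x # ys)"
  by (simp_all add: cbd_def)

lemma cbd_const: "cbd (\<lambda>_. f) g xs = cob f xs"
  by (cases xs) (simp_all add: coboundary_Cons)

lemma cbd_add: "cbd (\<lambda>g xs. \<Phi> g xs + \<Psi> g xs) g xs = cbd \<Phi> g xs + cbd \<Psi> g xs"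
  by (cases xs) (simp_all add: inner_bd_add ac_simps)

lemma cbd_translate: "cbd (\<lambda>g. \<Phi> (h \<otimes> g)) g xs = cbd \<Phi> (h \<otimes> g) xs"
  by (cases xs) (simp_all add: m_assoc)

lemma cbd_cong:
  assumes "\<And>g l. Suc (length l) = length xs \<Longrightarrow> \<Phi> g l = \<Psi> g l"
  shows "cbd \<Phi> g xs = cbd \<Psi> g xs"
proof (cases xs)
  case (Cons x ys)
  then show ?thesis using inner_bd_cong[of xs "\<Phi> g" "\<Psi> g" G] assms by auto
qed simp

lemma cbd_cbd: "cbd (cbd \<Phi>) g xs = 0"
proof (cases xs)
  case (Cons x ys)
  then show ?thesis by (cases ys) (simp_all add: inner_bd_inner_bd inner_bd_add m_assoc ac_simps)
qed simp

text \<open>Conditions are imposed in a single degree. The values on lists of other lengths stay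
  free, so the constructions below need no truncation.\<close>

definition ccocycle :: "nat \<Rightarrow> ('a \<Rightarrow> 'a list \<Rightarrow> bit) \<Rightarrow> bool" where
  "ccocycle n \<Phi> \<longleftrightarrow> (\<forall>g xs. length xs = Suc n \<longrightarrow> cbd \<Phi> g xs = 0)"

definition bounds :: "nat \<Rightarrow> ('a \<Rightarrow> 'a list \<Rightarrow> bit) \<Rightarrow> ('a \<Rightarrow> 'a list \<Rightarrow> bit) \<Rightarrow> bool" where
  "bounds n \<Phi> \<phi> \<longleftrightarrow> (\<forall>g xs. length xs = n \<longrightarrow> \<Phi> g xs = cbd \<phi> g xs)"

definition invariant :: "nat \<Rightarrow> 'a set \<Rightarrow> ('a \<Rightarrow> 'a list \<Rightarrow> bit) \<Rightarrow> bool" where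
  "invariant n S \<Phi> \<longleftrightarrow> (\<forall>h\<in>S. \<forall>g xs. length xs = n \<longrightarrow> \<Phi> (h \<otimes> g) xs = \<Phi> g xs)"

definition delta :: "'a \<Rightarrow> ('a \<Rightarrow> 'a list \<Rightarrow> bit) \<Rightarrow> 'a \<Rightarrow> 'a list \<Rightarrow> bit" where
  "delta h \<Phi> g xs = \<Phi> (h \<otimes> g) xs + \<Phi> g xs"

lemma boundsD: "bounds n \<Phi> \<phi> \<Longrightarrow> length xs = n \<Longrightarrow> \<Phi> g xs = cbd \<phi> g xs"
  by (simp add: bounds_def)

lemma invariantD: "invariant n S \<Phi> \<Longrightarrow> h \<in> S \<Longrightarrow> length xs = n \<Longrightarrow> \<Phi> (h \<otimes> g) xs = \<Phi> g xs"
  by (simp add: invariant_def)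

lemma invariant_subset: "invariant n S \<Phi> \<Longrightarrow> S' \<subseteq> S \<Longrightarrow> invariant n S' \<Phi>"
  by (auto simp: invariant_def)

lemma invariant_add:
  "invariant n S \<Phi> \<Longrightarrow> invariant n S \<Psi> \<Longrightarrow> invariant n S (\<lambda>g xs. \<Phi> g xs + \<Psi> g xs)"
  by (simp add: invariant_def)

lemma bounds_add:
  "bounds n \<Phi> \<phi> \<Longrightarrow> bounds n \<Psi> \<psi> \<Longrightarrow>
   bounds n (\<lambda>g xs. \<Phi> g xs + \<Psi> g xs) (\<lambda>g xs. \<phi> g xs + \<psi> g xs)"
  by (simp add: bounds_def cbd_add)

lemma ccocycle_add:
  "ccocycle n \<Phi> \<Longrightarrow> ccocycle n \<Psi> \<Longrightarrow> ccocycle n (\<lambda>g xs. \<Phi> g xs + \<Psi> g xs)"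
  by (simp add: ccocycle_def cbd_add)

lemma cbd_delta: "cbd (delta h \<Phi>) g xs = delta h (cbd \<Phi>) g xs"
proof -
  have "cbd (delta h \<Phi>) g xs = cbd (\<lambda>g xs. \<Phi> (h \<otimes> g) xs + \<Phi> g xs) g xs"
    by (simp add: delta_def[abs_def])
  then show ?thesis by (simp add: cbd_add cbd_translate delta_def)
qed

lemma ccocycle_delta_bound:
  assumes "bounds (Suc n) \<Phi> \<phi>" "invariant (Suc n) {h} \<Phi>"
  shows "ccocycle n (delta h \<phi>)"
  using assms by (simp add: ccocycle_def cbd_delta delta_def[of h "cbd \<phi>"] bounds_def invariant_def)

lemma invariant_delta:
  assumes "invariant n S \<Phi>" "\<And>k. k \<in> S \<Longrightarrow> \<exists>k'\<in>S. h \<otimes> k = k' \<otimes> h"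
  shows "invariant n S (delta h \<Phi>)"
  unfolding invariant_def
proof (intro ballI allI impI)
  fix k g and xs :: "'a list" assume k: "k \<in> S" and l: "length xs = n"
  obtain k' where k': "k' \<in> S" "h \<otimes> k = k' \<otimes> h" using assms(2)[OF k] by blast
  have "h \<otimes> (k \<otimes> g) = k' \<otimes> (h \<otimes> g)" using k' by (simp flip: m_assoc)
  then show "delta h \<Phi> (k \<otimes> g) xs = delta h \<Phi> g xs"
    using invariantD[OF assms(1) _ l] k k' by (simp add: delta_def)
qed

lemma invariant_cbd:
  assumes "invariant n S \<Phi>" shows "invariant (Suc n) S (cbd \<Phi>)"
  unfolding invariant_def
proof (intro ballI allI impI)
  fix h g and xs :: "'a list" assume h: "h \<in> S" and l: "length xs = Suc n"
  have "cbd \<Phi> (h \<otimes> g) xs = cbd (\<lambda>g. \<Phi> (h \<otimes> g)) g xs" by (simp add: cbd_translate)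
  also have "\<dots> = cbd \<Phi> g xs" by (rule cbd_cong) (use assms h l in \<open>auto simp: invariant_def\<close>)
  finally show "cbd \<Phi> (h \<otimes> g) xs = cbd \<Phi> g xs" .
qed

text \<open>Functions on G form a coinduced module, and inserting the base point as first entry is
  the contracting homotopy: the cocycle identity at \<one> on \<open>g # xs\<close> is the
  claim.\<close>

lemma exact_contraction:
  assumes "ccocycle (Suc n) \<Phi>"
  shows "bounds (Suc n) \<Phi> (\<lambda>g xs. \<Phi> \<one> (g # xs))"
  unfolding bounds_def
proof (intro allI impI)
  fix g and xs :: "'a list" assume "length xs = Suc n"
  then obtain x ys where xs: "xs = x # ys" by (cases xs) auto
  have "cbd \<Phi> \<one> (g # xs) = 0" using assms \<open>length xs = Suc n\<close> unfolding ccocycle_def by (metis length_Cons)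
  then show "\<Phi> g xs = cbd (\<lambda>g xs. \<Phi> \<one> (g # xs)) g xs"
    by (simp add: xs bit_add_eq_0_iff)
qed

text \<open>Right translation is transitive on G.\<close>

lemma ccocycle_0_const:
  assumes "ccocycle 0 \<Phi>" shows "\<Phi> g [] = \<Phi> \<one> []"
proof -
  have "cbd \<Phi> \<one> [g] = 0" using assms unfolding ccocycle_def by (metis length_Cons list.size(3))
  then show ?thesis by (simp add: bit_add_eq_0_iff)
qed

end

text \<open>An infinite cyclic group \<open>range s\<close> acting freely by left translation, with an equivariant
  coordinate \<open>\<kappa>\<close>, normalizing the subgroup generated by \<open>S\<close>. The operator \<open>delta (s 1)\<close> is onto on
  \<open>S\<close>-invariant cochains, which gives one step of the Wang sequence.\<close>

locale wang_step = full_group +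
  fixes s :: "int \<Rightarrow> 'a" and \<kappa> :: "'a \<Rightarrow> int" and S :: "'a set"
  assumes s_add: "s (i + j) = s i \<otimes> s j"
    and coord: "\<kappa> (s j \<otimes> g) = \<kappa> g + j"
    and coord_S: "h \<in> S \<Longrightarrow> \<kappa> (h \<otimes> g) = \<kappa> g"
    and normalizes: "h \<in> S \<Longrightarrow> \<exists>h'\<in>S. s j \<otimes> h = h' \<otimes> s j"
begin

text \<open>A discrete antiderivative: on each orbit \<phi> sums \<Psi> from the point with
  coordinate 0 up to g. Invariance under S survives because the cyclic group normalizes S.\<close>

lemma integrate:
  assumes "invariant n S \<Psi>"
  obtains \<phi> where "invariant n S \<phi>" "\<And>g xs. delta (s 1) \<phi> g xs = \<Psi> g xs"
proof
  define \<phi> where "\<phi> g xs = isum (\<lambda>j. \<Psi> (s (j - \<kappa> g) \<otimes> g) xs) (\<kappa> g)" for g xs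
  \<comment> \<open>Moving g by \<open>s 1\<close> raises its coordinate by one but keeps the
    summation points of the orbit, so exactly one new summand appears.\<close>
  have "s (j - (\<kappa> g + 1)) \<otimes> (s 1 \<otimes> g) = s (j - \<kappa> g) \<otimes> g" for j g
    using s_add[of "j - (\<kappa> g + 1)" 1] by (simp add: m_assoc)
  moreover have "s 0 \<otimes> g = g" for g
    using s_add[of 0 0] by (simp add: r_cancel_one)
  ultimately show "delta (s 1) \<phi> g xs = \<Psi> g xs" for g xs
    by (simp add: delta_def \<phi>_def coord isum_step add.commute[of "x + y" for x y :: bit])
  show "invariant n S \<phi>"
    unfolding invariant_def
  proof (intro ballI allI impI)
    fix h g and xs :: "'a list" assume h: "h \<in> S" and l: "length xs = n"
    have "\<Psi> (s i \<otimes> (h \<otimes> g)) xs = \<Psi> (s i \<otimes> g) xs" for i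
    proof -
      obtain h' where h': "h' \<in> S" "s i \<otimes> h = h' \<otimes> s i" using normalizes[OF h] by blast
      have "s i \<otimes> (h \<otimes> g) = h' \<otimes> (s i \<otimes> g)" using h' by (simp flip: m_assoc)
      then show ?thesis using invariantD[OF assms h'(1) l] by simp
    qed
    then show "\<phi> (h \<otimes> g) xs = \<phi> g xs" by (simp add: \<phi>_def coord_S[OF h])
  qed
qed

lemma normalizes_1: "k \<in> S \<Longrightarrow> \<exists>k'\<in>S. s 1 \<otimes> k = k' \<otimes> s 1"
  using normalizes by blast

lemma invariant_range:
  assumes "invariant n {s 1} \<Phi>" shows "invariant n (range s) \<Phi>"
proof -
  have "\<Phi> (s j \<otimes> g) xs = \<Phi> (s 0 \<otimes> g) xs" if "length xs = n" for j g xs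
  proof (rule int_step_eqI[where g = "\<lambda>_. \<Phi> (s 0 \<otimes> g) xs"])
    fix k show "\<Phi> (s (k + 1) \<otimes> g) xs + \<Phi> (s k \<otimes> g) xs = \<Phi> (s 0 \<otimes> g) xs + \<Phi> (s 0 \<otimes> g) xs"
      using invariantD[OF assms _ that, of "s 1" "s k \<otimes> g"] s_add[of 1 k]
      by (simp add: m_assoc add.commute)
  qed simp
  moreover have "s 0 \<otimes> g = g" for g
    using s_add[of 0 0] by (simp add: r_cancel_one)
  ultimately show ?thesis by (auto simp: invariant_def)
qed

text \<open>With \<nu> chosen such that \<open>delta (s 1) \<nu>\<close> is \<mu>, the primitive
  \<phi> + d\<nu> changes under \<open>s 1\<close> by d\<mu> + d\<mu> = 0. It still bounds \<Phi>
  because dd = 0.\<close>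

lemma descend:
  assumes \<phi>: "invariant (Suc n) S \<phi>" "bounds (Suc (Suc n)) \<Phi> \<phi>"
    and \<mu>: "invariant n S \<mu>" "bounds (Suc n) (delta (s 1) \<phi>) \<mu>"
  obtains \<phi>' where "invariant (Suc n) (S \<union> range s) \<phi>'" "bounds (Suc (Suc n)) \<Phi> \<phi>'"
proof -
  obtain \<nu> where \<nu>: "invariant n S \<nu>" "\<And>g xs. delta (s 1) \<nu> g xs = \<mu> g xs"
    using integrate[OF \<mu>(1)] by blast
  define \<phi>' where "\<phi>' g xs = \<phi> g xs + cbd \<nu> g xs" for g xs
  have "invariant (Suc n) S \<phi>'"
    unfolding \<phi>'_def by (intro invariant_add invariant_cbd \<phi> \<nu>)
  moreover have "delta (s 1) \<phi>' g xs = 0" if "length xs = Suc n" for g xs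
  proof -
    have "delta (s 1) \<phi>' g xs = delta (s 1) \<phi> g xs + cbd (delta (s 1) \<nu>) g xs"
      by (simp add: cbd_delta) (simp add: delta_def \<phi>'_def ac_simps)
    also have "delta (s 1) \<nu> = \<mu>" using \<nu>(2) by (simp add: fun_eq_iff)
    finally show ?thesis using boundsD[OF \<mu>(2) that] by simp
  qed
  then have "invariant (Suc n) {s 1} \<phi>'"
    by (simp add: invariant_def delta_def bit_add_eq_0_iff)
  then have "invariant (Suc n) (range s) \<phi>'" by (rule invariant_range)
  moreover have "bounds (Suc (Suc n)) \<Phi> \<phi>'"
    using \<phi>(2) by (simp add: bounds_def \<phi>'_def[abs_def] cbd_add cbd_cbd)
  ultimately show ?thesis using that[of \<phi>'] by (auto simp: invariant_def)
qed

text \<open>The change of \<phi> under \<open>s 1\<close> is a 0-cocycle, hence constant, and its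
  value at \<one> is 0 by the last hypothesis.\<close>

lemma descend_0:
  assumes \<phi>: "invariant 0 S \<phi>" "bounds 1 \<Phi> \<phi>" "invariant 1 {s 1} \<Phi>" "\<phi> (s 1) [] = \<phi> \<one> []"
  shows "invariant 0 (S \<union> range s) \<phi>"
proof -
  have "ccocycle 0 (delta (s 1) \<phi>)" using \<phi> by (intro ccocycle_delta_bound) auto
  then have "delta (s 1) \<phi> g [] = 0" for g
    using ccocycle_0_const[of "delta (s 1) \<phi>" g] \<phi>(4) by (simp add: delta_def)
  then have "invariant 0 {s 1} \<phi>" by (simp add: invariant_def delta_def bit_add_eq_0_iff)
  then have "invariant 0 (range s) \<phi>" by (rule invariant_range)
  then show ?thesis using \<phi>(1) by (auto simp: invariant_def)
qed

end

section \<open>Cohomological dimension of torus bundle groups\<close>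

lemma matrix_inv_inverse:
  fixes A :: "int^2^2"
  assumes "invertible A"
  shows "A ** matrix_inv A = mat 1" "matrix_inv A ** A = mat 1"
  using someI_ex[OF assms[unfolded invertible_def]] by (simp_all add: matrix_inv_def)

lemma matrix_inv_cancel:
  fixes A :: "int^2^2"
  assumes "invertible A"
  shows "A *v (matrix_inv A *v v) = v" "matrix_inv A *v (A *v v) = v"
  by (simp_all add: matrix_vector_mul_assoc matrix_inv_inverse[OF assms])

type_synonym torus_cochain = "((int^2) \<times> int) list \<Rightarrow> bit"

locale torus_bundle =
  fixes A :: "int^2^2"
  assumes invertible_A: "invertible A"
begin

abbreviation pow :: "int \<Rightarrow> int^2 \<Rightarrow> int^2" where "pow \<equiv> aut_power A"

abbreviation TG :: "((int^2) \<times> int) monoid" where "TG \<equiv> torus_bundle_group A"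

abbreviation torus_mult :: "(int^2) \<times> int \<Rightarrow> (int^2) \<times> int \<Rightarrow> (int^2) \<times> int" (infixl "\<cdot>" 70)
  where "g \<cdot> h \<equiv> g \<otimes>\<^bsub>TG\<^esub> h"

abbreviation neutral :: "(int^2) \<times> int" where "neutral \<equiv> \<one>\<^bsub>TG\<^esub>"

lemma pow_0 [simp]: "pow 0 v = v"
  by (simp add: aut_power_def)

lemma pow_step: "pow (k + 1) v = A *v pow k v"
proof (cases "0 \<le> k")
  case True
  then show ?thesis by (simp add: aut_power_def nat_add_distrib)
next
  case False
  then have "nat (- k) = Suc (nat (- (k + 1)))" by simp
  then show ?thesis
    using False invertible_A by (cases "k = - 1") (auto simp: aut_power_def matrix_inv_cancel)
qed

lemma pow_1 [simp]: "pow 1 v = A *v v"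
  using pow_step[of 0] by simp

lemma pow_add: "pow (k + l) v = pow k (pow l v)"
proof (induction k rule: int_induct[of _ 0])
  case (step1 i)
  then show ?case using pow_step[of "i + l" v] pow_step[of i "pow l v"] by (simp add: ac_simps)
next
  case (step2 i)
  have "A *v pow (i - 1 + l) v = A *v pow (i - 1) (pow l v)"
    using step2 pow_step[of "i - 1 + l" v] pow_step[of "i - 1" "pow l v"] by (simp add: algebra_simps)
  then show ?case using matrix_inv_cancel(2)[OF invertible_A] by metis
qed simp

lemma pow_plus: "pow k (v + w) = pow k v + pow k w"
proof (induction k rule: int_induct[of _ 0])
  case (step1 i)
  then show ?case by (simp add: pow_step matrix_vector_right_distrib)
next
  case (step2 i)
  have "A *v pow (i - 1) (v + w) = A *v (pow (i - 1) v + pow (i - 1) w)"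
    using step2 pow_step[of "i - 1"] by (simp add: matrix_vector_right_distrib)
  then show ?case using matrix_inv_cancel(2)[OF invertible_A] by metis
qed simp

lemma pow_zero [simp]: "pow k 0 = 0"
  using pow_plus[of k 0 0] by simp

lemma mult_TG [simp]: "(v, k) \<cdot> (w, l) = (v + pow k w, k + l)"
  and one_TG [simp]: "neutral = (0, 0)"
  and carrier_TG: "carrier TG = UNIV"
  by (simp_all add: torus_bundle_group_def)

lemma mult_TG': "g \<cdot> h = (fst g + pow (snd g) (fst h), snd g + snd h)"
  by (simp add: torus_bundle_group_def case_prod_beta)

sublocale full_group TG
proof -
  have "group TG"
  proof (rule groupI)
    fix x assume "x \<in> carrier TG"
    obtain v k where x: "x = (v, k)" by (cases x)
    have "pow (- k) v + pow (- k) (- v) = 0" by (simp flip: pow_plus)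
    then have "(pow (- k) (- v), - k) \<cdot> x = neutral"
      by (simp add: x add.commute)
    then show "\<exists>y\<in>carrier TG. y \<cdot> x = neutral" by (auto simp: carrier_TG)
  qed (auto simp: carrier_TG mult_TG' pow_add pow_plus add.assoc)
  then show "full_group TG" by (simp add: full_group_def full_group_axioms_def carrier_TG)
qed

definition sa :: "int \<Rightarrow> (int^2) \<times> int" where "sa i = (vector [i, 0], 0)"
definition sb :: "int \<Rightarrow> (int^2) \<times> int" where "sb i = (vector [0, i], 0)"
definition st :: "int \<Rightarrow> (int^2) \<times> int" where "st i = (0, i)"
definition fiber :: "((int^2) \<times> int) set" where "fiber = range (\<lambda>v. (v, 0))"

text \<open>The part already made invariant grows from nothing to <a> and then to the fiber. The
  normalizing condition comes from ab = ba at the second step and from t^j v = \<theta>^j(v) t^j at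
  the third.\<close>

sublocale wa: wang_step TG sa "\<lambda>g. vec_nth (fst g) 1" "{}"
  by unfold_locales (auto simp: sa_def vec_eq_iff forall_2)

sublocale wb: wang_step TG sb "\<lambda>g. vec_nth (fst g) 2" "range sa"
  by unfold_locales (auto simp: sa_def sb_def vec_eq_iff forall_2)

sublocale wt: wang_step TG st "snd" fiber
  by unfold_locales (auto simp: st_def fiber_def vec_eq_iff forall_2)

lemma fiber_eq: "fiber = {g \<cdot> h | g h. g \<in> range sa \<and> h \<in> range sb}"
proof (intro equalityI subsetI)
  fix g assume "g \<in> fiber"
  then obtain v where "g = (v, 0)" by (auto simp: fiber_def)
  then have "g = sa (v $ 1) \<cdot> sb (v $ 2)"
    by (auto simp: sa_def sb_def vec_eq_iff forall_2)
  then show "g \<in> {g \<cdot> h | g h. g \<in> range sa \<and> h \<in> range sb}" by blast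
next
  fix g assume "g \<in> {g \<cdot> h | g h. g \<in> range sa \<and> h \<in> range sb}"
  then obtain i j where "g = sa i \<cdot> sb j" by blast
  then show "g \<in> fiber" by (simp add: sa_def sb_def fiber_def)
qed

lemma invariant_mult:
  assumes "invariant n S \<Phi>" "invariant n T \<Phi>"
  shows "invariant n {g \<cdot> h | g h. g \<in> S \<and> h \<in> T} \<Phi>"
  unfolding invariant_def
proof (intro ballI allI impI)
  fix k g and xs :: "((int^2) \<times> int) list"
  assume "k \<in> {g \<cdot> h | g h. g \<in> S \<and> h \<in> T}" and l: "length xs = n"
  then obtain a b where "k = a \<cdot> b" "a \<in> S" "b \<in> T" by blast
  moreover have "(a \<cdot> b) \<cdot> g = a \<cdot> (b \<cdot> g)" by (rule m_assoc) auto
  ultimately show "\<Phi> (k \<cdot> g) xs = \<Phi> g xs"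
    using invariantD[OF assms(1) _ l] invariantD[OF assms(2) _ l] by metis
qed

lemma invariant_fiber: "invariant n (range sa \<union> range sb) \<Phi> \<Longrightarrow> invariant n fiber \<Phi>"
  unfolding fiber_eq by (rule invariant_mult) (erule invariant_subset; blast)+

lemma invariant_UNIV:
  assumes "invariant n (fiber \<union> range st) \<Phi>" shows "invariant n UNIV \<Phi>"
proof -
  have "g = (fst g, 0) \<cdot> st (snd g)" for g by (simp add: st_def)
  then have "UNIV \<subseteq> {g \<cdot> h | g h. g \<in> fiber \<and> h \<in> range st}"
    unfolding fiber_def by blast
  moreover have "invariant n {g \<cdot> h | g h. g \<in> fiber \<and> h \<in> range st} \<Phi>"
    by (rule invariant_mult) (rule invariant_subset[OF assms]; blast)+
  ultimately show ?thesis by (rule invariant_subset[rotated])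
qed

lemma range_sa_subset: "range sa \<subseteq> fiber" and range_sb_subset: "range sb \<subseteq> fiber"
  by (auto simp: sa_def sb_def fiber_def)

lemma invariant_fiberD:
  assumes "invariant n fiber \<Phi>"
  shows "invariant n (range sa) \<Phi>" "invariant n {sb 1} \<Phi>"
  by (rule invariant_subset[OF assms range_sa_subset],
      rule invariant_subset[OF assms]) (use range_sb_subset in auto)

section \<open>Exactness of cochains invariant under <a> and under the fiber\<close>

lemma ccocycle_1_one:
  assumes "ccocycle 1 \<Phi>" shows "\<Phi> neutral [neutral] = 0"
proof -
  have "cbd \<Phi> neutral [neutral, neutral] = 0"
    using assms unfolding ccocycle_def by (simp del: cbd_Cons)
  then show ?thesis by simp
qed

text \<open>The defect of the contraction under a is a cocycle of positive degree, which contracts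
  again. This is the vanishing of the cohomology of an infinite cyclic group from degree 2
  on.\<close>

lemma contraction_invariant:
  assumes "ccocycle (Suc (Suc n)) \<Phi>" "invariant (Suc (Suc n)) (range sa) \<Phi>"
  obtains \<phi> where "invariant (Suc n) (range sa) \<phi>" "bounds (Suc (Suc n)) \<Phi> \<phi>"
proof -
  define \<phi> where "\<phi> g xs = \<Phi> neutral (g # xs)" for g xs
  have 1: "bounds (Suc (Suc n)) \<Phi> \<phi>" unfolding \<phi>_def by (rule exact_contraction) (fact assms)
  have "ccocycle (Suc n) (delta (sa 1) \<phi>)"
    by (rule ccocycle_delta_bound[OF 1], rule invariant_subset[OF assms(2)]) blast
  from exact_contraction[OF this] obtain \<mu> where "bounds (Suc n) (delta (sa 1) \<phi>) \<mu>" by blast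
  with wa.descend[of n \<phi> \<Phi> \<mu>] 1 that show ?thesis by (auto simp: invariant_def)
qed

lemma exact_a_1:
  assumes "ccocycle 1 \<Phi>" "invariant 1 (range sa) \<Phi>" "\<Phi> neutral [sa 1] = 0"
  shows "invariant 0 (range sa) (\<lambda>g xs. \<Phi> neutral (g # xs))"
proof -
  have "bounds 1 \<Phi> (\<lambda>g xs. \<Phi> neutral (g # xs))"
    using exact_contraction[of 0 \<Phi>] assms by simp
  moreover have "invariant 1 {sa 1} \<Phi>" by (rule invariant_subset[OF assms(2)]) blast
  ultimately show ?thesis
    using wa.descend_0[of "\<lambda>g xs. \<Phi> neutral (g # xs)" \<Phi>] ccocycle_1_one[OF assms(1)] assms(3)
    by (simp add: invariant_def)
qed

text \<open>The contraction itself is the primitive. Its changes under a and b are constants, equal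
  to the values of \<Phi> on the two generators.\<close>

lemma exact_fiber_1:
  assumes "ccocycle 1 \<Phi>" "invariant 1 fiber \<Phi>" "\<Phi> neutral [sa 1] = 0" "\<Phi> neutral [sb 1] = 0"
  obtains \<phi> where "invariant 0 fiber \<phi>" "bounds 1 \<Phi> \<phi>"
proof
  show *: "bounds 1 \<Phi> (\<lambda>g xs. \<Phi> neutral (g # xs))"
    using exact_contraction[of 0 \<Phi>] assms by simp
  show "invariant 0 fiber (\<lambda>g xs. \<Phi> neutral (g # xs))"
  proof (rule invariant_fiber, rule wb.descend_0[OF _ *])
    show "invariant 0 (range sa) (\<lambda>g xs. \<Phi> neutral (g # xs))"
      using assms invariant_fiberD by (intro exact_a_1) auto
    show "invariant 1 {sb 1} \<Phi>" by (rule invariant_fiberD) (fact assms)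
  qed (use ccocycle_1_one[OF assms(1)] assms(4) in simp)
qed

text \<open>The defect of an a-invariant primitive under b is a 1-cocycle whose value at a is
  \<Phi>(a, b) + \<Phi>(b, a): the other terms cancel by ab = ba and a-invariance. This pairing with
  the fundamental class of the torus is the only obstruction.\<close>

lemma exact_fiber_2:
  assumes "ccocycle 2 \<Phi>" "invariant 2 fiber \<Phi>"
    and "\<Phi> neutral [sa 1, sb 1] + \<Phi> neutral [sb 1, sa 1] = 0"
  obtains \<phi> where "invariant 1 fiber \<phi>" "bounds 2 \<Phi> \<phi>"
proof -
  obtain \<phi> where \<phi>: "invariant 1 (range sa) \<phi>" "bounds 2 \<Phi> \<phi>"
    using contraction_invariant[of 0 \<Phi>] assms invariant_fiberD(1) by (auto simp: numeral_2_eq_2)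
  have inv: "invariant 2 {sb 1} \<Phi>" by (rule invariant_fiberD) (fact assms)
  have c: "ccocycle 1 (delta (sb 1) \<phi>)"
    using ccocycle_delta_bound[of 1 \<Phi> \<phi> "sb 1"] \<phi>(2) inv by (simp add: numeral_2_eq_2)
  have i: "invariant 1 (range sa) (delta (sb 1) \<phi>)"
    by (rule invariant_delta[OF \<phi>(1) wb.normalizes_1])
  have "\<Phi> neutral [sa 1, sb 1] = cbd \<phi> neutral [sa 1, sb 1]"
    "\<Phi> neutral [sb 1, sa 1] = cbd \<phi> neutral [sb 1, sa 1]"
    using \<phi>(2) by (auto intro: boundsD simp del: cbd_Cons)
  moreover have "\<phi> (sa 1 \<cdot> neutral) [sb 1] = \<phi> neutral [sb 1]"
    by (rule invariantD[OF \<phi>(1)]) auto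
  moreover have "sa 1 \<cdot> sb 1 = sb 1 \<cdot> sa 1"
    by (simp add: sa_def sb_def add.commute)
  ultimately have "delta (sb 1) \<phi> neutral [sa 1] = 0"
    using assms(3) by (simp add: delta_def ac_simps del: one_TG)
  from exact_a_1[OF c i this] exact_contraction[of 0 "delta (sb 1) \<phi>"] c
  obtain \<mu> where "invariant 0 (range sa) \<mu>" "bounds 1 (delta (sb 1) \<phi>) \<mu>" by auto
  with wb.descend[of 0 \<phi> \<Phi> \<mu>] \<phi> that show ?thesis
    by (auto simp: numeral_2_eq_2 intro: invariant_fiber)
qed

text \<open>Here the defect under b has degree at least 2, where cocycles invariant under <a> have
  invariant primitives.\<close>

lemma exact_fiber_ge_3:
  assumes "ccocycle (Suc (Suc (Suc n))) \<Phi>" "invariant (Suc (Suc (Suc n))) fiber \<Phi>"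
  obtains \<phi> where "invariant (Suc (Suc n)) fiber \<phi>" "bounds (Suc (Suc (Suc n))) \<Phi> \<phi>"
proof -
  obtain \<phi> where \<phi>: "invariant (Suc (Suc n)) (range sa) \<phi>" "bounds (Suc (Suc (Suc n))) \<Phi> \<phi>"
    using contraction_invariant[OF assms(1) invariant_fiberD(1)[OF assms(2)]] by blast
  have inv: "invariant (Suc (Suc (Suc n))) {sb 1} \<Phi>" by (rule invariant_fiberD) (fact assms)
  have c: "ccocycle (Suc (Suc n)) (delta (sb 1) \<phi>)"
    by (rule ccocycle_delta_bound[OF \<phi>(2) inv])
  have i: "invariant (Suc (Suc n)) (range sa) (delta (sb 1) \<phi>)"
    by (rule invariant_delta[OF \<phi>(1) wb.normalizes_1])
  obtain \<mu> where "invariant (Suc n) (range sa) \<mu>" "bounds (Suc (Suc n)) (delta (sb 1) \<phi>) \<mu>"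
    using contraction_invariant[OF c i] by blast
  with wb.descend[of "Suc n" \<phi> \<Phi> \<mu>] \<phi> that show ?thesis by (auto intro: invariant_fiber)
qed

text \<open>Invariance under all of G means independence of the base point, so the primitive is a
  cochain with trivial coefficients.\<close>

lemma invariant_UNIV_bounds:
  assumes "invariant n UNIV \<phi>" "bounds (Suc n) (\<lambda>_. f) \<phi>" "length xs = Suc n"
  shows "f xs = cob (\<phi> neutral) xs"
proof -
  have "f xs = cbd \<phi> neutral xs" using boundsD[OF assms(2,3)] .
  also have "\<dots> = cbd (\<lambda>_. \<phi> neutral) neutral xs"
  proof (rule cbd_cong)
    fix g and l :: "((int^2) \<times> int) list" assume "Suc (length l) = length xs"
    then show "\<phi> g l = \<phi> neutral l"
      using invariantD[OF assms(1), of g l "neutral"] assms(3) by (simp add: mult_TG')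
  qed
  finally show ?thesis by (simp add: cbd_const)
qed

lemma ccocycle_const_iff: "ccocycle n (\<lambda>_. f) \<longleftrightarrow> (\<forall>xs. length xs = Suc n \<longrightarrow> cob f xs = 0)"
  by (simp add: ccocycle_def cbd_const)

lemma invariant_const: "invariant n S (\<lambda>_. f)"
  by (simp add: invariant_def)

lemma descend_total:
  assumes "invariant (Suc n) fiber \<phi>" "bounds (Suc (Suc n)) (\<lambda>_. f) \<phi>"
    and "invariant n fiber \<mu>" "bounds (Suc n) (delta (st 1) \<phi>) \<mu>"
  obtains c where "\<And>xs. length xs = Suc (Suc n) \<Longrightarrow> f xs = cob c xs"
proof -
  obtain \<phi>' where \<phi>': "invariant (Suc n) (fiber \<union> range st) \<phi>'" "bounds (Suc (Suc n)) (\<lambda>_. f) \<phi>'"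
    using wt.descend[OF assms] by blast
  then show ?thesis using that invariant_UNIV_bounds[OF invariant_UNIV] by blast
qed

lemma delta_total:
  assumes "invariant (Suc n) fiber \<phi>" "bounds (Suc (Suc n)) (\<lambda>_. f) \<phi>"
  shows "ccocycle (Suc n) (delta (st 1) \<phi>)" "invariant (Suc n) fiber (delta (st 1) \<phi>)"
  by (rule ccocycle_delta_bound[OF assms(2) invariant_const],
      rule invariant_delta[OF assms(1) wt.normalizes_1])

lemma exact_total_ge_4:
  assumes n: "n \<ge> 4" and f: "\<And>xs. length xs = Suc n \<Longrightarrow> cob f xs = 0"
  obtains c where "\<And>xs. length xs = n \<Longrightarrow> f xs = cob c xs"
proof -
  obtain m where m: "n = Suc (Suc (Suc (Suc m)))"
    using that[of "n - 4"] n by simp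
  have "ccocycle n (\<lambda>_. f)" using f by (simp add: ccocycle_const_iff)
  then obtain \<phi> where \<phi>: "invariant (Suc (Suc (Suc m))) fiber \<phi>" "bounds n (\<lambda>_. f) \<phi>"
    using exact_fiber_ge_3[of "Suc m" "\<lambda>_. f"] invariant_const unfolding m by blast
  \<comment> \<open>The defect under t has degree n - 1, which is at least 3, so the fiber is exact
    in this degree as well. This is where the bound 4 comes from.\<close>
  obtain \<mu> where \<mu>: "invariant (Suc (Suc m)) fiber \<mu>"
    "bounds (Suc (Suc (Suc m))) (delta (st 1) \<phi>) \<mu>"
    using exact_fiber_ge_3[of m "delta (st 1) \<phi>"] delta_total[OF \<phi>[unfolded m]] by blast
  show ?thesis using descend_total[OF \<phi>[unfolded m] \<mu>] that unfolding m by blast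
qed

end

text \<open>A binomial coefficient modulo 2, used as a quadratic refinement of the product: its
  coboundary is (m, n) \<mapsto> mn, and on even integers it halves.\<close>

definition tri :: "int \<Rightarrow> bit" where "tri n = of_int (n * (n - 1) div 2)"

lemma tri_add: "tri (m + n) = tri m + tri n + of_int m * of_int n"
proof -
  have "even (m * (m - 1))" "even (n * (n - 1))" by auto
  then obtain i j where ij: "m * (m - 1) = 2 * i" "n * (n - 1) = 2 * j" by (elim evenE)
  have "(m + n) * (m + n - 1) = m * (m - 1) + n * (n - 1) + 2 * (m * n)" by (simp add: algebra_simps)
  also have "\<dots> = 2 * (i + j + m * n)" unfolding ij by (simp add: algebra_simps)
  finally have "(m + n) * (m + n - 1) div 2 = i + j + m * n" by simp
  moreover have "m * (m - 1) div 2 = i" "n * (n - 1) div 2 = j" unfolding ij by simp_all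
  ultimately show ?thesis unfolding tri_def by simp
qed

lemma tri_0 [simp]: "tri 0 = 0"
  by (simp add: tri_def)

lemma tri_double: "tri (2 * n) = of_int n"
proof -
  have "2 * n * (2 * n - 1) div 2 = n * (2 * n - 1)" by simp
  then show ?thesis by (simp add: tri_def)
qed

context torus_bundle
begin

section \<open>Explicit cocycles\<close>

subsection \<open>Low degree cocycle conditions\<close>

lemma cochain_degree_list_case [simp]:
  "cochain_degree (Suc 0) (\<lambda>xs. case xs of [x] \<Rightarrow> f x | _ \<Rightarrow> 0)"
  "cochain_degree 2 (\<lambda>xs. case xs of [x, y] \<Rightarrow> h x y | _ \<Rightarrow> 0)"
  by (auto simp: cochain_degree_def split: list.splits)

lemma length_1_E: "length xs = Suc 0 \<Longrightarrow> (\<And>x. xs = [x] \<Longrightarrow> P) \<Longrightarrow> P"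
  and length_2_E: "length xs = 2 \<Longrightarrow> (\<And>x y. xs = [x, y] \<Longrightarrow> P) \<Longrightarrow> P"
  and length_3_E: "length xs = 3 \<Longrightarrow> (\<And>x y z. xs = [x, y, z] \<Longrightarrow> P) \<Longrightarrow> P"
  by (auto simp: length_Suc_conv numeral_eq_Suc)

lemma cocycle_1I:
  fixes f :: "torus_cochain"
  assumes "cochain_degree 1 f" "\<And>x y. f [x \<cdot> y] = f [x] + f [y]"
  shows "f \<in> cocycles TG"
proof (rule cocycle_degreeI[OF assms(1)])
  fix xs :: "((int^2) \<times> int) list" assume "length xs = Suc 1"
  then obtain x y where "xs = [x, y]" by (auto elim: length_2_E simp flip: numeral_2_eq_2)
  then show "cob f xs = 0" using assms(2)[of x y] by (simp add: coboundary_Cons ac_simps)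
qed

lemma cocycle_1D:
  fixes f :: "torus_cochain"
  assumes "f \<in> cocycles TG" shows "f [x \<cdot> y] = f [x] + f [y]"
  using cocyclesD[OF assms, of "[x, y]"] by (simp add: coboundary_Cons bit_add_eq_0_iff ac_simps)

lemma cocycle_2I:
  fixes f :: "torus_cochain"
  assumes "cochain_degree 2 f"
    "\<And>x y z. f [y, z] + f [x \<cdot> y, z] + f [x, y \<cdot> z] + f [x, y] = 0"
  shows "f \<in> cocycles TG"
proof (rule cocycle_degreeI[OF assms(1)])
  fix xs :: "((int^2) \<times> int) list" assume "length xs = Suc 2"
  then obtain x y z where "xs = [x, y, z]" by (auto elim: length_3_E)
  then show "cob f xs = 0" using assms(2)[of y z x] by (simp add: coboundary_Cons ac_simps)
qed

lemma coboundary_2I: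
  assumes "cochain_degree 2 f" "\<And>x y. f [x, y] = c x + c y + c (x \<cdot> y)"
  shows "f \<in> B"
proof (rule coboundary_degreeI[OF assms(1)])
  fix xs :: "((int^2) \<times> int) list" assume "length xs = 2"
  then obtain x y where "xs = [x, y]" by (auto elim: length_2_E)
  then show "f xs = cob (\<lambda>l. c (hd l)) xs" by (simp add: coboundary_Cons assms(2) ac_simps)
qed

lemma coboundary_2E:
  assumes "f \<in> B"
  obtains c where "\<And>x y. f [x, y] = c x + c y + c (x \<cdot> y)"
proof -
  obtain c where "f = cob c" using assms by (auto simp: coboundaries_def)
  then show ?thesis using that[of "\<lambda>x. c [x]"] by (simp add: coboundary_Cons ac_simps)
qed

subsection \<open>Linear forms modulo two\<close>

definition lin :: "bit \<Rightarrow> bit \<Rightarrow> int^2 \<Rightarrow> bit" where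
  "lin c d v = c * of_int (v $ 1) + d * of_int (v $ 2)"

definition ent :: "2 \<Rightarrow> 2 \<Rightarrow> bit" where "ent i j = of_int (A $ i $ j)"

lemma lin_plus: "lin c d (v + w) = lin c d v + lin c d w"
  by (simp add: lin_def algebra_simps)

lemma lin_add: "lin (c + c') (d + d') v = lin c d v + lin c' d' v"
  by (simp add: lin_def algebra_simps)

lemma lin_0 [simp]: "lin 0 0 v = 0" by (simp add: lin_def)

lemma mult_vec_components:
  "(A *v v) $ 1 = A $ 1 $ 1 * v $ 1 + A $ 1 $ 2 * v $ 2"
  "(A *v v) $ 2 = A $ 2 $ 1 * v $ 1 + A $ 2 $ 2 * v $ 2"
  by (simp_all add: matrix_vector_mult_def sum_2)

lemma lin_mult_vec:
  "lin c d (A *v v) = lin (c * ent 1 1 + d * ent 2 1) (c * ent 1 2 + d * ent 2 2) v"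
  by (simp add: lin_def ent_def mult_vec_components algebra_simps)

lemma lin_basis [simp]: "lin c d (vector [1, 0]) = c" "lin c d (vector [0, 1]) = d"
  by (simp_all add: lin_def)

lemma additive_eq_lin:
  assumes "\<And>v w. u (v + w) = u v + (u w :: bit)"
  shows "u v = lin (u (vector [1, 0])) (u (vector [0, 1])) v"
proof -
  have 1: "u (vector [i, 0]) = of_int i * u (vector [1, 0])" for i
  proof (rule additive_int_eq[of "\<lambda>i. u (vector [i, 0])"])
    fix i j :: int
    have "vector [i + j, 0] = (vector [i, 0] + vector [j, 0] :: int^2)" by (simp add: vec_eq_iff forall_2)
    then show "u (vector [i + j, 0]) = u (vector [i, 0]) + u (vector [j, 0])" by (simp add: assms)
  qed
  have 2: "u (vector [0, i]) = of_int i * u (vector [0, 1])" for i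
  proof (rule additive_int_eq[of "\<lambda>i. u (vector [0, i])"])
    fix i j :: int
    have "vector [0, i + j] = (vector [0, i] + vector [0, j] :: int^2)" by (simp add: vec_eq_iff forall_2)
    then show "u (vector [0, i + j]) = u (vector [0, i]) + u (vector [0, j])" by (simp add: assms)
  qed
  have "v = vector [v $ 1, 0] + vector [0, v $ 2]" by (simp add: vec_eq_iff forall_2)
  then have "u v = u (vector [v $ 1, 0]) + u (vector [0, v $ 2])" using assms by metis
  then show ?thesis unfolding 1[of "v $ 1"] 2[of "v $ 2"] by (simp add: lin_def mult.commute)
qed

lemma ent_det: "ent 1 1 * ent 2 2 + ent 1 2 * ent 2 1 = 1"
proof -
  have "det A * det (matrix_inv A) = 1" by (metis matrix_inv_inverse(1) invertible_A det_I det_mul)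
  then have "of_int (det A) * (of_int (det (matrix_inv A)) :: bit) = 1" by (metis of_int_1 of_int_mult)
  then have "of_int (det A) = (1 :: bit)" by (cases "of_int (det A) :: bit") auto
  then show ?thesis by (simp add: det_2 ent_def)
qed

lemma det_A: "det A = 1 \<or> det A = - 1"
proof -
  have "det A * det (matrix_inv A) = 1" by (metis matrix_inv_inverse(1) invertible_A det_I det_mul)
  then show ?thesis by (simp add: zmult_eq_1_iff) blast
qed

subsection \<open>Crossed sums along the monodromy\<close>

text \<open>The value at t^k of the crossed homomorphism from <t> to functions on the fiber that
  sends t to u. Negative k are covered by the convention of \<open>isum\<close>.\<close>

definition crossed_sum :: "(int^2 \<Rightarrow> bit) \<Rightarrow> int \<Rightarrow> int^2 \<Rightarrow> bit" where
  "crossed_sum u k w = isum (\<lambda>i. u (pow i w)) k"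

lemma crossed_sum_0 [simp]: "crossed_sum u 0 w = 0" and crossed_sum_1 [simp]: "crossed_sum u 1 w = u w"
  by (simp_all add: crossed_sum_def)

lemma crossed_sum_add: "crossed_sum u (k + l) w = crossed_sum u l w + crossed_sum u k (pow l w)"
  using isum_add[of "\<lambda>i. u (pow i w)" l k] by (simp add: crossed_sum_def add.commute flip: pow_add)

lemma crossed_sum_plus:
  assumes "\<And>v w. u (v + w) = u v + u w + b v w"
  shows "crossed_sum u k (v + w) = crossed_sum u k v + crossed_sum u k w + isum (\<lambda>i. b (pow i v) (pow i w)) k"
  by (simp add: crossed_sum_def pow_plus assms isum_distrib)

lemma crossed_sum_lin_plus: "crossed_sum (lin c d) k (v + w) = crossed_sum (lin c d) k v + crossed_sum (lin c d) k w"
  using crossed_sum_plus[of "lin c d" "\<lambda>_ _. 0"] by (simp add: lin_plus isum_const)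

lemma crossed_sum_coboundary: "crossed_sum (\<lambda>v. u (A *v v) + u v) k w = u (pow k w) + u w"
  using isum_telescope[of "\<lambda>i. u (pow i w)" k] by (simp add: crossed_sum_def pow_step)

lemma crossed_sum_invariant:
  assumes "\<And>v. u (A *v v) = u v" shows "crossed_sum u k w = of_int k * u w" "u (pow k w) = u w"
proof -
  have inv: "u (pow k w) = u w" for k w
    using crossed_sum_coboundary[of u k w] assms by (simp add: crossed_sum_def isum_const bit_add_eq_0_iff)
  show "crossed_sum u k w = of_int k * u w" "u (pow k w) = u w" by (simp_all add: crossed_sum_def inv isum_const)
qed

subsection \<open>The cocycles\<close>

definition tau :: "torus_cochain" where
  "tau xs = (case xs of [x] \<Rightarrow> of_int (snd x) | _ \<Rightarrow> 0)"

definition form :: "bit \<Rightarrow> bit \<Rightarrow> torus_cochain" where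
  "form c d xs = (case xs of [x] \<Rightarrow> lin c d (fst x) | _ \<Rightarrow> 0)"

definition fixed :: "bit \<Rightarrow> bit \<Rightarrow> bool" where
  "fixed c d \<longleftrightarrow> c * ent 1 1 + d * ent 2 1 = c \<and> c * ent 1 2 + d * ent 2 2 = d"

text \<open>The image of a linear form under the map from H^1(<t>, H^1(fiber)) to H^2(G) of the Wang
  sequence, written in the bar complex.\<close>

definition crossed :: "bit \<Rightarrow> bit \<Rightarrow> torus_cochain" where
  "crossed c d xs = (case xs of [x, y] \<Rightarrow> crossed_sum (lin c d) (snd x) (fst y) | _ \<Rightarrow> 0)"

definition area_form :: "int^2 \<Rightarrow> int^2 \<Rightarrow> bit" where "area_form v w = of_int (v $ 1) * of_int (w $ 2)"

text \<open>The coboundary of \<open>area_defect\<close> is the change of \<open>area_form\<close> under the monodromy.\<close>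

definition area_defect :: "int^2 \<Rightarrow> bit" where
  "area_defect v = ent 1 1 * ent 2 1 * tri (v $ 1) + ent 1 2 * ent 2 2 * tri (v $ 2)
         + ent 1 2 * ent 2 1 * of_int (v $ 1) * of_int (v $ 2)"

text \<open>The first summand, the area form of v and \<theta>^k w, is not a cocycle alone, since
  \<theta> preserves the area form only up to a coboundary. The crossed sum of
  \<open>area_defect\<close> repairs this.\<close>

definition area :: "torus_cochain" where
  "area xs = (case xs of [x, y] \<Rightarrow> area_form (fst x) (pow (snd x) (fst y)) + crossed_sum area_defect (snd x) (fst y) | _ \<Rightarrow> 0)"

lemma degree_tau: "cochain_degree 1 tau" and degree_form: "cochain_degree 1 (form c d)"
  and degree_crossed: "cochain_degree 2 (crossed c d)" and degree_area: "cochain_degree 2 area"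
  by (simp_all add: tau_def[abs_def] form_def[abs_def] crossed_def[abs_def] area_def[abs_def])

lemma fixed_iff: "fixed c d \<longleftrightarrow> (\<forall>v. lin c d (A *v v) = lin c d v)"
proof
  show "fixed c d \<Longrightarrow> \<forall>v. lin c d (A *v v) = lin c d v" by (simp add: lin_mult_vec fixed_def)
  assume "\<forall>v. lin c d (A *v v) = lin c d v"
  then show "fixed c d" unfolding lin_mult_vec fixed_def using lin_basis by metis
qed

lemma tau_cocycle: "tau \<in> cocycles TG"
  by (rule cocycle_1I[OF degree_tau]) (simp add: tau_def mult_TG')

lemma form_cocycle: "fixed c d \<Longrightarrow> form c d \<in> cocycles TG"
  by (rule cocycle_1I[OF degree_form])
    (simp add: form_def mult_TG' lin_plus fixed_iff crossed_sum_invariant(2)[of "lin c d"])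

lemma crossed_cocycle: "crossed c d \<in> cocycles TG"
  by (rule cocycle_2I[OF degree_crossed])
    (simp add: crossed_def mult_TG' crossed_sum_add crossed_sum_lin_plus ac_simps)

lemma area_defect_plus: "area_defect (v + w) = area_defect v + area_defect w + (area_form (A *v v) (A *v w) + area_form v w)"
proof -
  \<comment> \<open>Replacing the coefficient 1 by the determinant modulo 2 symmetrizes the mixed
    terms. What remains are multiples of v_1 w_1, v_2 w_2 and v_1 w_2 + v_2 w_1, the polarizations
    of the three terms of \<open>area_defect\<close>.\<close>
  have "area_form v w = (ent 1 1 * ent 2 2 + ent 1 2 * ent 2 1) * area_form v w" by (simp add: ent_det)
  then show ?thesis
    by (simp add: area_defect_def tri_add mult_vec_components area_form_def algebra_simps flip: ent_def)
qed

lemma crossed_sum_area_defect_plus: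
  "crossed_sum area_defect k (v + w) = crossed_sum area_defect k v + crossed_sum area_defect k w + area_form (pow k v) (pow k w) + area_form v w"
  using isum_telescope[of "\<lambda>i. area_form (pow i v) (pow i w)" k]
  by (simp add: crossed_sum_plus[OF area_defect_plus] pow_step add.assoc)

lemma area_form_plus: "area_form (v + v') w = area_form v w + area_form v' w" "area_form v (w + w') = area_form v w + area_form v w'"
  by (simp_all add: area_form_def algebra_simps)

lemma area_cocycle: "area \<in> cocycles TG"
  by (rule cocycle_2I[OF degree_area])
    (simp add: area_def mult_TG' crossed_sum_add crossed_sum_area_defect_plus area_form_plus pow_plus pow_add ac_simps)

text \<open>For an invariant form the crossed sum is k times the form, so the two sides agree as
  cochains and not merely as classes.\<close>

lemma tau_eq_form_cup: "fixed c d \<Longrightarrow> cup_product tau (form c d) = crossed c d"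
proof
  fix xs assume "fixed c d"
  show "cup_product tau (form c d) xs = crossed c d xs"
  proof (cases "length xs = 2")
    case True
    then show ?thesis using \<open>fixed c d\<close>
      by (auto elim!: length_2_E simp: cup_product_Cons tau_def form_def crossed_def fixed_iff crossed_sum_invariant)
  next
    case False
    then show ?thesis using cup_product_degree[OF degree_tau degree_form] degree_crossed
      by (simp add: cochain_degree_def numeral_2_eq_2)
  qed
qed

lemma tau_cup_tau: "cup_product tau tau \<in> B"
proof (rule coboundary_2I)
  show "cochain_degree 2 (cup_product tau tau)"
    using cup_product_degree[OF degree_tau degree_tau] by (simp add: numeral_2_eq_2)
  show "cup_product tau tau [x, y] = tri (snd x) + tri (snd y) + tri (snd (x \<cdot> y))" for x y
    by (simp add: cup_product_Cons tau_def mult_TG' tri_add ac_simps)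
qed

text \<open>The square of a class is its Bockstein, computed from an integral lift of the linear form.\<close>

lemma form_cup_self:
  fixes c d c' d' :: int
  assumes "c * A $ 1 $ 1 + d * A $ 2 $ 1 = c + 2 * c'" "c * A $ 1 $ 2 + d * A $ 2 $ 2 = d + 2 * d'"
  shows "(\<lambda>xs. cup_product (form (of_int c) (of_int d)) (form (of_int c) (of_int d)) xs
          + crossed (of_int c') (of_int d') xs) \<in> B"
proof (rule coboundary_2I)
  define F U where "F v = c * v $ 1 + d * v $ 2" and "U v = c' * v $ 1 + d' * v $ 2" for v :: "int^2"
  have F: "of_int (F v) = lin (of_int c) (of_int d) v" and U: "of_int (U v) = lin (of_int c') (of_int d') v"
    for v by (simp_all add: F_def U_def lin_def)
  have F_mult: "F (A *v v) = F v + 2 * U v" for v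
  proof -
    have "F (A *v v) = (c * A $ 1 $ 1 + d * A $ 2 $ 1) * v $ 1 + (c * A $ 1 $ 2 + d * A $ 2 $ 2) * v $ 2"
      by (simp add: F_def mult_vec_components algebra_simps)
    then show ?thesis unfolding assms by (simp add: F_def U_def algebra_simps)
  qed
  have "fixed (of_int c) (of_int d)"
    unfolding fixed_iff using F_mult by (simp flip: F)
  then have inv: "lin (of_int c) (of_int d) (pow k w) = lin (of_int c) (of_int d) w" for k w
    by (simp add: fixed_iff crossed_sum_invariant(2)[of "lin (of_int c) (of_int d)"])
  \<comment> \<open>Modulo 2, tri(m + 2u) = tri(m) + u. Hence the form (c', d') is the change of
    tri(F v) under \<theta>, and its crossed sum telescopes.\<close>
  have "tri (F (A *v v)) + tri (F v) = lin (of_int c') (of_int d') v" for v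
    unfolding F_mult by (simp add: tri_add tri_double U)
  then have tri: "crossed_sum (lin (of_int c') (of_int d')) k w = tri (F (pow k w)) + tri (F w)" for k w
    using crossed_sum_coboundary[of "\<lambda>v. tri (F v)" k w] by (simp add: crossed_sum_def)
  show "cochain_degree 2 (\<lambda>xs. cup_product (form (of_int c) (of_int d)) (form (of_int c) (of_int d)) xs
          + crossed (of_int c') (of_int d') xs)"
    using cup_product_degree[OF degree_form degree_form] degree_crossed
    by (simp add: cochain_degree_def numeral_2_eq_2)
  have F_plus: "F (v + w) = F v + F w" for v w by (simp add: F_def algebra_simps)
  show "cup_product (form (of_int c) (of_int d)) (form (of_int c) (of_int d)) [x, y]
      + crossed (of_int c') (of_int d') [x, y]
    = tri (F (fst x)) + tri (F (fst y)) + tri (F (fst (x \<cdot> y)))" for x y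
    by (simp add: cup_product_Cons form_def crossed_def tri mult_TG' F_plus tri_add F inv ac_simps)
qed

lemma crossed_add: "crossed (c + c') (d + d') xs = crossed c d xs + crossed c' d' xs"
  by (auto simp: crossed_def crossed_sum_def lin_add isum_distrib split: list.splits)

lemma crossed_0: "crossed 0 0 = (\<lambda>_. 0)"
  by (auto simp: crossed_def crossed_sum_def isum_const fun_eq_iff split: list.splits)

text \<open>For a linear form u the primitive is (v, k) \<mapsto> u(v): the crossed sum of
  u(\<theta> v) - u(v) telescopes to u(\<theta>^k w) - u(w).\<close>

lemma crossed_coboundary: "crossed (c * ent 1 1 + d * ent 2 1 + c) (c * ent 1 2 + d * ent 2 2 + d) \<in> B"
proof (rule coboundary_2I[OF degree_crossed])
  have "lin (c * ent 1 1 + d * ent 2 1 + c) (c * ent 1 2 + d * ent 2 2 + d)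
      = (\<lambda>v. lin c d (A *v v) + lin c d v)"
    by (simp add: fun_eq_iff lin_add lin_mult_vec)
  then have "crossed (c * ent 1 1 + d * ent 2 1 + c) (c * ent 1 2 + d * ent 2 2 + d) [x, y]
    = lin c d (pow (snd x) (fst y)) + lin c d (fst y)" for x y
    by (simp add: crossed_def crossed_sum_coboundary)
  then show "crossed (c * ent 1 1 + d * ent 2 1 + c) (c * ent 1 2 + d * ent 2 2 + d) [x, y]
    = lin c d (fst x) + lin c d (fst y) + lin c d (fst (x \<cdot> y))" for x y
    by (simp add: mult_TG' lin_plus ac_simps)
qed

text \<open>The cocycle vanishes on the fiber, so a primitive restricts there to a linear form.
  Comparing both factorizations of t v = \<theta>(v) t exhibits (c, d) in the image of \<theta>^* -
  1.\<close>

lemma crossed_coboundaryD: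
  assumes "crossed c d \<in> B"
  obtains c' d' where "c = c' * ent 1 1 + d' * ent 2 1 + c'" "d = c' * ent 1 2 + d' * ent 2 2 + d'"
proof -
  obtain h where h: "\<And>x y. crossed c d [x, y] = h x + h y + h (x \<cdot> y)"
    using coboundary_2E[OF assms] by metis
  have "h (v + w, 0) = h (v, 0) + h (w, 0)" for v w
    using h[of "(v, 0)" "(w, 0)"] by (simp add: crossed_def bit_add_eq_0_iff)
  then obtain c' d' where lin: "h (v, 0) = lin c' d' v" for v
    using additive_eq_lin[of "\<lambda>v. h (v, 0)"] by blast
  have "lin c d v = lin c' d' (A *v v) + lin c' d' v" for v
  proof -
    have "lin c d v = h (0, 1) + lin c' d' v + h (A *v v, 1)"
      using h[of "(0, 1)" "(v, 0)"] by (simp add: crossed_def lin)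
    moreover have "0 = lin c' d' (A *v v) + h (0, 1) + h (A *v v, 1)"
      using h[of "(A *v v, 0)" "(0, 1)"] by (simp add: crossed_def lin)
    ultimately show ?thesis 
      by (cases "h (0, 1)"; cases "h (A *v v, 1)"; cases "lin c' d' (A *v v)") auto
  qed
  then have "lin c d v = lin (c' * ent 1 1 + d' * ent 2 1 + c') (c' * ent 1 2 + d' * ent 2 2 + d') v" for v
    by (simp add: lin_mult_vec lin_add)
  from this[of "vector [1, 0]"] this[of "vector [0, 1]"] that show ?thesis by simp
qed

text \<open>A homomorphism to Z_2 is determined on the fiber and on t, and t v = \<theta>(v) t
  forces its restriction to the fiber to be invariant.\<close>

lemma cocycle_1_cases:
  assumes "f \<in> cocycles TG" "cochain_degree 1 f"
  obtains c d e where "fixed c d" "f = (\<lambda>xs. form c d xs + e * tau xs)"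
proof -
  have hom: "f [x \<cdot> y] = f [x] + f [y]" for x y using cocycle_1D[OF assms(1)] .
  have "f [(v + w, 0)] = f [(v, 0)] + f [(w, 0)]" for v w
    using hom[of "(v, 0)" "(w, 0)"] by simp
  then obtain c d where lin: "f [(v, 0)] = lin c d v" for v
    using additive_eq_lin[of "\<lambda>v. f [(v, 0)]"] by blast
  have "f [(0, i + j)] = f [(0, i)] + f [(0, j)]" for i j
    using hom[of "(0, i)" "(0, j)"] by simp
  then have t: "f [(0, k)] = of_int k * f [(0, 1)]" for k
    by (rule additive_int_eq)
  have "lin c d (A *v v) = lin c d v" for v
    using hom[of "(0, 1)" "(v, 0)"] hom[of "(A *v v, 0)" "(0, 1)"] lin by (simp add: add.commute)
  then have "fixed c d" unfolding fixed_iff by blast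
  moreover have "f xs = form c d xs + f [(0, 1)] * tau xs" for xs
  proof (cases "length xs = Suc 0")
    case True
    then obtain v k where xs: "xs = [(v, k)]" by (metis length_1_E surj_pair)
    show ?thesis using hom[of "(v, 0)" "(0, k)"] lin t[of k] by (simp add: xs form_def tau_def mult.commute)
  next
    case False
    then show ?thesis using assms(2) degree_form degree_tau by (simp add: cochain_degree_def)
  qed
  ultimately show ?thesis using that by blast
qed

section \<open>Classification in degrees two and three\<close>

text \<open>Evaluation on the bar cycle [a|b] + [b|a], the fundamental class of the torus modulo
  2.\<close>

definition fiber_eval :: "(torus_cochain) \<Rightarrow> bit" where
  "fiber_eval f = f [sa 1, sb 1] + f [sb 1, sa 1]"

lemma fiber_eval_add: "fiber_eval (\<lambda>xs. f xs + g xs) = fiber_eval f + fiber_eval g"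
  and fiber_eval_scale: "fiber_eval (\<lambda>xs. c * f xs) = c * fiber_eval f"
  by (simp_all add: fiber_eval_def algebra_simps)

lemma fiber_eval_area: "fiber_eval area = 1" and fiber_eval_crossed: "fiber_eval (crossed c d) = 0"
  by (simp_all add: fiber_eval_def area_def crossed_def sa_def sb_def area_form_def)

lemma fiber_eval_coboundary: "f \<in> B \<Longrightarrow> fiber_eval f = 0"
  by (elim coboundary_2E) (simp add: fiber_eval_def sa_def sb_def ac_simps)

text \<open>A fiber-invariant primitive of \<open>crossed\<close>, with the t-coordinate of the base
  point as upper limit of summation. Its change under t, taken at the neutral element, is the linear
  form itself.\<close>

definition prim :: "bit \<Rightarrow> bit \<Rightarrow> (int^2) \<times> int \<Rightarrow> torus_cochain" where
  "prim c d g xs = (case xs of [x] \<Rightarrow> crossed_sum (lin c d) (snd g) (fst x) | _ \<Rightarrow> 0)"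

lemma invariant_prim: "invariant n fiber (prim c d)"
  by (auto simp: invariant_def fiber_def prim_def split: list.splits)

lemma bounds_prim: "bounds 2 (\<lambda>_. crossed c d) (prim c d)"
  unfolding bounds_def
proof (intro allI impI)
  fix g and xs :: "((int^2) \<times> int) list" assume "length xs = 2"
  then obtain x y where xs: "xs = [x, y]" by (auto elim: length_2_E)
  show "crossed c d xs = cbd (prim c d) g xs"
    using crossed_sum_add[of "lin c d" "snd g" "snd x" "fst y"]
    by (simp add: xs crossed_def prim_def mult_TG' crossed_sum_lin_plus ac_simps)
qed

lemma delta_prim: "delta (st 1) (prim c d) neutral [x] = lin c d (fst x)"
  by (simp add: delta_def prim_def st_def)

text \<open>Removing a multiple of \<open>area\<close> makes f exact on the fiber. The defect of a
  primitive under t is a fiber 1-cocycle; its values on a and b are the right choice of (c, d),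
  because adding \<open>prim c d\<close> cancels both.\<close>

lemma cocycle_2_cases:
  assumes f: "f \<in> cocycles TG" "cochain_degree 2 f"
  obtains c d where "(\<lambda>xs. f xs + fiber_eval f * area xs + crossed c d xs) \<in> B"
proof -
  define f' where "f' xs = f xs + fiber_eval f * area xs" for xs
  have cob: "cob f' xs = 0" for xs
    using cocyclesD[OF f(1)] cocyclesD[OF area_cocycle]
    by (simp add: f'_def[abs_def] coboundary_add coboundary_scale)
  have "fiber_eval f' = 0" by (simp add: f'_def[abs_def] fiber_eval_add fiber_eval_scale fiber_eval_area)
  then obtain \<phi> where \<phi>: "invariant 1 fiber \<phi>" "bounds 2 (\<lambda>_. f') \<phi>"
    using exact_fiber_2[of "\<lambda>_. f'"] cob invariant_const by (auto simp: ccocycle_const_iff fiber_eval_def)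
  define c d where "c = delta (st 1) \<phi> neutral [sa 1]" and "d = delta (st 1) \<phi> neutral [sb 1]"
  define \<psi> where "\<psi> g xs = \<phi> g xs + prim c d g xs" for g xs
  have \<psi>: "invariant 1 fiber \<psi>" "bounds 2 (\<lambda>_ xs. f' xs + crossed c d xs) \<psi>"
    unfolding \<psi>_def by (intro invariant_add bounds_add \<phi> invariant_prim bounds_prim)+
  have "delta (st 1) \<psi> neutral [x] = delta (st 1) \<phi> neutral [x] + lin c d (fst x)" for x
    using delta_prim[of c d x] by (simp add: delta_def \<psi>_def ac_simps)
  then have 0: "delta (st 1) \<psi> neutral [sa 1] = 0" "delta (st 1) \<psi> neutral [sb 1] = 0"
    by (simp_all add: c_def d_def sa_def[of 1] sb_def[of 1])
  obtain \<mu> where \<mu>: "invariant 0 fiber \<mu>" "bounds (Suc 0) (delta (st 1) \<psi>) \<mu>"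
    using exact_fiber_1[of "delta (st 1) \<psi>"] 0 delta_total[of 0 \<psi>] \<psi> by (auto simp: numeral_2_eq_2)
  obtain b where b: "\<And>xs. length xs = Suc (Suc 0) \<Longrightarrow> f' xs + crossed c d xs = cob b xs"
    using descend_total[of 0 \<psi> "\<lambda>xs. f' xs + crossed c d xs" \<mu>] \<psi> \<mu> by (auto simp: numeral_2_eq_2)
  have "(\<lambda>xs. f' xs + crossed c d xs) \<in> B"
  proof (rule coboundary_degreeI[where n = 2 and c = b])
    show "cochain_degree 2 (\<lambda>xs. f' xs + crossed c d xs)"
      using f(2) degree_area degree_crossed by (simp add: cochain_degree_def f'_def)
  qed (use b in \<open>simp add: numeral_2_eq_2\<close>)
  then show ?thesis using that by (simp add: f'_def)
qed

text \<open>The fundamental class: evaluate the transgression of a 3-cocycle on the torus fiber.\<close>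

definition transgresses :: "(torus_cochain) \<Rightarrow> bit \<Rightarrow> bool" where
  "transgresses f c \<longleftrightarrow> (\<exists>\<phi>. invariant 2 fiber \<phi> \<and> bounds 3 (\<lambda>_. f) \<phi>
      \<and> fiber_eval (delta (st 1) \<phi> neutral) = c)"

lemma fiber_eval_cbd:
  assumes "invariant 1 fiber \<nu>" shows "fiber_eval (cbd \<nu> neutral) = 0"
proof -
  have "\<nu> (sa 1 \<cdot> neutral) [sb 1] = \<nu> neutral [sb 1]" "\<nu> (sb 1 \<cdot> neutral) [sa 1] = \<nu> neutral [sa 1]"
    using range_sa_subset range_sb_subset by (intro invariantD[OF assms]; auto)+
  moreover have "sa 1 \<cdot> sb 1 = sb 1 \<cdot> sa 1"
    by (simp add: sa_def sb_def add.commute)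
  ultimately show ?thesis
    by (simp add: fiber_eval_def ac_simps del: one_TG)
qed

lemma fiber_eval_cong: "(\<And>xs. length xs = 2 \<Longrightarrow> f xs = g xs) \<Longrightarrow> fiber_eval f = fiber_eval g"
  by (simp add: fiber_eval_def)

text \<open>This makes the transgression independent of the primitive. A fiber-invariant 2-cocycle
  is a multiple of \<open>area\<close> plus a coboundary, and \<open>area\<close> does not depend on
  the base point, so t does not change it: \<theta> acts trivially on H^2 of the fiber.\<close>

lemma fiber_eval_delta_cocycle:
  assumes "invariant 2 fiber \<phi>" "ccocycle 2 \<phi>" shows "fiber_eval (delta (st 1) \<phi> neutral) = 0"
proof -
  define e where "e = fiber_eval (\<phi> neutral)"
  define z where "z g xs = \<phi> g xs + e * area xs" for g xs
  have "ccocycle 2 (\<lambda>_ xs. e * area xs)"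
    using cocyclesD[OF area_cocycle] by (simp add: ccocycle_const_iff coboundary_scale)
  then have "ccocycle 2 z" "invariant 2 fiber z"
    unfolding z_def using assms by (intro ccocycle_add invariant_add invariant_const; simp)+
  moreover have "fiber_eval (z neutral) = 0"
    by (simp add: z_def[abs_def] fiber_eval_add fiber_eval_scale fiber_eval_area e_def)
  ultimately obtain \<mu> where \<mu>: "invariant 1 fiber \<mu>" "bounds 2 z \<mu>"
    using exact_fiber_2[of z] by (auto simp: fiber_eval_def)
  have "fiber_eval (delta (st 1) \<phi> neutral) = fiber_eval (delta (st 1) z neutral)"
    by (rule fiber_eval_cong) (simp add: delta_def z_def ac_simps)
  also have "\<dots> = fiber_eval (cbd (delta (st 1) \<mu>) neutral)"
    by (rule fiber_eval_cong) (simp add: cbd_delta, simp add: delta_def boundsD[OF \<mu>(2)])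
  also have "\<dots> = 0"
    by (rule fiber_eval_cbd) (rule invariant_delta[OF \<mu>(1) wt.normalizes_1])
  finally show ?thesis .
qed

lemma transgresses_add:
  assumes "transgresses f c" "transgresses g d"
  shows "transgresses (\<lambda>xs. f xs + g xs) (c + d)"
proof -
  obtain \<phi> \<psi> where *: "invariant 2 fiber \<phi>" "bounds 3 (\<lambda>_. f) \<phi>" "fiber_eval (delta (st 1) \<phi> neutral) = c"
    "invariant 2 fiber \<psi>" "bounds 3 (\<lambda>_. g) \<psi>" "fiber_eval (delta (st 1) \<psi> neutral) = d"
    using assms by (auto simp: transgresses_def)
  have "fiber_eval (delta (st 1) (\<lambda>g xs. \<phi> g xs + \<psi> g xs) neutral)
      = fiber_eval (delta (st 1) \<phi> neutral) + fiber_eval (delta (st 1) \<psi> neutral)"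
    by (simp add: fiber_eval_def delta_def ac_simps)
  moreover have "invariant 2 fiber (\<lambda>g xs. \<phi> g xs + \<psi> g xs)"
    "bounds 3 (\<lambda>_ xs. f xs + g xs) (\<lambda>g xs. \<phi> g xs + \<psi> g xs)"
    by (intro invariant_add bounds_add *)+
  ultimately show ?thesis
    using * unfolding transgresses_def by (intro exI[of _ "\<lambda>g xs. \<phi> g xs + \<psi> g xs"]) simp
qed

text \<open>If the fiber evaluation of the defect under t is 0, the defect bounds on the fiber and
  the primitive descends to G. Conversely, a primitive on G is constant in the base point and has no
  defect.\<close>

lemma transgresses_0_iff:
  "transgresses f 0 \<longleftrightarrow> (\<exists>c. \<forall>xs. length xs = 3 \<longrightarrow> f xs = cob c xs)"
proof
  assume "transgresses f 0"
  then obtain \<phi> where \<phi>: "invariant 2 fiber \<phi>" "bounds 3 (\<lambda>_. f) \<phi>"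
    "fiber_eval (delta (st 1) \<phi> neutral) = 0" by (auto simp: transgresses_def)
  obtain \<mu> where \<mu>: "invariant 1 fiber \<mu>" "bounds 2 (delta (st 1) \<phi>) \<mu>"
    using exact_fiber_2[of "delta (st 1) \<phi>"] delta_total[of 1 \<phi> f] \<phi>
    by (auto simp: fiber_eval_def numeral_2_eq_2 numeral_3_eq_3)
  obtain c where "\<And>xs. length xs = Suc (Suc (Suc 0)) \<Longrightarrow> f xs = cob c xs"
    using descend_total[of "Suc 0" \<phi> f \<mu>] \<phi> \<mu>
    unfolding numeral_2_eq_2 numeral_3_eq_3 One_nat_def by blast
  then show "\<exists>c. \<forall>xs. length xs = 3 \<longrightarrow> f xs = cob c xs"
    unfolding numeral_3_eq_3 by blast
next
  assume "\<exists>c. \<forall>xs. length xs = 3 \<longrightarrow> f xs = cob c xs"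
  then obtain c where "\<forall>xs. length xs = 3 \<longrightarrow> f xs = cob c xs" by blast
  then have "bounds 3 (\<lambda>_. f) (\<lambda>_. c)" by (simp add: bounds_def cbd_const)
  moreover have "fiber_eval (delta (st 1) (\<lambda>_. c) neutral) = 0" by (simp add: fiber_eval_def delta_def)
  ultimately show "transgresses f 0" unfolding transgresses_def using invariant_const by blast
qed

lemma transgresses_unique:
  assumes "transgresses f c" "transgresses f d" shows "c = d"
proof -
  have "transgresses (\<lambda>_. 0) (c + d)" using transgresses_add[OF assms] by simp
  then obtain \<phi> where \<phi>: "invariant 2 fiber \<phi>" "bounds 3 (\<lambda>_ _. 0) \<phi>"
    "fiber_eval (delta (st 1) \<phi> neutral) = c + d" by (auto simp: transgresses_def)
  have "ccocycle 2 \<phi>" using \<phi>(2) by (simp add: bounds_def ccocycle_def)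
  then show ?thesis using fiber_eval_delta_cocycle[OF \<phi>(1)] \<phi>(3) by (simp add: bit_add_eq_0_iff)
qed

lemma transgresses_exists:
  assumes "f \<in> cocycles TG" shows "\<exists>c. transgresses f c"
proof -
  have "ccocycle 3 (\<lambda>_. f)" using cocyclesD[OF assms] by (simp add: ccocycle_const_iff)
  then obtain \<phi> where "invariant 2 fiber \<phi>" "bounds 3 (\<lambda>_. f) \<phi>"
    using exact_fiber_ge_3[of 0 "\<lambda>_. f"] invariant_const by (auto simp: numeral_2_eq_2 numeral_3_eq_3)
  then show ?thesis unfolding transgresses_def by blast
qed

definition top_eval :: "(torus_cochain) \<Rightarrow> bit" where
  "top_eval f = (THE c. transgresses f c)"

lemma top_eval_eq: "transgresses f c \<Longrightarrow> top_eval f = c"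
  unfolding top_eval_def using transgresses_unique by blast

lemma transgresses_top_eval: "f \<in> cocycles TG \<Longrightarrow> transgresses f (top_eval f)"
  using transgresses_exists top_eval_eq by blast

lemma top_eval_add:
  "f \<in> cocycles TG \<Longrightarrow> g \<in> cocycles TG \<Longrightarrow> top_eval (\<lambda>xs. f xs + g xs) = top_eval f + top_eval g"
  by (intro top_eval_eq transgresses_add transgresses_top_eval)

lemma top_eval_coboundary: "f \<in> B \<Longrightarrow> top_eval f = 0"
  by (rule top_eval_eq) (auto simp: transgresses_0_iff coboundaries_def)

lemma coboundary_iff_top_eval:
  assumes "f \<in> cocycles TG" "cochain_degree 3 f" shows "f \<in> B \<longleftrightarrow> top_eval f = 0"
proof
  assume "top_eval f = 0"
  then have "transgresses f 0" using transgresses_top_eval[OF assms(1)] by simp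
  then show "f \<in> B" using coboundary_degreeI[OF assms(2)] by (auto simp: transgresses_0_iff)
qed (rule top_eval_coboundary)

lemma top_eval_tau_cup:
  assumes "f \<in> cocycles TG" "cochain_degree 2 f"
  shows "top_eval (cup_product tau f) = fiber_eval f"
proof (rule top_eval_eq, unfold transgresses_def, intro exI conjI)
  \<comment> \<open>Multiplication of f by the t-coordinate gives a primitive whose change under t
    is f.\<close>
  define \<phi> where "\<phi> g xs = of_int (snd g) * f xs" for g :: "(int^2) \<times> int" and xs
  show "invariant 2 fiber \<phi>" by (auto simp: invariant_def fiber_def \<phi>_def)
  show "bounds 3 (\<lambda>_. cup_product tau f) \<phi>"
    unfolding bounds_def
  proof (intro allI impI)
    fix g and xs :: "((int^2) \<times> int) list" assume "length xs = 3"
    then obtain x y z where xs: "xs = [x, y, z]" by (auto elim: length_3_E)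
    have "cup_product tau f xs = tau [x] * f [y, z]"
      using cup_product_split[OF degree_tau, of xs 2 f] by (simp add: xs)
    moreover have "bd f xs = f [y, z]"
      using cocyclesD[OF assms(1), of xs] by (simp add: xs coboundary_Cons bit_add_eq_0_iff)
    ultimately show "cup_product tau f xs = cbd \<phi> g xs"
      using inner_bd_scale[of TG "of_int (snd g)" f xs]
      by (simp add: xs \<phi>_def[abs_def] mult_TG' tau_def algebra_simps del: inner_bd.simps)
  qed
  show "fiber_eval (delta (st 1) \<phi> neutral) = fiber_eval f"
    by (simp add: fiber_eval_def delta_def \<phi>_def st_def)
qed

lemma top_eval_crossed_cup:
  assumes "f \<in> cocycles TG" "cochain_degree 1 f"
  shows "top_eval (cup_product (crossed c d) f) = c * f [sb 1] + d * f [sa 1]"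
proof (rule top_eval_eq, unfold transgresses_def, intro exI conjI)
  \<comment> \<open>At the neutral element the change of this product under t is the linear form (c,
    d) times f. Its fiber evaluation is the determinant of the two.\<close>
  define \<phi> where "\<phi> g xs = prim c d g [hd xs] * f [xs ! 1]" for g xs
  show "invariant 2 fiber \<phi>" 
    using invariant_prim[of 1 c d] by (auto simp: invariant_def \<phi>_def)
  show "bounds 3 (\<lambda>_. cup_product (crossed c d) f) \<phi>"
    unfolding bounds_def
  proof (intro allI impI)
    fix g and xs :: "((int^2) \<times> int) list" assume "length xs = 3"
    then obtain x y z where xs: "xs = [x, y, z]" by (auto elim: length_3_E)
    have "cup_product (crossed c d) f xs = crossed c d [x, y] * f [z]"
      using cup_product_split[OF degree_crossed, of xs 1 c d f] by (simp add: xs numeral_2_eq_2)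
    also have "crossed c d [x, y] = cbd (prim c d) g [x, y]" by (rule boundsD[OF bounds_prim]) simp
    finally show "cup_product (crossed c d) f xs = cbd \<phi> g xs"
      using cocycle_1D[OF assms(1), of y z] by (simp add: xs \<phi>_def[abs_def] algebra_simps)
  qed
  show "fiber_eval (delta (st 1) \<phi> neutral) = c * f [sb 1] + d * f [sa 1]"
    by (simp add: fiber_eval_def delta_def \<phi>_def prim_def) (simp add: st_def sa_def sb_def)
qed

lemma coboundary_ge_4:
  assumes "f \<in> cocycles TG" "cochain_degree n f" "n \<ge> 4" shows "f \<in> B"
proof -
  obtain c where "\<And>xs. length xs = n \<Longrightarrow> f xs = cob c xs"
    using exact_total_ge_4[OF assms(3), of f] cocyclesD[OF assms(1)] by blast
  then show ?thesis by (rule coboundary_degreeI[OF assms(2)])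
qed

end

section \<open>Polynomials with coefficients modulo two\<close>

lemma poly_ring_simps [simp]:
  "p \<otimes>\<^bsub>poly_ring V\<^esub> q = p * q" "p \<oplus>\<^bsub>poly_ring V\<^esub> q = p + q"
  "\<one>\<^bsub>poly_ring V\<^esub> = 1" "\<zero>\<^bsub>poly_ring V\<^esub> = 0"
  by (simp_all add: poly_ring_def ring_of_type_algebra_def)

lemma carrier_poly_ring:
  "p \<in> carrier (poly_ring V) \<longleftrightarrow> (\<forall>m\<in>Poly_Mapping.keys p. Poly_Mapping.keys m \<subseteq> V)"
  by (simp add: poly_ring_def)

lemma poly_ring_closed [simp]:
  "0 \<in> carrier (poly_ring V)" "1 \<in> carrier (poly_ring V)"
  "Poly_Mapping.single 0 c \<in> carrier (poly_ring V)"
  "x \<in> V \<Longrightarrow> gen_var x \<in> carrier (poly_ring V)"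
  by (auto simp: carrier_poly_ring gen_var_def)

lemma poly_ring_add_closed [simp]:
  assumes "p \<in> carrier (poly_ring V)" "q \<in> carrier (poly_ring V)"
  shows "p + q \<in> carrier (poly_ring V)"
  using assms keys_add[of p q] by (auto simp: carrier_poly_ring)

lemma poly_ring_mult_closed [simp]:
  assumes "p \<in> carrier (poly_ring V)" "q \<in> carrier (poly_ring V)"
  shows "p * q \<in> carrier (poly_ring V)"
proof -
  have "Poly_Mapping.keys m \<subseteq> V" if m: "m \<in> Poly_Mapping.keys (p * q)" for m
  proof -
    obtain a b where "m = a + b" "a \<in> Poly_Mapping.keys p" "b \<in> Poly_Mapping.keys q"
      using keys_mult[of p q] m by auto
    then show ?thesis using assms keys_add[of a b] by (fastforce simp: carrier_poly_ring)
  qed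
  then show ?thesis by (simp add: carrier_poly_ring)
qed

lemma gen_poly_add_self [simp]: "p + p = (0 :: gen_poly)"
  by (rule poly_mapping_eqI) (simp only: lookup_add bit_add_self lookup_zero)

lemma gen_poly_two [simp]: "(2 :: gen_poly) = 0"
  using gen_poly_add_self[of 1] by (simp only: one_add_one)

lemma gen_poly_uminus [simp]: "- p = (p :: gen_poly)"
  by (rule minus_unique) simp

lemma gen_poly_diff [simp]: "p - q = p + (q :: gen_poly)"
  using diff_conv_add_uminus[of p q] by simp

lemma gen_poly_add_self_left [simp]: "p + (p + q) = (q :: gen_poly)"
  by (simp flip: add.assoc)

lemma gen_poly_of_int: "(of_int k :: gen_poly) = Poly_Mapping.single 0 (of_int k)"
  by simp

lemma poly_ring_of_int_closed [simp]: "of_int k \<in> carrier (poly_ring V)"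
  unfolding gen_poly_of_int by (rule poly_ring_closed)

lemma poly_ring_sum_closed [simp]:
  "(\<And>i. i \<in> S \<Longrightarrow> f i \<in> carrier (poly_ring V)) \<Longrightarrow> sum f S \<in> carrier (poly_ring V)"
  by (induction S rule: infinite_finite_induct) auto

lemma cring_poly_ring: "cring (poly_ring V)"
proof (rule cringI)
  show "abelian_group (poly_ring V)"
    by (rule abelian_groupI) (auto simp: ac_simps intro!: bexI[where x = "_ :: gen_poly"])
  show "comm_monoid (poly_ring V)"
    by (rule comm_monoidI) (auto simp: ac_simps)
qed (simp add: algebra_simps)

lemma gen_poly_induct [case_names zero add]:
  assumes "P 0" "\<And>m p. m \<notin> Poly_Mapping.keys p \<Longrightarrow> P p \<Longrightarrow> P (Poly_Mapping.single m 1 + p)"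
  shows "P (p :: gen_poly)"
proof (induction p rule: Poly_Mapping.update_induct)
  case (update p m b)
  have "Poly_Mapping.update m b p = Poly_Mapping.single m 1 + p"
    using update(1,2) by (intro poly_mapping_eqI)
      (auto simp: lookup_update lookup_add lookup_single when_def in_keys_iff)
  then show ?case using assms(2)[OF update(1,3)] by simp
qed (fact assms(1))

section \<open>Evaluation of polynomials in a ring of characteristic two\<close>

locale char2_evaluation = cring R for R (structure) +
  fixes h :: "gen \<Rightarrow> 'a"
  assumes h_closed: "h x \<in> carrier R" and add_self: "a \<in> carrier R \<Longrightarrow> a \<oplus> a = \<zero>"
begin

definition mon :: "(gen \<Rightarrow>\<^sub>0 nat) \<Rightarrow> 'a" where
  "mon m = finprod R (\<lambda>x. h x [^] Poly_Mapping.lookup m x) (Poly_Mapping.keys m)"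

text \<open>Every coefficient in the support is 1, so a sum of monomials suffices and no scalar
  action on R is required.\<close>

definition ev :: "gen_poly \<Rightarrow> 'a" where
  "ev p = finsum R mon (Poly_Mapping.keys p)"

lemma mon_closed [simp]: "mon m \<in> carrier R"
  unfolding mon_def by (rule finprod_closed) (simp add: h_closed)

lemma ev_closed [simp]: "ev p \<in> carrier R"
  unfolding ev_def by (rule finsum_closed) simp

lemma mon_superset:
  assumes "finite S" "Poly_Mapping.keys m \<subseteq> S"
  shows "mon m = finprod R (\<lambda>x. h x [^] Poly_Mapping.lookup m x) S"
  unfolding mon_def
  by (rule finprod_mono_neutral_cong_left) (use assms in \<open>auto simp: h_closed in_keys_iff\<close>)

lemma mon_add: "mon (m + n) = mon m \<otimes> mon n"
proof -
  define S where "S = Poly_Mapping.keys m \<union> Poly_Mapping.keys n"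
  have S: "finite S" "Poly_Mapping.keys m \<subseteq> S" "Poly_Mapping.keys n \<subseteq> S"
    "Poly_Mapping.keys (m + n) \<subseteq> S"
    using keys_add[of m n] by (auto simp: S_def)
  have "mon (m + n) = finprod R (\<lambda>x. (h x [^] Poly_Mapping.lookup m x) \<otimes> (h x [^] Poly_Mapping.lookup n x)) S"
    by (simp add: mon_superset[OF S(1,4)] lookup_add nat_pow_mult h_closed)
  also have "\<dots> = mon m \<otimes> mon n"
    by (simp add: mon_superset[OF S(1,2)] mon_superset[OF S(1,3)] finprod_multf h_closed)
  finally show ?thesis .
qed

lemma mon_0: "mon 0 = \<one>"
  by (simp add: mon_def)

lemma mon_single: "mon (Poly_Mapping.single x 1) = h x"
  by (simp add: mon_def h_closed)

lemma ev_superset: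
  assumes "finite S" "Poly_Mapping.keys p \<subseteq> S"
  shows "ev p = finsum R (\<lambda>m. if Poly_Mapping.lookup p m = 1 then mon m else \<zero>) S"
  unfolding ev_def
  by (rule add.finprod_mono_neutral_cong_left) (use assms in \<open>auto simp: in_keys_iff\<close>)

lemma ev_add: "ev (p + q) = ev p \<oplus> ev q"
proof -
  define S where "S = Poly_Mapping.keys p \<union> Poly_Mapping.keys q"
  have S: "finite S" "Poly_Mapping.keys p \<subseteq> S" "Poly_Mapping.keys q \<subseteq> S"
    "Poly_Mapping.keys (p + q) \<subseteq> S"
    using keys_add[of p q] by (auto simp: S_def)
  have "ev (p + q) = finsum R (\<lambda>m. (if Poly_Mapping.lookup p m = 1 then mon m else \<zero>) \<oplus>
      (if Poly_Mapping.lookup q m = 1 then mon m else \<zero>)) S"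
    unfolding ev_superset[OF S(1,4)]
    by (rule add.finprod_cong') (auto simp: lookup_add add_self)
  also have "\<dots> = ev p \<oplus> ev q"
    by (simp add: ev_superset[OF S(1,2)] ev_superset[OF S(1,3)] finsum_addf)
  finally show ?thesis .
qed

lemma ev_0 [simp]: "ev 0 = \<zero>"
  by (simp add: ev_def)

lemma ev_monomial: "ev (Poly_Mapping.single m 1) = mon m"
  by (simp add: ev_def)

lemma ev_1: "ev 1 = \<one>"
  by (simp add: ev_def mon_0)

lemma ev_gen_var: "ev (gen_var x) = h x"
  using ev_monomial mon_single by (simp add: gen_var_def)

lemma ev_monomial_mult: "ev (Poly_Mapping.single m 1 * q) = mon m \<otimes> ev q"
proof (induction q rule: gen_poly_induct)
  case (add n q)
  then show ?case
    using ev_monomial[of "m + n"]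
    by (simp add: algebra_simps mult_single ev_add mon_add r_distr ev_monomial)
qed simp

lemma ev_mult: "ev (p * q) = ev p \<otimes> ev q"
proof (induction p rule: gen_poly_induct)
  case (add n p)
  then show ?case by (simp add: distrib_right ev_add l_distr ev_monomial ev_monomial_mult)
qed simp

lemma ev_ring_hom: "ring_hom_ring (poly_ring V) R ev"
  by (intro ring_hom_ringI2 ring_hom_memI)
    (auto simp: ev_mult ev_add ev_1 cring.axioms(1)[OF cring_poly_ring] ring_axioms)

end

section \<open>A criterion for presentations\<close>

text \<open>Cocycles vanish on long lists, so finitely many homogeneous components, again cocycles,
  add up to f.\<close>

lemma (in full_group) cocycle_induct [consumes 1, case_names zero homogeneous add]:
  assumes f: "f \<in> cocycles G" and P0: "P (\<lambda>_. 0)"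
    and Ph: "\<And>n f. f \<in> cocycles G \<Longrightarrow> cochain_degree n f \<Longrightarrow> P f"
    and Padd: "\<And>f g. f \<in> cocycles G \<Longrightarrow> g \<in> cocycles G \<Longrightarrow> P f \<Longrightarrow> P g \<Longrightarrow> P (\<lambda>xs. f xs + g xs)"
  shows "P (f :: 'a list \<Rightarrow> bit)"
proof -
  obtain N where N: "\<And>xs. length xs > N \<Longrightarrow> f xs = 0"
    using f by (auto simp: cocycles_def cochains_iff)
  define t where "t n xs = (if length xs < n then f xs else 0)" for n xs
  have "t n \<in> cocycles G \<and> P (t n)" for n
  proof (induction n)
    case 0
    have "t 0 = (\<lambda>_. 0)" by (simp add: t_def fun_eq_iff)
    then show ?case using P0 zero_cocycle by simp
  next
    case (Suc n)
    have "t (Suc n) = (\<lambda>xs. t n xs + degree_part n f xs)"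
      by (auto simp: t_def degree_part_def fun_eq_iff)
    then show ?case
      using Suc Padd Ph degree_part_cocycle[OF f] cochain_degree_part cocycles_add by metis
  qed
  moreover have "t (Suc N) = f" using N by (auto simp: fun_eq_iff t_def)
  ultimately show ?thesis by metis
qed

text \<open>The assignment z is total on \<open>gen\<close>. In the applications, generators outside
  V are sent to the zero cochain.\<close>

locale cohomology_evaluation = full_group G for G (structure) +
  fixes z :: "gen \<Rightarrow> 'a list \<Rightarrow> bit"
  assumes cring_HR: "cring HR"
    and z_cocycle: "z x \<in> cocycles G" and z_degree: "cochain_degree (gen_dim x) (z x)"
begin

sublocale ev: char2_evaluation HR "\<lambda>x. cls (z x)"
  using cring_HR z_cocycle HR_add_self
  by (auto simp: char2_evaluation_def char2_evaluation_axioms_def carrier_HR)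

abbreviation ev where "ev \<equiv> ev.ev"

definition represents :: "gen_poly \<Rightarrow> ('a list \<Rightarrow> bit) \<Rightarrow> bool" where
  "represents p f \<longleftrightarrow> f \<in> cocycles G \<and> ev p = cls f"

lemma represents_gen_var: "represents (gen_var x) (z x)"
  by (simp add: represents_def z_cocycle ev.ev_gen_var)

lemma represents_add:
  "represents p f \<Longrightarrow> represents q g \<Longrightarrow> represents (p + q) (\<lambda>xs. f xs + g xs)"
  using cls.hom_add[of f g] by (auto simp: represents_def ev.ev_add cocycles_add)

lemma represents_mult:
  "represents p f \<Longrightarrow> represents q g \<Longrightarrow> represents (p * q) (cup_product f g)"
  using cls.hom_mult[of f g] by (auto simp: represents_def ev.ev_mult cocycles_cup_product)

lemma represents_0: "represents 0 (\<lambda>_. 0)"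
  using cls.hom_zero by (simp add: represents_def zero_cocycle)

lemma represents_const: "represents (Poly_Mapping.single 0 c) (const_cochain c)"
proof (cases c)
  case one
  then show ?thesis using cls.hom_one ev.ev_1 by (simp add: represents_def const_cocycle)
next
  case zero
  have "const_cochain 0 = (\<lambda>_. 0)" by (auto simp: const_cochain_def)
  then show ?thesis using zero represents_0 by simp
qed

lemma represents_scale:
  "represents p f \<Longrightarrow> represents (Poly_Mapping.single 0 c * p) (\<lambda>xs. c * f xs)"
  using represents_mult[OF represents_const] by (simp add: cup_product_const_left)

lemma represents_of_int_mult:
  "represents p f \<Longrightarrow> represents (of_int k * p) (\<lambda>xs. of_int k * f xs)"
  unfolding gen_poly_of_int by (rule represents_scale)

lemma represents_sum:
  fixes k :: nat
  assumes "\<And>i. i < k \<Longrightarrow> represents (e i) (f i)"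
  shows "represents (\<Sum>i<k. Poly_Mapping.single 0 (c i) * e i) (\<lambda>xs. \<Sum>i<k. c i * f i xs)"
  using assms by (induction k) (simp_all add: represents_0 represents_add represents_scale)

lemma ev_eq_0_iff: "represents p f \<Longrightarrow> ev p = \<zero>\<^bsub>HR\<^esub> \<longleftrightarrow> f \<in> B"
  by (auto simp: represents_def cls_eq_0_iff)

lemma component_add:
  assumes "a \<in> cohomology_component G n" "b \<in> cohomology_component G n"
  shows "a \<oplus>\<^bsub>HR\<^esub> b \<in> cohomology_component G n"
proof -
  obtain f g where fg: "a = cls f" "b = cls g" "f \<in> cocycles G" "g \<in> cocycles G"
    "cochain_degree n f" "cochain_degree n g"
    using assms by (auto simp: cohomology_component_eq)
  have "cls f \<oplus>\<^bsub>HR\<^esub> cls g = cls (\<lambda>xs. f xs + g xs)" using cls.hom_add[of f g] fg by simp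
  then show ?thesis using fg
    by (auto simp: cohomology_component_eq cocycles_add cochain_degree_def intro!: imageI)
qed

lemma component_zero: "\<zero>\<^bsub>HR\<^esub> \<in> cohomology_component G n"
  using cls.hom_zero zero_cocycle
  by (auto simp: cohomology_component_eq cochain_degree_def image_iff intro!: bexI[of _ "\<lambda>_. 0"])

lemma component_one: "\<one>\<^bsub>HR\<^esub> \<in> cohomology_component G 0"
  using cls.hom_one const_cocycle cochain_degree_const
  by (auto simp: cohomology_component_eq image_iff intro!: bexI[of _ "const_cochain 1"])

lemma component_mult:
  assumes "a \<in> cohomology_component G m" "b \<in> cohomology_component G n"
  shows "a \<otimes>\<^bsub>HR\<^esub> b \<in> cohomology_component G (m + n)"
proof -
  obtain f g where fg: "a = cls f" "b = cls g" "f \<in> cocycles G" "g \<in> cocycles G"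
    "cochain_degree m f" "cochain_degree n g"
    using assms by (auto simp: cohomology_component_eq)
  have "cls f \<otimes>\<^bsub>HR\<^esub> cls g = cls (cup_product f g)" using cls.hom_mult[of f g] fg by simp
  then show ?thesis using fg
    by (auto simp: cohomology_component_eq cocycles_cup_product cup_product_degree intro!: imageI)
qed

lemma component_pow:
  assumes "a \<in> cohomology_component G m" shows "a [^]\<^bsub>HR\<^esub> (n::nat) \<in> cohomology_component G (m * n)"
proof (induction n)
  case (Suc n)
  then show ?case using component_mult[OF Suc assms] by (simp add: ac_simps)
qed (simp add: component_one)

lemma component_mon:
  "ev.mon m \<in> cohomology_component G (\<Sum>x\<in>Poly_Mapping.keys m. gen_dim x * Poly_Mapping.lookup m x)"
proof -
  have z: "cls (z x) \<in> cohomology_component G (gen_dim x)" for x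
    using z_cocycle z_degree by (auto simp: cohomology_component_eq)
  have "finprod HR (\<lambda>x. cls (z x) [^]\<^bsub>HR\<^esub> Poly_Mapping.lookup m x) S
    \<in> cohomology_component G (\<Sum>x\<in>S. gen_dim x * Poly_Mapping.lookup m x)" if "finite S" for S
    using that
  proof (induction S rule: finite_induct)
    case (insert x S)
    then show ?case
      using component_mult[OF component_pow[OF z] insert.IH] by (simp add: ev.h_closed)
  qed (simp add: component_one)
  then show ?thesis by (simp add: ev.mon_def)
qed

lemma component_ev:
  assumes "poly_homogeneous n p" shows "ev p \<in> cohomology_component G n"
proof -
  have "finsum HR ev.mon S \<in> cohomology_component G n"
    if "finite S" "S \<subseteq> Poly_Mapping.keys p" for S
    using that
  proof (induction S rule: finite_induct)
    case (insert m S)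
    then have "ev.mon m \<in> cohomology_component G n"
      using component_mon[of m] assms by (auto simp: poly_homogeneous_def)
    then show ?case using insert component_add by simp
  qed (simp add: component_zero)
  then show ?thesis by (simp add: ev.ev_def)
qed

lemma homogeneous_surjective_imp_surjective:
  assumes "\<And>n f. f \<in> cocycles G \<Longrightarrow> cochain_degree n f \<Longrightarrow> \<exists>q\<in>carrier (poly_ring V). ev q = cls f"
  shows "ev ` carrier (poly_ring V) = carrier HR"
proof (intro equalityI subsetI)
  fix a assume "a \<in> carrier HR"
  then obtain f where f: "f \<in> cocycles G" "a = cls f" by (auto simp: carrier_HR)
  from f(1) have "\<exists>q\<in>carrier (poly_ring V). represents q f"
  proof (induction f rule: cocycle_induct)
    case zero
    then show ?case using represents_0 by (intro bexI[of _ 0]) auto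
  next
    case (homogeneous n f)
    then show ?case using assms by (force simp: represents_def)
  next
    case (add f g)
    then show ?case using represents_add poly_ring_add_closed by blast
  qed
  then show "a \<in> ev ` carrier (poly_ring V)" using f(2) by (auto simp: represents_def)
qed auto

text \<open>The first isomorphism theorem for evaluation. Degrees transfer because evaluation
  respects them and homogeneous classes have homogeneous preimages.\<close>

theorem presented_by_kernel:
  assumes rels: "rels \<subseteq> carrier (poly_ring V)" "\<And>r. r \<in> rels \<Longrightarrow> ev r = \<zero>\<^bsub>HR\<^esub>"
    and kernel: "\<And>p. p \<in> carrier (poly_ring V) \<Longrightarrow> ev p = \<zero>\<^bsub>HR\<^esub> \<Longrightarrow> p \<in> Idl\<^bsub>poly_ring V\<^esub> rels"
    and surj: "\<And>n f. f \<in> cocycles G \<Longrightarrow> cochain_degree n f \<Longrightarrow>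
      \<exists>q\<in>carrier (poly_ring V). poly_homogeneous n q \<and> ev q = cls f"
  shows "mod2_cohomology_presented_by G V rels"
proof -
  interpret P: cring "poly_ring V" by (rule cring_poly_ring)
  interpret E: ring_hom_ring "poly_ring V" HR ev by (rule ev.ev_ring_hom)
  define I where "I = Idl\<^bsub>poly_ring V\<^esub> rels"
  have ker_eq: "a_kernel (poly_ring V) HR ev = {p \<in> carrier (poly_ring V). ev p = \<zero>\<^bsub>HR\<^esub>}"
    unfolding a_kernel_def' by (rule refl)
  have "rels \<subseteq> a_kernel (poly_ring V) HR ev"
    unfolding ker_eq using rels by blast
  then have "I \<subseteq> a_kernel (poly_ring V) HR ev"
    unfolding I_def by (rule P.genideal_minimal[OF E.kernel_is_ideal])
  moreover have "a_kernel (poly_ring V) HR ev \<subseteq> I"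
    unfolding ker_eq I_def using kernel by blast
  ultimately have ker: "a_kernel (poly_ring V) HR ev = I" by (rule equalityI[rotated])
  define h where "h K = the_elem (ev ` K)" for K
  have onto: "ev ` carrier (poly_ring V) = carrier HR"
    using surj by (intro homogeneous_surjective_imp_surjective) blast
  have h_iso: "h \<in> ring_iso (poly_ring V Quot I) HR"
    unfolding h_def[abs_def] using E.FactRing_iso_set[OF onto] by (simp add: ker)
  have h_coset: "h (I +>\<^bsub>poly_ring V\<^esub> p) = ev p" if "p \<in> carrier (poly_ring V)" for p
    using E.the_elem_simp[OF that] by (simp add: h_def ker)
  have h_comp: "h ` presented_component V rels n = (cohomology_component G n :: ('a list \<Rightarrow> bit) set set)" for n
  proof (intro equalityI subsetI)
    fix a assume "a \<in> h ` presented_component V rels n"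
    then show "a \<in> cohomology_component G n"
      by (auto simp: presented_component_def I_def[symmetric] h_coset component_ev)
  next
    fix a :: "('a list \<Rightarrow> bit) set" assume "a \<in> cohomology_component G n"
    then obtain f where f: "f \<in> cocycles G" "cochain_degree n f" "a = cls f"
      by (auto simp: cohomology_component_eq)
    then obtain q where q: "q \<in> carrier (poly_ring V)" "poly_homogeneous n q" "ev q = cls f"
      using surj by blast
    then have "I +>\<^bsub>poly_ring V\<^esub> q \<in> presented_component V rels n"
      by (auto simp: presented_component_def I_def)
    then show "a \<in> h ` presented_component V rels n" using f(3) q h_coset by (force simp: image_iff)
  qed
  \<comment> \<open>The isomorphism h runs from the presented ring to cohomology, and
    \<open>mod2_cohomology_presented_by\<close> asks for the opposite direction.\<close>
  define g where "g = inv_into (carrier (presented_ring V rels)) h"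
  have "ideal I (poly_ring V)" unfolding I_def by (rule P.genideal_ideal[OF rels(1)])
  then have "ring (presented_ring V rels)"
    by (simp add: presented_ring_def I_def[symmetric] ideal.quotient_is_ring)
  then have "g \<in> ring_iso HR (presented_ring V rels)"
    unfolding g_def by (rule ring_iso_set_sym) (use h_iso in \<open>simp add: presented_ring_def I_def\<close>)
  moreover have "g ` cohomology_component G n = presented_component V rels n" for n
  proof -
    have "presented_component V rels n \<subseteq> carrier (presented_ring V rels)"
      by (auto simp: presented_component_def presented_ring_def FactRing_def A_RCOSETS_def')
    moreover have "inj_on h (carrier (presented_ring V rels))"
      using h_iso by (auto simp: ring_iso_def bij_betw_def presented_ring_def I_def)
    ultimately show ?thesis
      unfolding h_comp[symmetric] g_def by (rule inv_into_image_cancel[rotated])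
  qed
  ultimately show ?thesis unfolding mod2_cohomology_presented_by_def by blast
qed

end

text \<open>The polynomials e are candidates for a spanning set of the quotient by I over Z_2. Their
  independence is supplied later by cohomology.\<close>

locale spanning = ideal I "poly_ring V" for I V +
  fixes k :: nat and e :: "nat \<Rightarrow> gen_poly"
  assumes e_closed: "i < k \<Longrightarrow> e i \<in> carrier (poly_ring V)"
begin

lemma zero_in_I: "0 \<in> I"
  using additive_subgroup.zero_closed[OF additive_subgroup_axioms] by simp

definition comb :: "(nat \<Rightarrow> bit) \<Rightarrow> gen_poly" where
  "comb c = (\<Sum>i<k. Poly_Mapping.single 0 (c i) * e i)"

definition spanned :: "gen_poly \<Rightarrow> bool" where
  "spanned p \<longleftrightarrow> (\<exists>c. p + comb c \<in> I)"

lemma I_add: "p \<in> I \<Longrightarrow> q \<in> I \<Longrightarrow> p + q \<in> I"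
  using additive_subgroup.a_closed[OF additive_subgroup_axioms, of p q] by simp

lemma I_mult: "p \<in> I \<Longrightarrow> q \<in> carrier (poly_ring V) \<Longrightarrow> q * p \<in> I"
  using I_l_closed[of p q] by simp

lemma comb_closed: "comb c \<in> carrier (poly_ring V)"
  unfolding comb_def
  by (intro poly_ring_sum_closed poly_ring_mult_closed poly_ring_closed e_closed) simp

lemma comb_add: "comb (\<lambda>i. c i + c' i) = comb c + comb c'"
  by (simp add: comb_def single_add distrib_right sum.distrib)

lemma spanned_I: "p \<in> I \<Longrightarrow> spanned p"
  unfolding spanned_def by (rule exI[of _ "\<lambda>_. 0"]) (simp add: comb_def)

lemma spanned_basis:
  assumes "j < k" shows "spanned (e j)"
proof -
  have "comb (\<lambda>i. of_bool (i = j)) = (\<Sum>i\<in>{j}. e i)"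
    unfolding comb_def using assms by (intro sum.mono_neutral_cong_right) auto
  then have "e j + comb (\<lambda>i. of_bool (i = j)) = 0" by simp
  then show ?thesis unfolding spanned_def using zero_in_I by metis
qed

lemma spanned_add:
  assumes "spanned p" "spanned q" shows "spanned (p + q)"
proof -
  obtain c c' where "p + comb c \<in> I" "q + comb c' \<in> I" using assms by (auto simp: spanned_def)
  then have "(p + comb c) + (q + comb c') \<in> I" by (rule I_add)
  then have "(p + q) + comb (\<lambda>i. c i + c' i) \<in> I" by (simp add: comb_add ac_simps)
  then show ?thesis unfolding spanned_def by blast
qed

lemma spanned_cong: "p + q \<in> I \<Longrightarrow> spanned q \<Longrightarrow> spanned p"
  using spanned_add[of "p + q" q] spanned_I by (simp add: add.assoc)

lemma spanned_0: "spanned 0"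
  by (rule spanned_I) (rule zero_in_I)

lemma spanned_scale: "spanned p \<Longrightarrow> spanned (Poly_Mapping.single 0 c * p)"
  using spanned_0 by (cases c) auto

lemma spanned_of_int_mult: "spanned p \<Longrightarrow> spanned (of_int n * p)"
  unfolding gen_poly_of_int by (rule spanned_scale)

lemma spanned_comb:
  assumes "\<And>i. i < k \<Longrightarrow> spanned (x * e i)" shows "spanned (x * comb c)"
proof -
  have "spanned (\<Sum>i\<in>S. Poly_Mapping.single 0 (c i) * (x * e i))" if "S \<subseteq> {..<k}" for S
    using finite_subset[OF that finite_lessThan] that
    by (induction S rule: finite_induct) (auto simp: spanned_0 intro!: spanned_add spanned_scale assms)
  from this[of "{..<k}"] show ?thesis
    by (simp add: comb_def sum_distrib_left ac_simps)
qed

text \<open>By the multiplication table the span is closed under every generator in V, and starting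
  from 1 it reaches all monomials.\<close>

lemma all_spanned:
  assumes one: "spanned 1"
    and table: "\<And>x i. x \<in> V \<Longrightarrow> i < k \<Longrightarrow> spanned (gen_var x * e i)"
    and p: "p \<in> carrier (poly_ring V)"
  shows "spanned p"
proof -
  have gen: "spanned (gen_var x * q)" if x: "x \<in> V" and q: "spanned q" for x q
  proof -
    obtain c where "q + comb c \<in> I" using q by (auto simp: spanned_def)
    then have "gen_var x * (q + comb c) \<in> I" using x by (intro I_mult) auto
    then have "gen_var x * q + gen_var x * comb c \<in> I" by (simp add: distrib_left)
    then show ?thesis using spanned_comb[OF table[OF x]] spanned_cong by blast
  qed
  have power: "Poly_Mapping.single (Poly_Mapping.single x n) 1 = (gen_var x ^ n :: gen_poly)" for x n
  proof (induction n)
    case (Suc n)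
    have "Poly_Mapping.single x (Suc n) = Poly_Mapping.single x 1 + Poly_Mapping.single x n"
      by (simp flip: single_add)
    then have "Poly_Mapping.single (Poly_Mapping.single x (Suc n)) 1
        = gen_var x * (Poly_Mapping.single (Poly_Mapping.single x n) 1 :: gen_poly)"
      by (simp only: gen_var_def mult_single mult_1)
    then show ?case unfolding Suc by simp
  qed simp
  have gen_power: "spanned (gen_var x ^ n * q)" if "x \<in> V" "spanned q" for x n q
    using that by (induction n) (simp_all add: gen mult.assoc)
  have mon: "spanned (Poly_Mapping.single m 1)" if "Poly_Mapping.keys m \<subseteq> V" for m
    using that
  proof (induction m rule: Poly_Mapping.update_induct)
    case (update m x n)
    have m: "Poly_Mapping.update x n m = Poly_Mapping.single x n + m"
      using update(1) by (intro poly_mapping_eqI)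
        (auto simp: lookup_update lookup_add lookup_single when_def in_keys_iff)
    have "Poly_Mapping.keys (Poly_Mapping.update x n m) = insert x (Poly_Mapping.keys m)"
      using update(2) by (simp add: keys_update)
    then have "x \<in> V" "spanned (Poly_Mapping.single m 1)" using update by auto
    moreover have "Poly_Mapping.single (Poly_Mapping.update x n m) (1::bit) = gen_var x ^ n * Poly_Mapping.single m 1"
      unfolding m power[symmetric] by (simp add: mult_single)
    ultimately show ?case using gen_power by simp
  qed (simp add: one)
  show ?thesis
    using p
  proof (induction p rule: gen_poly_induct)
    case (add m p)
    have "Poly_Mapping.keys (Poly_Mapping.single m 1 + p) = insert m (Poly_Mapping.keys p)"
      using add(1) by (auto simp: in_keys_iff lookup_add lookup_single when_def split: if_splits)
    then show ?case using add by (intro spanned_add mon) (auto simp: carrier_poly_ring)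
  qed (rule spanned_0)
qed

end

lemma poly_homogeneous_sum:
  assumes "\<And>i. i \<in> S \<Longrightarrow> c i \<noteq> 0 \<Longrightarrow> poly_homogeneous n (e i)"
  shows "poly_homogeneous n (\<Sum>i\<in>S. Poly_Mapping.single 0 (c i) * e i)"
  using assms
proof (induction S rule: infinite_finite_induct)
  case (insert i S)
  have 1: "poly_homogeneous n (Poly_Mapping.single 0 (c i) * e i)"
    using insert.prems[of i] by (cases "c i") (auto simp: poly_homogeneous_def)
  have 2: "poly_homogeneous n (\<Sum>i\<in>S. Poly_Mapping.single 0 (c i) * e i)"
    using insert by auto
  show ?case
    using 1 2 keys_add[of "Poly_Mapping.single 0 (c i) * e i" "\<Sum>i\<in>S. Poly_Mapping.single 0 (c i) * e i"]
      insert(1,2) by (auto simp: poly_homogeneous_def)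
qed (auto simp: poly_homogeneous_def)

lemma poly_homogeneous_1: "poly_homogeneous 0 1"
  by (simp add: poly_homogeneous_def)

lemma poly_homogeneous_gen_var: "poly_homogeneous (gen_dim x) (gen_var x)"
  by (simp add: poly_homogeneous_def gen_var_def)

lemma poly_homogeneous_mult:
  assumes "poly_homogeneous m p" "poly_homogeneous n q" shows "poly_homogeneous (m + n) (p * q)"
proof -
  have "(\<Sum>x\<in>Poly_Mapping.keys a. gen_dim x * Poly_Mapping.lookup a x) = m + n"
    if a: "a \<in> Poly_Mapping.keys (p * q)" for a
  proof -
    obtain b c where bc: "a = b + c" "b \<in> Poly_Mapping.keys p" "c \<in> Poly_Mapping.keys q"
      using keys_mult[of p q] a by auto
    define S where "S = Poly_Mapping.keys b \<union> Poly_Mapping.keys c"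
    have "(\<Sum>x\<in>Poly_Mapping.keys d. gen_dim x * Poly_Mapping.lookup d x)
        = (\<Sum>x\<in>S. gen_dim x * Poly_Mapping.lookup d x)" if "d \<in> {a, b, c}" for d
      by (rule sum.mono_neutral_left)
        (use that keys_add[of b c] bc in \<open>auto simp: S_def in_keys_iff\<close>)
    note sums = this[of a] this[of b] this[of c]
    have "(\<Sum>x\<in>Poly_Mapping.keys a. gen_dim x * Poly_Mapping.lookup a x)
        = (\<Sum>x\<in>S. gen_dim x * Poly_Mapping.lookup b x) + (\<Sum>x\<in>S. gen_dim x * Poly_Mapping.lookup c x)"
      using sums(1) by (simp add: bc(1) lookup_add distrib_left sum.distrib)
    then show ?thesis using assms bc(2,3) sums(2,3) by (simp add: poly_homogeneous_def)
  qed
  then show ?thesis by (simp add: poly_homogeneous_def)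
qed

context cohomology_evaluation
begin

text \<open>Elements that span the presented ring and map to a basis of cohomology force the kernel
  of evaluation to be the ideal. Independence is required only inside one degree, since the
  components of a coboundary are coboundaries.\<close>

theorem presented_by_basis:
  fixes k :: nat and e :: "nat \<Rightarrow> gen_poly" and f :: "nat \<Rightarrow> 'a list \<Rightarrow> bit" and d :: "nat \<Rightarrow> nat"
  assumes rels: "rels \<subseteq> carrier (poly_ring V)" "\<And>r. r \<in> rels \<Longrightarrow> \<exists>g\<in>B. represents r g"
    and e: "\<And>i. i < k \<Longrightarrow> e i \<in> carrier (poly_ring V)" "\<And>i. i < k \<Longrightarrow> poly_homogeneous (d i) (e i)"
      "\<And>i. i < k \<Longrightarrow> represents (e i) (f i)"
    and f: "\<And>i. i < k \<Longrightarrow> cochain_degree (d i) (f i)"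
    and span: "\<And>p. spanning (Idl\<^bsub>poly_ring V\<^esub> rels) V k e \<Longrightarrow> p \<in> carrier (poly_ring V) \<Longrightarrow>
      spanning.spanned (Idl\<^bsub>poly_ring V\<^esub> rels) k e p"
    and indep: "\<And>n c. (\<And>i. i < k \<Longrightarrow> c i \<noteq> 0 \<Longrightarrow> d i = n) \<Longrightarrow>
      (\<lambda>xs. \<Sum>i<k. c i * f i xs) \<in> B \<Longrightarrow> \<forall>i<k. c i = 0"
    and gen: "\<And>n g. g \<in> cocycles G \<Longrightarrow> cochain_degree n g \<Longrightarrow>
      \<exists>c. (\<forall>i<k. c i \<noteq> 0 \<longrightarrow> d i = n) \<and> (\<lambda>xs. g xs + (\<Sum>i<k. c i * f i xs)) \<in> B"
  shows "mod2_cohomology_presented_by G V rels"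
proof (rule presented_by_kernel[OF rels(1)])
  interpret P: cring "poly_ring V" by (rule cring_poly_ring)
  interpret E: ring_hom_ring "poly_ring V" HR ev by (rule ev.ev_ring_hom)
  define I where "I = Idl\<^bsub>poly_ring V\<^esub> rels"
  interpret S: spanning I V k e
    unfolding I_def spanning_def spanning_axioms_def using P.genideal_ideal[OF rels(1)] e(1) by blast
  have comb: "represents (S.comb c) (\<lambda>xs. \<Sum>i<k. c i * f i xs)" for c
    unfolding S.comb_def by (rule represents_sum) (rule e)
  show ev_rel: "ev r = \<zero>\<^bsub>HR\<^esub>" if "r \<in> rels" for r
    using rels(2)[OF that] ev_eq_0_iff by blast
  have "rels \<subseteq> a_kernel (poly_ring V) HR ev"
    unfolding a_kernel_def' using rels(1) ev_rel by blast
  then have "I \<subseteq> a_kernel (poly_ring V) HR ev"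
    unfolding I_def by (rule P.genideal_minimal[OF E.kernel_is_ideal])
  then have ev_I: "ev p = \<zero>\<^bsub>HR\<^esub>" if "p \<in> I" for p
    unfolding a_kernel_def' using that by blast
  show "p \<in> Idl\<^bsub>poly_ring V\<^esub> rels" if p: "p \<in> carrier (poly_ring V)" "ev p = \<zero>\<^bsub>HR\<^esub>" for p
  proof -
    obtain c where c: "p + S.comb c \<in> I"
      using span[folded I_def, OF S.spanning_axioms p(1)] by (auto simp: S.spanned_def)
    from ev_I[OF c] have "ev (S.comb c) = \<zero>\<^bsub>HR\<^esub>"
      using p(2) by (simp add: ev.ev_add)
    then have B: "(\<lambda>xs. \<Sum>i<k. c i * f i xs) \<in> B" using ev_eq_0_iff[OF comb] by simp
    then obtain b where b: "(\<lambda>xs. \<Sum>i<k. c i * f i xs) = cob b" by (auto simp: coboundaries_def)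
    have "c j = 0" if j: "j < k" for j
    proof -
      define c' where "c' i = (if d i = d j then c i else 0)" for i
      have deg: "cochain_degree (d j) (\<lambda>xs. \<Sum>i<k. c' i * f i xs)"
        using f by (auto simp: cochain_degree_def c'_def intro!: sum.neutral)
      have "(\<lambda>xs. \<Sum>i<k. c' i * f i xs) \<in> B"
      proof (rule coboundary_degreeI[OF deg])
        fix xs :: "'a list" assume "length xs = d j"
        then have "(\<Sum>i<k. c' i * f i xs) = (\<Sum>i<k. c i * f i xs)"
          using f by (intro sum.cong) (auto simp: c'_def cochain_degree_def)
        then show "(\<Sum>i<k. c' i * f i xs) = cob b xs" using b by metis
      qed
      then have "\<forall>i<k. c' i = 0" by (rule indep[rotated]) (auto simp: c'_def split: if_splits)
      then show ?thesis using j by (auto simp: c'_def)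
    qed
    then have "S.comb c = 0" by (simp add: S.comb_def)
    then show ?thesis using c by (simp add: I_def)
  qed
  show "\<exists>q\<in>carrier (poly_ring V). poly_homogeneous n q \<and> ev q = cls g"
    if g: "g \<in> cocycles G" "cochain_degree n g" for n g
  proof -
    obtain c where c: "\<forall>i<k. c i \<noteq> 0 \<longrightarrow> d i = n" "(\<lambda>xs. g xs + (\<Sum>i<k. c i * f i xs)) \<in> B"
      using gen[OF g] by blast
    have "poly_homogeneous n (S.comb c)"
      unfolding S.comb_def by (rule poly_homogeneous_sum) (use c e in auto)
    moreover have "ev (S.comb c) = cls g"
      using comb[of c] c(2) cls_eq_iff[OF g(1), of "\<lambda>xs. \<Sum>i<k. c i * f i xs"] by (simp add: represents_def)
    ultimately show ?thesis using S.comb_closed by blast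
  qed
qed

end

text \<open>Apart from scalars, only the degrees (1, 1), (1, 2) and (2, 1) have total degree below
  4. In all other degrees both products are coboundaries.\<close>

lemma (in torus_bundle) cup_commute_homogeneous:
  assumes f: "f \<in> cocycles TG" "cochain_degree m f" and g: "g \<in> cocycles TG" "cochain_degree n g"
  shows "cls (cup_product f g) = cls (cup_product g f)"
proof -
  have const: "h = const_cochain (h [])" if "cochain_degree 0 h" for h :: "torus_cochain"
    using that by (auto simp: fun_eq_iff const_cochain_def cochain_degree_def)
  consider "m = 0" | "n = 0" | "m = 1 \<and> n \<in> {1, 2}" | "n = 1 \<and> m \<in> {1, 2}" | "m + n \<ge> 4" by force
  then show ?thesis
  proof cases
    case 1
    then obtain c where "f = const_cochain c" using const f by blast
    then show ?thesis by (simp add: cup_product_const_left cup_product_const_right)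
  next
    case 2
    then obtain c where "g = const_cochain c" using const g by blast
    then show ?thesis by (simp add: cup_product_const_left cup_product_const_right)
  next
    case 3
    then show ?thesis using hom_cup_commute[OF _ f(1) g(2,1)] f(2) by auto
  next
    case 4
    then show ?thesis using hom_cup_commute[OF _ g(1) f(2,1)] g(2) by auto
  next
    case 5
    have "cup_product f g \<in> B" "cup_product g f \<in> B"
      using coboundary_ge_4[OF cocycles_cup_product[OF f(1) g(1)] cup_product_degree[OF f(2) g(2)]]
        coboundary_ge_4[OF cocycles_cup_product[OF g(1) f(1)] cup_product_degree[OF g(2) f(2)]] 5
      by (simp_all add: add.commute)
    then show ?thesis
      using cls_eq_iff cocycles_cup_product f(1) g(1) coboundaries_add by blast
  qed
qed

lemma (in full_group) cls_add:
  "f \<in> cocycles G \<Longrightarrow> g \<in> cocycles G \<Longrightarrow> cls (\<lambda>xs. f xs + g xs) = cls f \<oplus>\<^bsub>HR\<^esub> cls g"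
  using cls.hom_add[of f g] by simp

lemma (in full_group) cls_cup_add:
  assumes "f \<in> cocycles G" "g \<in> cocycles G" "h \<in> cocycles G"
  shows "cls (cup_product (\<lambda>xs. f xs + g xs) h) = cls (cup_product f h) \<oplus>\<^bsub>HR\<^esub> cls (cup_product g h)"
    and "cls (cup_product h (\<lambda>xs. f xs + g xs)) = cls (cup_product h f) \<oplus>\<^bsub>HR\<^esub> cls (cup_product h g)"
  using assms cls_add[of "cup_product f h" "cup_product g h"] cls_add[of "cup_product h f" "cup_product h g"]
  by (simp_all add: cup_product_add_left[abs_def] cup_product_add_right[abs_def] cocycles_cup_product)

lemma (in torus_bundle) cring_cohomology: "cring HR"
proof -
  have zero: "cup_product (\<lambda>_. 0) g = (\<lambda>_. 0)" "cup_product g (\<lambda>_. 0) = (\<lambda>_. 0)"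
    for g :: "torus_cochain"
    by (simp_all add: cup_product_def[abs_def])
  have comm_h: "cls (cup_product f g) = cls (cup_product g f)"
    if f: "f \<in> cocycles TG" and g: "g \<in> cocycles TG" "cochain_degree n g" for f g n
    using f
  proof (induction f rule: cocycle_induct)
    case (homogeneous m f)
    then show ?case using cup_commute_homogeneous g by blast
  qed (use g(1) in \<open>simp_all add: zero cls_cup_add\<close>)
  have comm: "cls (cup_product f g) = cls (cup_product g f)"
    if f: "f \<in> cocycles TG" and g: "g \<in> cocycles TG" for f g
    using g
  proof (induction g rule: cocycle_induct)
    case (homogeneous n g)
    then show ?case using comm_h[OF f] by blast
  qed (use f in \<open>simp_all add: zero cls_cup_add\<close>)
  show ?thesis
  proof (intro cring.intro comm_monoid.intro HR.ring_axioms HR.monoid_axioms comm_monoid_axioms.intro)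
    fix a b assume "a \<in> carrier HR" "b \<in> carrier HR"
    then obtain f g where fg: "f \<in> cocycles TG" "g \<in> cocycles TG" "a = cls f" "b = cls g"
      by (auto simp: carrier_HR)
    then show "a \<otimes>\<^bsub>HR\<^esub> b = b \<otimes>\<^bsub>HR\<^esub> a"
      using comm cls.hom_mult[of f g] cls.hom_mult[of g f] by simp
  qed
qed

section \<open>The three presentations\<close>

lemma less_8_cases: "(i::nat) < 8 \<Longrightarrow> i = 0 \<or> i = 1 \<or> i = 2 \<or> i = 3 \<or> i = 4 \<or> i = 5 \<or> i = 6 \<or> i = 7"
  and less_6_cases: "(i::nat) < 6 \<Longrightarrow> i = 0 \<or> i = 1 \<or> i = 2 \<or> i = 3 \<or> i = 4 \<or> i = 5"
  and less_4_cases: "(i::nat) < 4 \<Longrightarrow> i = 0 \<or> i = 1 \<or> i = 2 \<or> i = 3"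
  by auto

lemma sum_less_8: "(\<Sum>i<8. g i) = g 0 + g 1 + g 2 + g 3 + g 4 + g 5 + g 6 + g (7::nat)"
  and sum_less_6: "(\<Sum>i<6. g i) = g 0 + g 1 + g 2 + g 3 + g 4 + g (5::nat)"
  and sum_less_4: "(\<Sum>i<4. g i) = g 0 + g 1 + g 2 + g (3::nat)"
  by (simp_all add: eval_nat_numeral)

abbreviation (input) basis_1 :: "gen_poly list" where
  "basis_1 \<equiv> [1, \<zeta> 1, \<zeta> 2, \<zeta> 3, \<zeta> 1 * \<zeta> 2, \<zeta> 1 * \<zeta> 3, \<zeta> 2 * \<zeta> 3, \<zeta> 1 * \<zeta> 2 * \<zeta> 3]"

abbreviation (input) rels_1 :: "int \<Rightarrow> int \<Rightarrow> int \<Rightarrow> int \<Rightarrow> gen_poly set" where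
  "rels_1 a b c d \<equiv>
     {\<zeta> 1 ^ 2 \<doteq> of_int a * \<zeta> 1 * \<zeta> 3 + of_int b * \<zeta> 2 * \<zeta> 3,
      \<zeta> 2 ^ 2 \<doteq> of_int c * \<zeta> 1 * \<zeta> 3 + of_int d * \<zeta> 2 * \<zeta> 3,
      \<zeta> 3 ^ 2 \<doteq> 0}"

lemma spanned_1:
  fixes a b c d :: int
  defines "V \<equiv> {Zeta 1, Zeta 2, Zeta 3}"
  defines "I \<equiv> Idl\<^bsub>poly_ring V\<^esub> (rels_1 a b c d)"
  assumes sp: "spanning I V 8 (\<lambda>i. basis_1 ! i)" and p: "p \<in> carrier (poly_ring V)"
  shows "spanning.spanned I 8 (\<lambda>i. basis_1 ! i) p"
proof -
  interpret P: cring "poly_ring V" by (rule cring_poly_ring)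
  interpret S: spanning I V 8 "\<lambda>i. basis_1 ! i" by (rule sp)
  define z1 z2 z3 where "z1 = \<zeta> 1" and "z2 = \<zeta> 2" and "z3 = \<zeta> 3"
  have carr [simp]: "z1 \<in> carrier (poly_ring V)" "z2 \<in> carrier (poly_ring V)" "z3 \<in> carrier (poly_ring V)"
    by (simp_all add: V_def z1_def z2_def z3_def)
  have "rels_1 a b c d \<subseteq> I"
    unfolding I_def by (rule P.genideal_self) (use carr in \<open>simp add: power2_eq_square z1_def z2_def z3_def\<close>)
  then have r: "z1 * z1 + (of_int a * (z1 * z3) + of_int b * (z2 * z3)) \<in> I"
    "z2 * z2 + (of_int c * (z1 * z3) + of_int d * (z2 * z3)) \<in> I" "z3 * z3 \<in> I"
    by (simp_all add: power2_eq_square z1_def z2_def z3_def mult.assoc)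
  have TT: "q * (z3 * z3) \<in> I" if "q \<in> carrier (poly_ring V)" for q
    using S.I_mult[OF r(3) that] .
  \<comment> \<open>After multiplication by z3 every term on the right of the two square relations
    contains z3 twice and lies in the ideal.\<close>
  have "z3 * (z1 * z1 + (of_int a * (z1 * z3) + of_int b * (z2 * z3))) + (of_int a * z1 + of_int b * z2) * (z3 * z3) \<in> I"
    "z3 * (z2 * z2 + (of_int c * (z1 * z3) + of_int d * (z2 * z3))) + (of_int c * z1 + of_int d * z2) * (z3 * z3) \<in> I"
    by (intro S.I_add S.I_mult r TT; simp)+
  then have XXT: "z1 * (z1 * z3) \<in> I" and YYT: "z2 * (z2 * z3) \<in> I"
    by (simp_all add: algebra_simps)
  \<comment> \<open>Multiplied by the other variable, each square relation leaves only a multiple of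
    the top monomial.\<close>
  have "z2 * (z1 * z1 + (of_int a * (z1 * z3) + of_int b * (z2 * z3))) + of_int b * (z2 * (z2 * z3)) \<in> I"
    "z1 * (z2 * z2 + (of_int c * (z1 * z3) + of_int d * (z2 * z3))) + of_int c * (z1 * (z1 * z3)) \<in> I"
    by (intro S.I_add S.I_mult r XXT YYT; simp)+
  then have XXY: "z1 * (z1 * z2) + of_int a * (z1 * z2 * z3) \<in> I" and XYY: "z2 * (z1 * z2) + of_int d * (z1 * z2 * z3) \<in> I"
    by (simp_all add: algebra_simps)
  have basis: "S.spanned 1" "S.spanned z1" "S.spanned z2" "S.spanned z3" "S.spanned (z1 * z2)"
    "S.spanned (z1 * z3)" "S.spanned (z2 * z3)" "S.spanned (z1 * z2 * z3)"
    using S.spanned_basis[of 0] S.spanned_basis[of 1] S.spanned_basis[of 2] S.spanned_basis[of 3]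
      S.spanned_basis[of 4] S.spanned_basis[of 5] S.spanned_basis[of 6] S.spanned_basis[of 7]
    by (simp_all add: z1_def z2_def z3_def)
  have deg2: "S.spanned (z1 * z1)" "S.spanned (z2 * z2)" "S.spanned (z3 * z3)"
    by (rule S.spanned_cong[OF r(1)] S.spanned_cong[OF r(2)] S.spanned_I[OF r(3)],
        (intro S.spanned_add S.spanned_of_int_mult basis)?)+
  have deg3: "S.spanned (z1 * (z1 * z2))" "S.spanned (z2 * (z1 * z2))"
    by (rule S.spanned_cong[OF XXY] S.spanned_cong[OF XYY], intro S.spanned_of_int_mult basis)+
  have "z2 * (z1 * (z1 * z3)) \<in> I" "z1 * (z2 * (z2 * z3)) \<in> I" "z1 * (z3 * z3) \<in> I" "z2 * (z3 * z3) \<in> I"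
    "z1 * z2 * (z3 * z3) \<in> I"
    by (intro S.I_mult XXT YYT r(3); simp)+
  note zero = this[THEN S.spanned_I] XXT[THEN S.spanned_I] YYT[THEN S.spanned_I]
  define Q where "Q = S.spanned"
  have table: "Q (g * u)"
    if "g \<in> {z1, z2, z3}" "u \<in> {1, z1, z2, z3, z1 * z2, z1 * z3, z2 * z3, z1 * z2 * z3}" for g u
    using that basis[folded Q_def] deg2[folded Q_def] deg3[folded Q_def] zero[folded Q_def]
    by (elim insertE emptyE) (simp_all add: ac_simps)
  show ?thesis
  proof (rule S.all_spanned[OF basis(1) _ p], fold Q_def, rule table)
    fix x i assume "x \<in> V" "i < (8::nat)"
    then show "gen_var x \<in> {z1, z2, z3}"
      "basis_1 ! i \<in> {1, z1, z2, z3, z1 * z2, z1 * z3, z2 * z3, z1 * z2 * z3}"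
      using less_8_cases[of i] by (auto simp: V_def z1_def z2_def z3_def)
  qed
qed

abbreviation (input) basis_2 :: "gen_poly list" where
  "basis_2 \<equiv> [1, \<zeta> 1, \<zeta> 2, \<xi> 1, \<xi> 2, \<zeta> 1 * \<xi> 1]"

text \<open>Common shape of the three involution cases; b is the coefficient that depends on the
  choice of \<xi>_2.\<close>

abbreviation (input) rels_2 :: "int \<Rightarrow> int \<Rightarrow> gen_poly set" where
  "rels_2 a b \<equiv>
     {\<zeta> 1 ^ 2 \<doteq> of_int a * \<xi> 1,
      \<zeta> 2 ^ 2 \<doteq> 0,
      \<zeta> 1 * \<zeta> 2 \<doteq> 0,
      \<zeta> 1 * \<xi> 2 \<doteq> of_int b * \<zeta> 1 * \<xi> 1,
      \<zeta> 2 * \<xi> 1 \<doteq> 0,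
      \<zeta> 2 * \<xi> 2 \<doteq> \<zeta> 1 * \<xi> 1,
      \<xi> 1 ^ 2 \<doteq> 0,
      \<xi> 2 ^ 2 \<doteq> 0,
      \<xi> 1 * \<xi> 2 \<doteq> 0}"

lemma spanned_2:
  fixes a b :: int
  defines "V \<equiv> {Zeta 1, Zeta 2, Xi 1, Xi 2}"
  defines "I \<equiv> Idl\<^bsub>poly_ring V\<^esub> (rels_2 a b)"
  assumes sp: "spanning I V 6 (\<lambda>i. basis_2 ! i)" and p: "p \<in> carrier (poly_ring V)"
  shows "spanning.spanned I 6 (\<lambda>i. basis_2 ! i) p"
proof -
  interpret P: cring "poly_ring V" by (rule cring_poly_ring)
  interpret S: spanning I V 6 "\<lambda>i. basis_2 ! i" by (rule sp)
  define z1 z2 x1 x2 where "z1 = \<zeta> 1" and "z2 = \<zeta> 2" and "x1 = \<xi> 1" and "x2 = \<xi> 2"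
  have carr [simp]: "z1 \<in> carrier (poly_ring V)" "z2 \<in> carrier (poly_ring V)"
    "x1 \<in> carrier (poly_ring V)" "x2 \<in> carrier (poly_ring V)"
    by (simp_all add: V_def z1_def z2_def x1_def x2_def)
  have "rels_2 a b \<subseteq> I"
    unfolding I_def
    by (rule P.genideal_self) (use carr in \<open>simp add: power2_eq_square z1_def z2_def x1_def x2_def\<close>)
  then have r: "z1 * z1 + of_int a * x1 \<in> I" "z2 * z2 \<in> I" "z1 * z2 \<in> I"
    "z1 * x2 + of_int b * (z1 * x1) \<in> I" "z2 * x1 \<in> I" "z2 * x2 + z1 * x1 \<in> I"
    "x1 * x1 \<in> I" "x2 * x2 \<in> I" "x1 * x2 \<in> I"
    by (simp_all add: power2_eq_square z1_def z2_def x1_def x2_def mult.assoc)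
  \<comment> \<open>The square of \<zeta>_1 is a multiple of \<xi>_1, which is annihilated by
    \<xi>_1.\<close>
  have "x1 * (z1 * z1 + of_int a * x1) + of_int a * (x1 * x1) \<in> I"
    by (intro S.I_add S.I_mult r; simp)
  then have x1z1z1: "x1 * (z1 * z1) \<in> I"
    by (simp add: algebra_simps)
  have "z1 * (z2 * x1) \<in> I" "z1 * (x1 * x1) \<in> I" "z1 * (x1 * x2) \<in> I"
    by (intro S.I_mult r; simp)+
  note zero = this[THEN S.spanned_I] x1z1z1[THEN S.spanned_I] r(2,3,5,7-9)[THEN S.spanned_I]
  have basis: "S.spanned 1" "S.spanned z1" "S.spanned z2" "S.spanned x1" "S.spanned x2"
    "S.spanned (z1 * x1)"
    using S.spanned_basis[of 0] S.spanned_basis[of 1] S.spanned_basis[of 2] S.spanned_basis[of 3]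
      S.spanned_basis[of 4] S.spanned_basis[of 5]
    by (simp_all add: z1_def z2_def x1_def x2_def)
  have other: "S.spanned (z1 * z1)" "S.spanned (z1 * x2)" "S.spanned (z2 * x2)"
    using S.spanned_cong[OF r(1)] S.spanned_cong[OF r(4)] S.spanned_cong[OF r(6)]
      S.spanned_of_int_mult basis by blast+
  define Q where "Q = S.spanned"
  have table: "Q (g * u)"
    if "g \<in> {z1, z2, x1, x2}" "u \<in> {1, z1, z2, x1, x2, z1 * x1}" for g u
    using that basis[folded Q_def] other[folded Q_def] zero[folded Q_def]
    by (elim insertE emptyE) (simp_all add: ac_simps)
  show ?thesis
  proof (rule S.all_spanned[OF basis(1) _ p], fold Q_def, rule table)
    fix x i assume "x \<in> V" "i < (6::nat)"
    then show "gen_var x \<in> {z1, z2, x1, x2}" "basis_2 ! i \<in> {1, z1, z2, x1, x2, z1 * x1}"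
      using less_6_cases[of i] by (auto simp: V_def z1_def z2_def x1_def x2_def)
  qed
qed

abbreviation (input) basis_3 :: "gen_poly list" where
  "basis_3 \<equiv> [1, \<zeta> 1, \<xi> 1, \<zeta> 1 * \<xi> 1]"

abbreviation (input) rels_3 :: "gen_poly set" where
  "rels_3 \<equiv> {\<zeta> 1 ^ 2 \<doteq> 0, \<xi> 1 ^ 2 \<doteq> 0}"

lemma spanned_3:
  defines "V \<equiv> {Zeta 1, Xi 1}"
  defines "I \<equiv> Idl\<^bsub>poly_ring V\<^esub> rels_3"
  assumes sp: "spanning I V 4 (\<lambda>i. basis_3 ! i)" and p: "p \<in> carrier (poly_ring V)"
  shows "spanning.spanned I 4 (\<lambda>i. basis_3 ! i) p"
proof -
  interpret P: cring "poly_ring V" by (rule cring_poly_ring)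
  interpret S: spanning I V 4 "\<lambda>i. basis_3 ! i" by (rule sp)
  define z1 x1 where "z1 = \<zeta> 1" and "x1 = \<xi> 1"
  have carr [simp]: "z1 \<in> carrier (poly_ring V)" "x1 \<in> carrier (poly_ring V)"
    by (simp_all add: V_def z1_def x1_def)
  have "rels_3 \<subseteq> I"
    unfolding I_def
    by (rule P.genideal_self) (use carr in \<open>simp add: power2_eq_square z1_def x1_def\<close>)
  then have r: "z1 * z1 \<in> I" "x1 * x1 \<in> I"
    by (simp_all add: power2_eq_square z1_def x1_def)
  have "x1 * (z1 * z1) \<in> I" "z1 * (x1 * x1) \<in> I"
    by (intro S.I_mult r; simp)+
  note zero = this[THEN S.spanned_I] r[THEN S.spanned_I]
  have basis: "S.spanned 1" "S.spanned z1" "S.spanned x1" "S.spanned (z1 * x1)"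
    using S.spanned_basis[of 0] S.spanned_basis[of 1] S.spanned_basis[of 2] S.spanned_basis[of 3]
    by (simp_all add: z1_def x1_def)
  define Q where "Q = S.spanned"
  have table: "Q (g * u)" if "g \<in> {z1, x1}" "u \<in> {1, z1, x1, z1 * x1}" for g u
    using that basis[folded Q_def] zero[folded Q_def]
    by (elim insertE emptyE) (simp_all add: ac_simps)
  show ?thesis
  proof (rule S.all_spanned[OF basis(1) _ p], fold Q_def, rule table)
    fix x i assume "x \<in> V" "i < (4::nat)"
    then show "gen_var x \<in> {z1, x1}" "basis_3 ! i \<in> {1, z1, x1, z1 * x1}"
      using less_4_cases[of i] by (auto simp: V_def z1_def x1_def)
  qed
qed

lemma cup_product_degree_eq:
  "cochain_degree m f \<Longrightarrow> cochain_degree n g \<Longrightarrow> k = m + n \<Longrightarrow> cochain_degree k (cup_product f g)"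
  by (simp add: cup_product_degree)

lemma poly_homogeneous_mult_eq:
  "poly_homogeneous m p \<Longrightarrow> poly_homogeneous n q \<Longrightarrow> k = m + n \<Longrightarrow> poly_homogeneous k (p * q)"
  by (simp add: poly_homogeneous_mult)

section \<open>From explicit cocycles to the three presentations\<close>

context torus_bundle
begin

lemma coboundary_eqI: "f \<in> B \<Longrightarrow> (\<And>xs. g xs = f xs) \<Longrightarrow> g \<in> B"
  by (simp add: ext[of g f])

lemma coboundary_degree_le_1: "f \<in> B \<Longrightarrow> f [] = 0" "f \<in> B \<Longrightarrow> f [x] = 0"
  by (auto simp: coboundaries_def coboundary_Cons)

lemma top_eval_scale: "f \<in> cocycles TG \<Longrightarrow> top_eval (\<lambda>xs. c * f xs) = c * top_eval f"
  using top_eval_coboundary[OF zero_coboundary] by (cases c) auto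

lemma cocycles_scale: "f \<in> cocycles TG \<Longrightarrow> (\<lambda>xs. c * f xs) \<in> cocycles TG" for c :: bit
  using zero_cocycle by (cases c) auto

lemma cocycle_0_const: "cochain_degree 0 g \<Longrightarrow> g xs + g [] * const_cochain 1 xs = 0"
  by (simp add: const_cochain_def cochain_degree_def)

lemma cocycle_3_top_eval:
  assumes "g \<in> cocycles TG" "cochain_degree 3 g" "h \<in> cocycles TG" "cochain_degree 3 h" "top_eval h = 1"
  shows "(\<lambda>xs. g xs + top_eval g * h xs) \<in> B"
proof -
  have "(\<lambda>xs. g xs + top_eval g * h xs) \<in> cocycles TG"
    by (rule cocycles_add[OF assms(1) cocycles_scale[OF assms(3)]])
  moreover have "cochain_degree 3 (\<lambda>xs. g xs + top_eval g * h xs)"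
    using assms by (simp add: cochain_degree_def)
  moreover have "top_eval (\<lambda>xs. g xs + top_eval g * h xs) = 0"
    using assms by (simp add: top_eval_add cocycles_scale top_eval_scale)
  ultimately show ?thesis using coboundary_iff_top_eval by blast
qed

lemma crossed_scale: "crossed (a * c) (a * d) xs = a * crossed c d xs"
  using crossed_0 by (cases a) (auto simp: fun_eq_iff)

lemma cup_commute_coboundary:
  assumes "f \<in> cocycles TG" "cochain_degree m f" "g \<in> cocycles TG" "cochain_degree n g"
  shows "(\<lambda>xs. cup_product f g xs + cup_product g f xs) \<in> B"
  using cup_commute_homogeneous[OF assms] cls_eq_iff cocycles_cup_product assms(1,3) by blast

lemma top_eval_cup_commute:
  assumes "f \<in> cocycles TG" "cochain_degree m f" "g \<in> cocycles TG" "cochain_degree n g"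
  shows "top_eval (cup_product f g) = top_eval (cup_product g f)"
  using top_eval_coboundary[OF cup_commute_coboundary[OF assms]] assms
  by (simp add: top_eval_add cocycles_cup_product bit_add_eq_0_iff)

lemma form_0: "form 0 0 = (\<lambda>_. 0)"
  by (auto simp: form_def fun_eq_iff split: list.splits)

lemma form_linear: "form (a * c + b * c') (a * d + b * d') xs = a * form c d xs + b * form c' d' xs"
  by (auto simp: form_def lin_def algebra_simps split: list.splits)

lemma crossed_linear: "crossed (a * c + b * c') (a * d + b * d') xs = a * crossed c d xs + b * crossed c' d' xs"
  by (simp add: crossed_add crossed_scale)

lemma low_degree_values [simp]:
  "const_cochain c [] = c" "const_cochain c [x] = 0" "tau [] = 0" "form c d [] = 0"
  "tau [st i] = of_int i" "tau [sa i] = 0" "tau [sb i] = 0"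
  "form c d [st i] = 0" "form c d [sa i] = c * of_int i" "form c d [sb i] = d * of_int i"
  by (simp_all add: const_cochain_def tau_def form_def st_def sa_def sb_def lin_def)

lemma cohomologyI:
  "(\<And>x. z x \<in> cocycles TG) \<Longrightarrow> (\<And>x. cochain_degree (gen_dim x) (z x)) \<Longrightarrow> cohomology_evaluation TG z"
  by (simp add: cohomology_evaluation_def cohomology_evaluation_axioms_def full_group_axioms cring_cohomology)

text \<open>Both hypotheses together express that \<theta>^* - 1 is bijective on linear forms modulo
  2. Only the circle class, the area class and their product survive, as in the cohomology of the
  product of a circle and a 2-sphere.\<close>

theorem presentation_3:
  assumes no_fixed: "\<And>c d. fixed c d \<Longrightarrow> c = 0 \<and> d = 0" and crossed: "\<And>c d. crossed c d \<in> B"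
  shows "mod2_cohomology_presented_by TG {Zeta 1, Xi 1} rels_3"
proof -
  define z where "z x = (if x = Zeta 1 then tau else if x = Xi 1 then area else (\<lambda>_. 0))" for x
  have z: "z x \<in> cocycles TG \<and> cochain_degree (gen_dim x) (z x)" for x
    unfolding z_def using tau_cocycle area_cocycle zero_cocycle degree_tau degree_area
    by (simp add: cochain_degree_def[of _ "\<lambda>_. 0"])
  interpret E: cohomology_evaluation TG z
    by (rule cohomologyI) (use z in auto)
  define w where "w = cup_product tau area"
  define f where "f = [const_cochain 1, tau, area, w]"
  define d :: "nat list" where "d = [0, 1, 2, 3]"
  have w: "w \<in> cocycles TG" "cochain_degree 3 w" "top_eval w = 1"
    using cup_product_degree_eq[OF degree_tau degree_area, of 3]
    by (simp_all add: w_def cocycles_cup_product tau_cocycle area_cocycle top_eval_tau_cup degree_area fiber_eval_area)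
  have rep: "E.represents 1 (const_cochain 1)" "E.represents (\<zeta> 1) tau" "E.represents (\<xi> 1) area"
    using E.represents_const[of 1] E.represents_gen_var[of "Zeta 1"] E.represents_gen_var[of "Xi 1"]
    by (simp_all add: z_def)
  have rep_w: "E.represents (\<zeta> 1 * \<xi> 1) w" unfolding w_def by (intro E.represents_mult rep)
  have rels: "\<exists>g\<in>B. E.represents (\<zeta> 1 ^ 2 \<doteq> 0) g" "\<exists>g\<in>B. E.represents (\<xi> 1 ^ 2 \<doteq> 0) g"
    using E.represents_mult[OF rep(2,2)] tau_cup_tau E.represents_mult[OF rep(3,3)]
      coboundary_ge_4[OF cocycles_cup_product[OF area_cocycle area_cocycle] cup_product_degree[OF degree_area degree_area]]
    by (auto simp: power2_eq_square)
  have hom: "poly_homogeneous 0 1" "poly_homogeneous 1 (\<zeta> 1)" "poly_homogeneous 2 (\<xi> 1)"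
    "poly_homogeneous 3 (\<zeta> 1 * \<xi> 1)"
    using poly_homogeneous_1 poly_homogeneous_gen_var[of "Zeta 1"] poly_homogeneous_gen_var[of "Xi 1"]
      poly_homogeneous_mult_eq[of 1 "\<zeta> 1" 2 "\<xi> 1" 3] by simp_all
  have w_low: "w [] = 0" "w [x] = 0" "fiber_eval w = 0" for x
    using w(2) by (simp_all add: cochain_degree_def fiber_eval_def)
  have area_low: "area [] = 0" "area [x] = 0" for x
    using degree_area by (simp_all add: cochain_degree_def)
  show ?thesis
  proof (rule E.presented_by_basis[where k = 4 and e = "\<lambda>i. basis_3 ! i" and f = "\<lambda>i. f ! i"
        and d = "\<lambda>i. d ! i", OF _ _ _ _ _ _ spanned_3])
    show "rels_3 \<subseteq> carrier (poly_ring {Zeta 1, Xi 1})" by (simp add: power2_eq_square)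
    show "\<exists>g\<in>B. E.represents r g" if "r \<in> rels_3" for r using that rels by blast
    fix i :: nat assume "i < 4"
    then have i: "i = 0 \<or> i = 1 \<or> i = 2 \<or> i = 3" by (rule less_4_cases)
    show "basis_3 ! i \<in> carrier (poly_ring {Zeta 1, Xi 1})" using i by auto
    show "poly_homogeneous (d ! i) (basis_3 ! i)" using i hom by (auto simp: d_def)
    show "E.represents (basis_3 ! i) (f ! i)" using i rep rep_w by (auto simp: f_def)
    show "cochain_degree (d ! i) (f ! i)"
      using i cochain_degree_const[of 1] degree_tau degree_area w(2) by (auto simp: d_def f_def)
  next
    fix n c assume "(\<lambda>xs. \<Sum>i<4. c i * (f ! i) xs) \<in> B"
    then have F: "(\<lambda>xs. c 0 * const_cochain 1 xs + c 1 * tau xs + c 2 * area xs + c 3 * w xs) \<in> B"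
      by (simp add: sum_less_4 f_def)
    \<comment> \<open>Four functionals isolate the coefficients in turn: the empty list, the list
      [t], the fiber evaluation and the transgression.\<close>
    have c0: "c 0 = 0" using coboundary_degree_le_1(1)[OF F] by (simp add: w_low area_low)
    have c1: "c 1 = 0" using coboundary_degree_le_1(2)[OF F, of "st 1"] by (simp add: w_low area_low)
    have c2: "c 2 = 0" using fiber_eval_coboundary[OF F] c0 c1 by (simp add: fiber_eval_add fiber_eval_scale w_low fiber_eval_area)
    have "c 3 = 0" using top_eval_coboundary[OF F] c0 c1 c2 w by (simp add: top_eval_scale)
    then show "\<forall>i<4. c i = 0" using c0 c1 c2 less_4_cases by blast
  next
    fix n and g :: "torus_cochain" assume g: "g \<in> cocycles TG" "cochain_degree n g"
    define P where "P c \<longleftrightarrow> (\<forall>i<4. c i \<noteq> 0 \<longrightarrow> d ! i = n) \<and> (\<lambda>xs. g xs + (\<Sum>i<4. c i * (f ! i) xs)) \<in> B" for c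
    have PI: "\<exists>c. P c" if "\<And>i. i < 4 \<Longrightarrow> a ! i \<noteq> 0 \<Longrightarrow> d ! i = n"
      "(\<lambda>xs. g xs + (a ! 0 * const_cochain 1 xs + a ! 1 * tau xs + a ! 2 * area xs + a ! 3 * w xs)) \<in> B" for a
      using that by (intro exI[of _ "\<lambda>i. a ! i"]) (simp add: P_def sum_less_4 f_def)
    consider "n = 0" | "n = 1" | "n = 2" | "n = 3" | "n \<ge> 4" by linarith
    then have "\<exists>c. P c"
    proof cases
      case 1
      have "(\<lambda>xs. g xs + g [] * const_cochain 1 xs) \<in> B"
        by (rule coboundary_eqI[OF zero_coboundary]) (use cocycle_0_const[of g] g 1 in simp)
      then show ?thesis by (intro PI[of "[g [], 0, 0, 0]"]) (auto simp: d_def 1 dest!: less_4_cases)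
    next
      case 2
      obtain a b e where "fixed a b" "g = (\<lambda>xs. form a b xs + e * tau xs)"
        using cocycle_1_cases[OF g(1) g(2)[unfolded 2]] by blast
      then have g': "g = (\<lambda>xs. e * tau xs)" using no_fixed form_0 by fastforce
      have "(\<lambda>xs. g xs + e * tau xs) \<in> B"
        by (rule coboundary_eqI[OF zero_coboundary]) (simp add: g')
      then show ?thesis by (intro PI[of "[0, e, 0, 0]"]) (auto simp: d_def 2 dest!: less_4_cases)
    next
      case 3
      obtain a b where ab: "(\<lambda>xs. g xs + fiber_eval g * area xs + crossed a b xs) \<in> B"
        using cocycle_2_cases[OF g(1) g(2)[unfolded 3]] by blast
      have "(\<lambda>xs. g xs + fiber_eval g * area xs) \<in> B"
        by (rule coboundary_eqI[OF coboundaries_add[OF ab crossed[of a b]]]) (simp add: ac_simps)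
      then show ?thesis by (intro PI[of "[0, 0, fiber_eval g, 0]"]) (auto simp: d_def 3 dest!: less_4_cases)
    next
      case 4
      have "(\<lambda>xs. g xs + top_eval g * w xs) \<in> B" using cocycle_3_top_eval[OF g(1) _ w] g(2) 4 by simp
      then show ?thesis by (intro PI[of "[0, 0, 0, top_eval g]"]) (auto simp: d_def 4 dest!: less_4_cases)
    next
      case 5
      then show ?thesis
        using coboundary_ge_4[OF g] by (intro exI[of _ "\<lambda>_. 0"]) (simp add: P_def)
    qed
    then show "\<exists>c. (\<forall>i<4. c i \<noteq> 0 \<longrightarrow> d ! i = n) \<and> (\<lambda>xs. g xs + (\<Sum>i<4. c i * (f ! i) xs)) \<in> B"
      unfolding P_def .
  qed
qed

lemma fiber_eval_cup:
  assumes "cochain_degree 1 f" "cochain_degree 1 g"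
  shows "fiber_eval (cup_product f g) = f [sa 1] * g [sb 1] + f [sb 1] * g [sa 1]"
  using cup_product_split[OF assms(1), of "[sa 1, sb 1]" 1 g] cup_product_split[OF assms(1), of "[sb 1, sa 1]" 1 g]
  by (simp add: fiber_eval_def)

lemma form_cup_tau:
  assumes "fixed c d" shows "(\<lambda>xs. cup_product (form c d) tau xs + crossed c d xs) \<in> B"
  using cup_commute_coboundary[OF form_cocycle[OF assms] degree_form tau_cocycle degree_tau]
  by (simp add: tau_eq_form_cup[OF assms])

text \<open>(c1, d1) spans the invariant forms and the image of \<theta>^* - 1; (c2, d2) completes
  it to a basis, \<open>wedge\<close> being the determinant. Thus the crossed class of the former is
  trivial and that of the latter is \<xi>_1.\<close>

theorem presentation_2:
  fixes a b :: int
  assumes fixed_cases: "\<And>c d. fixed c d \<Longrightarrow> (c = 0 \<and> d = 0) \<or> (c = c1 \<and> d = d1)"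
    and fixed: "fixed c1 d1" and image: "crossed c1 d1 \<in> B" "crossed c2 d2 \<notin> B"
    and wedge: "c2 * d1 + d2 * c1 = 1"
    and square: "(\<lambda>xs. cup_product (form c1 d1) (form c1 d1) xs + of_int a * crossed c2 d2 xs) \<in> B"
  shows "mod2_cohomology_presented_by TG {Zeta 1, Zeta 2, Xi 1, Xi 2} (rels_2 a b)"
proof -
  define x y where "x = form c1 d1" and "y = crossed c2 d2"
  \<comment> \<open>Adding y to the area class changes its pairing with x by 1, so this multiple of
    y turns that pairing into b.\<close>
  define t where "t = of_int b + top_eval (cup_product area x)"
  define v where "v xs = area xs + t * y xs" for xs
  define w where "w = cup_product x y"
  have x: "x \<in> cocycles TG" "cochain_degree 1 x" "x [sa 1] = c1" "x [sb 1] = d1" "x [st 1] = 0"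
    using fixed degree_form[of c1 d1] by (simp_all add: x_def form_cocycle)
  have y: "y \<in> cocycles TG" "cochain_degree 2 y" "fiber_eval y = 0"
    by (simp_all add: y_def crossed_cocycle degree_crossed fiber_eval_crossed)
  have v: "v \<in> cocycles TG" "cochain_degree 2 v" "fiber_eval v = 1"
    unfolding v_def[abs_def]
    by (intro cocycles_add cocycles_scale area_cocycle y)
      (use degree_area y in \<open>simp_all add: fiber_eval_add fiber_eval_scale fiber_eval_area cochain_degree_def\<close>)
  have yx: "top_eval (cup_product y x) = 1"
    using top_eval_crossed_cup[OF x(1,2), of c2 d2] wedge by (simp add: y_def x)
  have w: "w \<in> cocycles TG" "cochain_degree 3 w" "top_eval w = 1"
    using yx top_eval_cup_commute[OF x(1,2) y(1,2)] cocycles_cup_product[OF x(1) y(1)]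
      cup_product_degree_eq[OF x(2) y(2), of 3] by (simp_all add: w_def)
  have "top_eval (cup_product v x) = top_eval (cup_product area x) + t * top_eval (cup_product y x)"
    unfolding v_def[abs_def] cup_product_add_left[abs_def] cup_product_scale_left
    using top_eval_add top_eval_scale cocycles_scale cocycles_cup_product area_cocycle x(1) y(1) by simp
  then have xv: "top_eval (cup_product x v) = of_int b"
    using top_eval_cup_commute[OF x(1,2) v(1,2)] by (simp add: yx t_def ac_simps)
  have low: "x [] = 0" "y [] = 0" "v [] = 0" "w [] = 0" "y [h] = 0" "v [h] = 0" "w [h] = 0" "fiber_eval w = 0"
    "fiber_eval x = 0" "fiber_eval tau = 0" "fiber_eval (const_cochain c) = 0" for h c
    using x(2) y(2) v(2) w(2) degree_tau cochain_degree_const[of c]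
    by (simp_all add: cochain_degree_def fiber_eval_def)
  define z where "z g = (if g = Zeta 1 then x else if g = Zeta 2 then tau else if g = Xi 1 then y
    else if g = Xi 2 then v else (\<lambda>_. 0))" for g
  have z: "z g \<in> cocycles TG \<and> cochain_degree (gen_dim g) (z g)" for g
    unfolding z_def using tau_cocycle zero_cocycle degree_tau x y v
    by (simp add: cochain_degree_def[of _ "\<lambda>_. 0"])
  interpret E: cohomology_evaluation TG z
    by (rule cohomologyI) (use z in auto)
  define f where "f = [const_cochain 1, x, tau, y, v, w]"
  define d :: "nat list" where "d = [0, 1, 1, 2, 2, 3]"
  have rep: "E.represents 1 (const_cochain 1)" "E.represents (\<zeta> 1) x" "E.represents (\<zeta> 2) tau"
    "E.represents (\<xi> 1) y" "E.represents (\<xi> 2) v"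
    using E.represents_const[of 1] E.represents_gen_var[of "Zeta 1"] E.represents_gen_var[of "Zeta 2"]
      E.represents_gen_var[of "Xi 1"] E.represents_gen_var[of "Xi 2"]
    by (simp_all add: z_def)
  have rep_w: "E.represents (\<zeta> 1 * \<xi> 1) w" unfolding w_def by (intro E.represents_mult rep)
  have B3: "h \<in> B" if "h \<in> cocycles TG" "cochain_degree 3 h" "top_eval h = 0" for h
    using coboundary_iff_top_eval that by blast
  have B4: "cup_product h h' \<in> B" if "h \<in> {y, v}" "h' \<in> {y, v}" for h h'
    using coboundary_ge_4[of "cup_product h h'" 4] that y v
    by (auto simp: cocycles_cup_product cup_product_degree_eq)
  have "\<exists>g\<in>B. E.represents (\<zeta> 1 ^ 2 \<doteq> of_int a * \<xi> 1) g"
    using square E.represents_add[OF E.represents_mult[OF rep(2,2)] E.represents_of_int_mult[OF rep(4), of a]]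
    by (auto simp: power2_eq_square x_def y_def)
  moreover have "\<exists>g\<in>B. E.represents (\<zeta> 2 ^ 2 \<doteq> 0) g"
    using tau_cup_tau E.represents_mult[OF rep(3,3)] by (auto simp: power2_eq_square)
  moreover have "\<exists>g\<in>B. E.represents (\<zeta> 1 * \<zeta> 2 \<doteq> 0) g"
  proof -
    have "cup_product x tau \<in> B"
      by (rule coboundary_eqI[OF coboundaries_add[OF form_cup_tau[OF fixed] image(1)]]) (simp add: x_def ac_simps)
    then show ?thesis using E.represents_mult[OF rep(2,3)] by auto
  qed
  moreover have "\<exists>g\<in>B. E.represents (\<zeta> 1 * \<xi> 2 \<doteq> of_int b * \<zeta> 1 * \<xi> 1) g"
  proof -
    have "(\<lambda>xs. cup_product x v xs + of_int b * w xs) \<in> B"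
    proof (rule B3)
      show "cochain_degree 3 (\<lambda>xs. cup_product x v xs + of_int b * w xs)"
        using cup_product_degree_eq[OF x(2) v(2), of 3] w(2) by (simp add: cochain_degree_def)
      show "top_eval (\<lambda>xs. cup_product x v xs + of_int b * w xs) = 0"
        by (simp add: top_eval_add top_eval_scale cocycles_scale cocycles_cup_product x v w xv)
    qed (intro cocycles_add cocycles_scale cocycles_cup_product x v w)
    then show ?thesis
      using E.represents_add[OF E.represents_mult[OF rep(2,5)] E.represents_of_int_mult[OF rep_w, of b]]
      by (auto simp: mult.assoc)
  qed
  moreover have "\<exists>g\<in>B. E.represents (\<zeta> 2 * \<xi> 1 \<doteq> 0) g"
  proof -
    have "cup_product tau y \<in> B"
      using cup_product_degree_eq[OF degree_tau y(2), of 3]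
      by (intro B3 cocycles_cup_product tau_cocycle y) (simp_all add: top_eval_tau_cup y)
    then show ?thesis using E.represents_mult[OF rep(3,4)] by auto
  qed
  moreover have "\<exists>g\<in>B. E.represents (\<zeta> 2 * \<xi> 2 \<doteq> \<zeta> 1 * \<xi> 1) g"
  proof -
    have "(\<lambda>xs. cup_product tau v xs + w xs) \<in> B"
    proof (rule B3)
      show "cochain_degree 3 (\<lambda>xs. cup_product tau v xs + w xs)"
        using cup_product_degree_eq[OF degree_tau v(2), of 3] w(2) by (simp add: cochain_degree_def)
      show "top_eval (\<lambda>xs. cup_product tau v xs + w xs) = 0"
        by (simp add: top_eval_add cocycles_cup_product tau_cocycle top_eval_tau_cup v w)
    qed (intro cocycles_add cocycles_cup_product tau_cocycle v w)
    then show ?thesis using E.represents_add[OF E.represents_mult[OF rep(3,5)] rep_w] by auto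
  qed
  moreover have "\<exists>g\<in>B. E.represents (\<xi> 1 ^ 2 \<doteq> 0) g" "\<exists>g\<in>B. E.represents (\<xi> 2 ^ 2 \<doteq> 0) g"
    "\<exists>g\<in>B. E.represents (\<xi> 1 * \<xi> 2 \<doteq> 0) g"
    using B4 E.represents_mult[OF rep(4,4)] E.represents_mult[OF rep(5,5)] E.represents_mult[OF rep(4,5)]
    by (auto simp: power2_eq_square)
  ultimately have rels: "\<exists>g\<in>B. E.represents r g" if "r \<in> rels_2 a b" for r
    using that by (elim insertE emptyE) simp_all
  have hom: "poly_homogeneous 0 1" "poly_homogeneous 1 (\<zeta> 1)" "poly_homogeneous 1 (\<zeta> 2)"
    "poly_homogeneous 2 (\<xi> 1)" "poly_homogeneous 2 (\<xi> 2)" "poly_homogeneous 3 (\<zeta> 1 * \<xi> 1)"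
    using poly_homogeneous_1 poly_homogeneous_gen_var[of "Zeta 1"] poly_homogeneous_gen_var[of "Zeta 2"]
      poly_homogeneous_gen_var[of "Xi 1"] poly_homogeneous_gen_var[of "Xi 2"]
      poly_homogeneous_mult_eq[of 1 "\<zeta> 1" 2 "\<xi> 1" 3] by simp_all
  show ?thesis
  proof (rule E.presented_by_basis[where k = 6 and e = "\<lambda>i. basis_2 ! i" and f = "\<lambda>i. f ! i"
        and d = "\<lambda>i. d ! i", OF _ _ _ _ _ _ spanned_2])
    show "rels_2 a b \<subseteq> carrier (poly_ring {Zeta 1, Zeta 2, Xi 1, Xi 2})" by (simp add: power2_eq_square)
    show "\<exists>g\<in>B. E.represents r g" if "r \<in> rels_2 a b" for r by (rule rels[OF that])
    fix i :: nat assume "i < 6"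
    then have i: "i = 0 \<or> i = 1 \<or> i = 2 \<or> i = 3 \<or> i = 4 \<or> i = 5" by (rule less_6_cases)
    show "basis_2 ! i \<in> carrier (poly_ring {Zeta 1, Zeta 2, Xi 1, Xi 2})" using i by auto
    show "poly_homogeneous (d ! i) (basis_2 ! i)" using i hom by (auto simp: d_def)
    show "E.represents (basis_2 ! i) (f ! i)" using i rep rep_w by (auto simp: f_def)
    show "cochain_degree (d ! i) (f ! i)"
      using i cochain_degree_const[of 1] degree_tau x(2) y(2) v(2) w(2) by (auto simp: d_def f_def)
  next
    fix n c assume supp: "\<And>i. i < 6 \<Longrightarrow> c i \<noteq> 0 \<Longrightarrow> d ! i = n"
      and "(\<lambda>xs. \<Sum>i<6. c i * (f ! i) xs) \<in> B"
    then have F: "(\<lambda>xs. c 0 * const_cochain 1 xs + c 1 * x xs + c 2 * tau xs + c 3 * y xs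
        + c 4 * v xs + c 5 * w xs) \<in> B"
      by (simp add: sum_less_6 f_def)
    have c0: "c 0 = 0" using coboundary_degree_le_1(1)[OF F] by (simp add: low)
    have c2: "c 2 = 0" using coboundary_degree_le_1(2)[OF F, of "st 1"] by (simp add: low x)
    have c1: "c 1 = 0"
      using coboundary_degree_le_1(2)[OF F, of "sa 1"] coboundary_degree_le_1(2)[OF F, of "sb 1"] wedge
      by (auto simp: low x)
    have c4: "c 4 = 0" using fiber_eval_coboundary[OF F] by (simp add: fiber_eval_add fiber_eval_scale low y v)
    \<comment> \<open>Fiber evaluation does not see y. If its coefficient were nonzero, homogeneity
      would remove the degree 3 term and leave y itself as a coboundary.\<close>
    have c3: "c 3 = 0"
    proof (rule ccontr)
      assume "c 3 \<noteq> 0"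
      then have "c 3 = 1" "c 5 = 0" using supp[of 3] supp[of 5] by (cases "c 5"; simp add: d_def)+
      then show False using F c0 c1 c2 c4 image(2) by (simp add: y_def)
    qed
    have "c 5 = 0" using top_eval_coboundary[OF F] c0 c1 c2 c3 c4 w by (simp add: top_eval_scale)
    then show "\<forall>i<6. c i = 0" using c0 c1 c2 c3 c4 less_6_cases by blast
  next
    fix n and g :: "torus_cochain" assume g: "g \<in> cocycles TG" "cochain_degree n g"
    define P where "P c \<longleftrightarrow> (\<forall>i<6. c i \<noteq> 0 \<longrightarrow> d ! i = n) \<and> (\<lambda>xs. g xs + (\<Sum>i<6. c i * (f ! i) xs)) \<in> B" for c
    have PI: "\<exists>c. P c" if "\<And>i. i < 6 \<Longrightarrow> q ! i \<noteq> 0 \<Longrightarrow> d ! i = n"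
      "(\<lambda>xs. g xs + (q ! 0 * const_cochain 1 xs + q ! 1 * x xs + q ! 2 * tau xs + q ! 3 * y xs
        + q ! 4 * v xs + q ! 5 * w xs)) \<in> B" for q
      using that by (intro exI[of _ "\<lambda>i. q ! i"]) (simp add: P_def sum_less_6 f_def)
    consider "n = 0" | "n = 1" | "n = 2" | "n = 3" | "n \<ge> 4" by linarith
    then have "\<exists>c. P c"
    proof cases
      case 1
      have "(\<lambda>xs. g xs + g [] * const_cochain 1 xs) \<in> B"
        by (rule coboundary_eqI[OF zero_coboundary]) (use cocycle_0_const[of g] g 1 in simp)
      then show ?thesis by (intro PI[of "[g [], 0, 0, 0, 0, 0]"]) (auto simp: d_def 1 dest!: less_6_cases)
    next
      case 2
      obtain c d e where cd: "fixed c d" "g = (\<lambda>xs. form c d xs + e * tau xs)"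
        using cocycle_1_cases[OF g(1) g(2)[unfolded 2]] by blast
      obtain q where q: "\<And>xs. form c d xs = q * x xs"
        using fixed_cases[OF cd(1)] form_0 that[of 0] that[of 1] by (auto simp: x_def)
      have "(\<lambda>xs. g xs + (q * x xs + e * tau xs)) \<in> B"
        by (rule coboundary_eqI[OF zero_coboundary]) (simp add: cd(2) q)
      then show ?thesis
        by (intro PI[of "[0, q, e, 0, 0, 0]"]) (auto simp: d_def 2 dest!: less_6_cases)
    next
      case 3
      obtain c d where cd: "(\<lambda>xs. g xs + fiber_eval g * area xs + crossed c d xs) \<in> B"
        using cocycle_2_cases[OF g(1) g(2)[unfolded 3]] by blast
      \<comment> \<open>Cramer's rule for the coordinates of (c, d) in the basis (c1, d1), (c2, d2),
        whose determinant is 1.\<close>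
      define p q where "p = c * d2 + d * c2" and "q = c * d1 + d * c1"
      have "p * c1 + q * c2 = c * (c2 * d1 + d2 * c1)" "p * d1 + q * d2 = d * (c2 * d1 + d2 * c1)"
        by (simp_all add: p_def q_def algebra_simps)
      then have crossed: "crossed c d xs = p * crossed c1 d1 xs + q * y xs" for xs
        using crossed_linear[of p c1 q c2 d1 d2 xs] by (simp add: wedge y_def)
      have "(\<lambda>xs. g xs + ((q + fiber_eval g * t) * y xs + fiber_eval g * v xs)) \<in> B"
        by (rule coboundary_eqI[OF coboundaries_add[OF cd coboundary_scaleI[OF image(1), of p]]])
          (simp add: crossed v_def algebra_simps)
      then show ?thesis
        by (intro PI[of "[0, 0, 0, q + fiber_eval g * t, fiber_eval g, 0]"]) (auto simp: d_def 3 dest!: less_6_cases)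
    next
      case 4
      have "(\<lambda>xs. g xs + top_eval g * w xs) \<in> B" using cocycle_3_top_eval[OF g(1) _ w] g(2) 4 by simp
      then show ?thesis
        by (intro PI[of "[0, 0, 0, 0, 0, top_eval g]"]) (auto simp: d_def 4 dest!: less_6_cases)
    next
      case 5
      then show ?thesis
        using coboundary_ge_4[OF g] by (intro exI[of _ "\<lambda>_. 0"]) (simp add: P_def)
    qed
    then show "\<exists>c. (\<forall>i<6. c i \<noteq> 0 \<longrightarrow> d ! i = n) \<and> (\<lambda>xs. g xs + (\<Sum>i<6. c i * (f ! i) xs)) \<in> B"
      unfolding P_def .
  qed
qed

text \<open>Here \<theta>^* - 1 vanishes modulo 2, so every linear form extends to G and no nonzero
  crossed class is trivial. The rows of (\<theta> - 1)/2 give the Bocksteins of the two coordinate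
  forms, and only their parity matters.\<close>

theorem presentation_1:
  fixes a b c d a' b' c' d' :: int
  assumes A: "A $ 1 $ 1 = 1 + 2 * a'" "A $ 1 $ 2 = 2 * b'" "A $ 2 $ 1 = 2 * c'" "A $ 2 $ 2 = 1 + 2 * d'"
    and parity: "even (a + a')" "even (b + b')" "even (c + c')" "even (d + d')"
  shows "mod2_cohomology_presented_by TG {Zeta 1, Zeta 2, Zeta 3} (rels_1 a b c d)"
proof -
  have ent: "ent 1 1 = 1" "ent 1 2 = 0" "ent 2 1 = 0" "ent 2 2 = 1"
    by (simp_all add: ent_def A)
  have fixed: "fixed p q" for p q by (simp add: fixed_def ent)
  have image: "p = 0 \<and> q = 0" if "crossed p q \<in> B" for p q
    using that by (elim crossed_coboundaryD) (simp add: ent)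
  have of_int_eq: "(of_int m :: bit) = of_int n" if even: "even (m + n)" for m n
  proof -
    obtain k where "m + n = 2 * k" using even by (elim evenE)
    then have "(of_int (m + n) :: bit) = 0" by simp
    then show ?thesis by (simp add: bit_add_eq_0_iff)
  qed
  note par = parity[THEN of_int_eq]
  define x y where "x = form 1 0" and "y = form 0 1"
  define xy xt yt w where "xy = cup_product x y" and "xt = cup_product x tau" and "yt = cup_product y tau"
    and "w = cup_product xy tau"
  have x: "x \<in> cocycles TG" "cochain_degree 1 x" "x [sa 1] = 1" "x [sb 1] = 0" "x [st 1] = 0"
    using degree_form[of 1 0] by (simp_all add: x_def form_cocycle fixed)
  have y: "y \<in> cocycles TG" "cochain_degree 1 y" "y [sa 1] = 0" "y [sb 1] = 1" "y [st 1] = 0"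
    using degree_form[of 0 1] by (simp_all add: y_def form_cocycle fixed)
  have xy: "xy \<in> cocycles TG" "cochain_degree 2 xy" "fiber_eval xy = 1"
    and xt: "xt \<in> cocycles TG" "cochain_degree 2 xt" "fiber_eval xt = 0"
    and yt: "yt \<in> cocycles TG" "cochain_degree 2 yt" "fiber_eval yt = 0"
    unfolding xy_def xt_def yt_def
    using x(3-5) y(3-5) cup_product_degree_eq[OF x(2) y(2), of 2] cup_product_degree_eq[OF x(2) degree_tau, of 2]
      cup_product_degree_eq[OF y(2) degree_tau, of 2]
    by (simp_all add: cocycles_cup_product x(1) y(1) tau_cocycle fiber_eval_cup[OF x(2) y(2)]
        fiber_eval_cup[OF x(2) degree_tau] fiber_eval_cup[OF y(2) degree_tau])
  have w: "w \<in> cocycles TG" "cochain_degree 3 w" "top_eval w = 1"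
    using top_eval_cup_commute[OF xy(1,2) tau_cocycle degree_tau] top_eval_tau_cup[OF xy(1,2)]
      cup_product_degree_eq[OF xy(2) degree_tau, of 3]
    by (simp_all add: w_def cocycles_cup_product xy tau_cocycle)
  \<comment> \<open>This identifies \<zeta>_1 \<zeta>_3 and \<zeta>_2 \<zeta>_3 with the two basic
    crossed classes.\<close>
  have xt_crossed: "(\<lambda>xs. xt xs + crossed 1 0 xs) \<in> B" and yt_crossed: "(\<lambda>xs. yt xs + crossed 0 1 xs) \<in> B"
    unfolding xt_def yt_def x_def y_def by (intro form_cup_tau fixed)+
  have crossed: "crossed p q xs = p * crossed 1 0 xs + q * crossed 0 1 xs" for p q xs
    using crossed_linear[of p 1 q 0 0 1 xs] by simp
  have low: "x [] = 0" "y [] = 0" "xy [] = 0" "xt [] = 0" "yt [] = 0" "w [] = 0"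
    "xy [h] = 0" "xt [h] = 0" "yt [h] = 0" "w [h] = 0" "fiber_eval w = 0"
    "fiber_eval x = 0" "fiber_eval y = 0" "fiber_eval tau = 0" "fiber_eval (const_cochain c) = 0" for h c
    using x(2) y(2) xy(2) xt(2) yt(2) w(2) degree_tau cochain_degree_const[of c]
    by (simp_all add: cochain_degree_def fiber_eval_def)
  define z where "z g = (if g = Zeta 1 then x else if g = Zeta 2 then y else if g = Zeta 3 then tau
    else (\<lambda>_. 0))" for g
  have z: "z g \<in> cocycles TG \<and> cochain_degree (gen_dim g) (z g)" for g
    unfolding z_def using tau_cocycle zero_cocycle degree_tau x y
    by (simp add: cochain_degree_def[of _ "\<lambda>_. 0"])
  interpret E: cohomology_evaluation TG z
    by (rule cohomologyI) (use z in auto)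
  define f where "f = [const_cochain 1, x, y, tau, xy, xt, yt, w]"
  define dg :: "nat list" where "dg = [0, 1, 1, 1, 2, 2, 2, 3]"
  have rep: "E.represents 1 (const_cochain 1)" "E.represents (\<zeta> 1) x" "E.represents (\<zeta> 2) y"
    "E.represents (\<zeta> 3) tau"
    using E.represents_const[of 1] E.represents_gen_var[of "Zeta 1"] E.represents_gen_var[of "Zeta 2"]
      E.represents_gen_var[of "Zeta 3"]
    by (simp_all add: z_def)
  have rep2: "E.represents (\<zeta> 1 * \<zeta> 2) xy" "E.represents (\<zeta> 1 * \<zeta> 3) xt" "E.represents (\<zeta> 2 * \<zeta> 3) yt"
    unfolding xy_def xt_def yt_def by (intro E.represents_mult rep)+
  have rep_w: "E.represents (\<zeta> 1 * \<zeta> 2 * \<zeta> 3) w" unfolding w_def by (intro E.represents_mult rep rep2)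
  have "(\<lambda>xs. cup_product x x xs + (of_int a * xt xs + of_int b * yt xs)) \<in> B"
  proof -
    have "(\<lambda>xs. cup_product x x xs + crossed (of_int a) (of_int b) xs) \<in> B"
      using form_cup_self[of 1 0 a' b'] by (simp add: A par x_def)
    from coboundaries_add[OF this coboundaries_add[OF coboundary_scaleI[OF xt_crossed, of "of_int a"]
          coboundary_scaleI[OF yt_crossed, of "of_int b"]]]
    show ?thesis by (rule coboundary_eqI) (simp add: crossed[of "of_int a" "of_int b"] algebra_simps)
  qed
  then have "\<exists>g\<in>B. E.represents (\<zeta> 1 ^ 2 \<doteq> of_int a * \<zeta> 1 * \<zeta> 3 + of_int b * \<zeta> 2 * \<zeta> 3) g"
    using E.represents_add[OF E.represents_mult[OF rep(2,2)] E.represents_add[OF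
          E.represents_of_int_mult[OF rep2(2), of a] E.represents_of_int_mult[OF rep2(3), of b]]]
    by (auto simp: power2_eq_square mult.assoc)
  moreover have "(\<lambda>xs. cup_product y y xs + (of_int c * xt xs + of_int d * yt xs)) \<in> B"
  proof -
    have "(\<lambda>xs. cup_product y y xs + crossed (of_int c) (of_int d) xs) \<in> B"
      using form_cup_self[of 0 1 c' d'] by (simp add: A par y_def)
    from coboundaries_add[OF this coboundaries_add[OF coboundary_scaleI[OF xt_crossed, of "of_int c"]
          coboundary_scaleI[OF yt_crossed, of "of_int d"]]]
    show ?thesis by (rule coboundary_eqI) (simp add: crossed[of "of_int c" "of_int d"] algebra_simps)
  qed
  then have "\<exists>g\<in>B. E.represents (\<zeta> 2 ^ 2 \<doteq> of_int c * \<zeta> 1 * \<zeta> 3 + of_int d * \<zeta> 2 * \<zeta> 3) g"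
    using E.represents_add[OF E.represents_mult[OF rep(3,3)] E.represents_add[OF
          E.represents_of_int_mult[OF rep2(2), of c] E.represents_of_int_mult[OF rep2(3), of d]]]
    by (auto simp: power2_eq_square mult.assoc)
  moreover have "\<exists>g\<in>B. E.represents (\<zeta> 3 ^ 2 \<doteq> 0) g"
    using tau_cup_tau E.represents_mult[OF rep(4,4)] by (auto simp: power2_eq_square)
  ultimately have rels: "\<exists>g\<in>B. E.represents r g" if "r \<in> rels_1 a b c d" for r
    using that by (elim insertE emptyE) simp_all
  have hom: "poly_homogeneous 0 1" "poly_homogeneous 1 (\<zeta> 1)" "poly_homogeneous 1 (\<zeta> 2)"
    "poly_homogeneous 1 (\<zeta> 3)"
    using poly_homogeneous_1 poly_homogeneous_gen_var[of "Zeta 1"] poly_homogeneous_gen_var[of "Zeta 2"]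
      poly_homogeneous_gen_var[of "Zeta 3"] by simp_all
  have hom2: "poly_homogeneous 2 (\<zeta> 1 * \<zeta> 2)" "poly_homogeneous 2 (\<zeta> 1 * \<zeta> 3)" "poly_homogeneous 2 (\<zeta> 2 * \<zeta> 3)"
    by (rule poly_homogeneous_mult_eq[of 1 _ 1]; use hom in simp)+
  have hom3: "poly_homogeneous 3 (\<zeta> 1 * \<zeta> 2 * \<zeta> 3)"
    by (rule poly_homogeneous_mult_eq[of 2 _ 1]) (use hom hom2 in simp_all)
  show ?thesis
  proof (rule E.presented_by_basis[where k = 8 and e = "\<lambda>i. basis_1 ! i" and f = "\<lambda>i. f ! i"
        and d = "\<lambda>i. dg ! i", OF _ _ _ _ _ _ spanned_1])
    show "rels_1 a b c d \<subseteq> carrier (poly_ring {Zeta 1, Zeta 2, Zeta 3})" by (simp add: power2_eq_square)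
    show "\<exists>g\<in>B. E.represents r g" if "r \<in> rels_1 a b c d" for r by (rule rels[OF that])
    fix i :: nat assume "i < 8"
    then have i: "i = 0 \<or> i = 1 \<or> i = 2 \<or> i = 3 \<or> i = 4 \<or> i = 5 \<or> i = 6 \<or> i = 7" by (rule less_8_cases)
    show "basis_1 ! i \<in> carrier (poly_ring {Zeta 1, Zeta 2, Zeta 3})" using i by auto
    show "poly_homogeneous (dg ! i) (basis_1 ! i)" using i hom hom2 hom3 by (auto simp: dg_def)
    show "E.represents (basis_1 ! i) (f ! i)" using i rep rep2 rep_w by (auto simp: f_def)
    show "cochain_degree (dg ! i) (f ! i)"
      using i cochain_degree_const[of 1] degree_tau x(2) y(2) xy(2) xt(2) yt(2) w(2)
      by (auto simp: dg_def f_def)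
  next
    fix n and q :: "nat \<Rightarrow> bit" assume supp: "\<And>i. i < 8 \<Longrightarrow> q i \<noteq> 0 \<Longrightarrow> dg ! i = n"
      and "(\<lambda>xs. \<Sum>i<8. q i * (f ! i) xs) \<in> B"
    then have F: "(\<lambda>xs. q 0 * const_cochain 1 xs + q 1 * x xs + q 2 * y xs + q 3 * tau xs
        + q 4 * xy xs + q 5 * xt xs + q 6 * yt xs + q 7 * w xs) \<in> B"
      by (simp add: sum_less_8 f_def)
    have q0: "q 0 = 0" using coboundary_degree_le_1(1)[OF F] by (simp add: low)
    have q1: "q 1 = 0" "q 2 = 0" "q 3 = 0"
      using coboundary_degree_le_1(2)[OF F, of "sa 1"] coboundary_degree_le_1(2)[OF F, of "sb 1"]
        coboundary_degree_le_1(2)[OF F, of "st 1"]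
      by (simp_all add: low x y)
    have q4: "q 4 = 0" using fiber_eval_coboundary[OF F] by (simp add: fiber_eval_add fiber_eval_scale low xy xt yt)
    \<comment> \<open>A dependence in degree 2 between xt and yt would be one between crossed
      classes, which \<open>image\<close> excludes.\<close>
    have q5: "q 5 = 0 \<and> q 6 = 0"
    proof (cases "n = 2")
      case True
      then have "q 7 = 0" using supp[of 7] by (cases "q 7"; simp add: dg_def)
      then have "(\<lambda>xs. q 5 * xt xs + q 6 * yt xs) \<in> B" using F q0 q1 q4 by simp
      from coboundaries_add[OF this coboundaries_add[OF coboundary_scaleI[OF xt_crossed, of "q 5"]
            coboundary_scaleI[OF yt_crossed, of "q 6"]]]
      have "crossed (q 5) (q 6) \<in> B"
        by (rule coboundary_eqI) (simp add: crossed[of "q 5" "q 6"] algebra_simps)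
      then show ?thesis by (rule image)
    next
      case False
      then show ?thesis using supp[of 5] supp[of 6] by (cases "q 5"; cases "q 6"; simp add: dg_def)
    qed
    have "q 7 = 0" using top_eval_coboundary[OF F] q0 q1 q4 q5 w by (simp add: top_eval_scale)
    then show "\<forall>i<8. q i = 0" using q0 q1 q4 q5 less_8_cases by blast
  next
    fix n and g :: "torus_cochain" assume g: "g \<in> cocycles TG" "cochain_degree n g"
    define P where "P c \<longleftrightarrow> (\<forall>i<8. c i \<noteq> 0 \<longrightarrow> dg ! i = n) \<and> (\<lambda>xs. g xs + (\<Sum>i<8. c i * (f ! i) xs)) \<in> B" for c
    have PI: "\<exists>c. P c" if "\<And>i. i < 8 \<Longrightarrow> q ! i \<noteq> 0 \<Longrightarrow> dg ! i = n"
      "(\<lambda>xs. g xs + (q ! 0 * const_cochain 1 xs + q ! 1 * x xs + q ! 2 * y xs + q ! 3 * tau xs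
        + q ! 4 * xy xs + q ! 5 * xt xs + q ! 6 * yt xs + q ! 7 * w xs)) \<in> B" for q
      using that by (intro exI[of _ "\<lambda>i. q ! i"]) (simp add: P_def sum_less_8 f_def)
    consider "n = 0" | "n = 1" | "n = 2" | "n = 3" | "n \<ge> 4" by linarith
    then have "\<exists>c. P c"
    proof cases
      case 1
      have "(\<lambda>xs. g xs + g [] * const_cochain 1 xs) \<in> B"
        by (rule coboundary_eqI[OF zero_coboundary]) (use cocycle_0_const[of g] g 1 in simp)
      then show ?thesis
        by (intro PI[of "[g [], 0, 0, 0, 0, 0, 0, 0]"]) (auto simp: dg_def 1 dest!: less_8_cases)
    next
      case 2
      obtain p q e where pq: "g = (\<lambda>xs. form p q xs + e * tau xs)"
        using cocycle_1_cases[OF g(1) g(2)[unfolded 2]] by blast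
      have "(\<lambda>xs. g xs + (p * x xs + q * y xs + e * tau xs)) \<in> B"
        using form_linear[of p 1 q 0 0 1]
        by (intro coboundary_eqI[OF zero_coboundary]) (simp add: pq x_def y_def)
      then show ?thesis
        by (intro PI[of "[0, p, q, e, 0, 0, 0, 0]"]) (auto simp: dg_def 2 dest!: less_8_cases)
    next
      case 3
      \<comment> \<open>The product xy has fiber evaluation 1 and replaces \<open>area\<close>: for
        the corrected cocycle the area term drops out.\<close>
      define g' where "g' xs = g xs + fiber_eval g * xy xs" for xs
      have g': "g' \<in> cocycles TG" "cochain_degree 2 g'" "fiber_eval g' = 0"
        unfolding g'_def[abs_def] using g(2) xy 3
        by (simp_all add: cocycles_add cocycles_scale g(1) fiber_eval_add fiber_eval_scale cochain_degree_def)
      obtain p q where "(\<lambda>xs. g' xs + fiber_eval g' * area xs + crossed p q xs) \<in> B"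
        using cocycle_2_cases[OF g'(1,2)] by blast
      from coboundaries_add[OF this coboundaries_add[OF coboundary_scaleI[OF xt_crossed, of p]
            coboundary_scaleI[OF yt_crossed, of q]]]
      have "(\<lambda>xs. g xs + (fiber_eval g * xy xs + p * xt xs + q * yt xs)) \<in> B"
        by (rule coboundary_eqI) (simp add: g'(3) crossed[of p q], simp add: g'_def algebra_simps)
      then show ?thesis
        by (intro PI[of "[0, 0, 0, 0, fiber_eval g, p, q, 0]"]) (auto simp: dg_def 3 dest!: less_8_cases)
    next
      case 4
      have "(\<lambda>xs. g xs + top_eval g * w xs) \<in> B" using cocycle_3_top_eval[OF g(1) _ w] g(2) 4 by simp
      then show ?thesis
        by (intro PI[of "[0, 0, 0, 0, 0, 0, 0, top_eval g]"]) (auto simp: dg_def 4 dest!: less_8_cases)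
    next
      case 5
      then show ?thesis
        using coboundary_ge_4[OF g] by (intro exI[of _ "\<lambda>_. 0"]) (simp add: P_def)
    qed
    then show "\<exists>c. (\<forall>i<8. c i \<noteq> 0 \<longrightarrow> dg ! i = n) \<and> (\<lambda>xs. g xs + (\<Sum>i<8. c i * (f ! i) xs)) \<in> B"
      unfolding P_def .
  qed
qed

end

section \<open>The cohomology rings\<close>

lemma of_int_bit_even: "even k \<Longrightarrow> (of_int k :: bit) = 0"
  by (auto elim!: evenE)

lemma of_int_bit_odd: "odd k \<Longrightarrow> (of_int k :: bit) = 1"
  by (auto elim!: oddE)

lemma mat2_nth [simp]:
  "mat2 a b c d $ 1 $ 1 = a" "mat2 a b c d $ 1 $ 2 = b" "mat2 a b c d $ 2 $ 1 = c" "mat2 a b c d $ 2 $ 2 = d"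
  by (simp_all add: mat2_def)

lemma mat_cong_2_iff:
  "mat_cong A (mat2 a b c d) 2 \<longleftrightarrow>
    (even (A $ 1 $ 1) \<longleftrightarrow> even a) \<and> (even (A $ 1 $ 2) \<longleftrightarrow> even b) \<and>
    (even (A $ 2 $ 1) \<longleftrightarrow> even c) \<and> (even (A $ 2 $ 2) \<longleftrightarrow> even d)"
proof -
  have "[x = y] (mod 2) \<longleftrightarrow> (even x \<longleftrightarrow> even y)" for x y :: int
    unfolding cong_def by presburger
  then show ?thesis by (auto simp: mat_cong_def forall_2)
qed

section \<open>The congruence classes of \<theta> modulo 2\<close>

context torus_bundle
begin

lemma crossed_split: "crossed p q xs = p * crossed 1 0 xs + q * crossed 0 1 xs"
  using crossed_linear[of p 1 q 0 0 1 xs] by simp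

text \<open>Cramer's rule; division by the determinant is multiplication by it, since it is 1 or
  -1.\<close>

lemma matrix_inv_entries:
  assumes "- matrix_inv A = mat2 m1 m2 n1 n2"
  shows "m1 = - det A * A $ 2 $ 2" "m2 = det A * A $ 1 $ 2"
    "n1 = det A * A $ 2 $ 1" "n2 = - det A * A $ 1 $ 1"
proof -
  have "A ** matrix_inv A = mat 1" by (rule matrix_inv_inverse[OF invertible_A])
  moreover have "matrix_inv A = - mat2 m1 m2 n1 n2" using assms by (metis minus_minus)
  ultimately have "A ** (- mat2 m1 m2 n1 n2) = mat 1" by simp
  then have "(A ** (- mat2 m1 m2 n1 n2)) $ i $ j = mat 1 $ i $ j" for i j by simp
  from this[of 1 1] this[of 1 2] this[of 2 1] this[of 2 2]
  have *: "A $ 1 $ 1 * m1 + A $ 1 $ 2 * n1 = - 1" "A $ 1 $ 1 * m2 + A $ 1 $ 2 * n2 = 0"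
    "A $ 2 $ 1 * m1 + A $ 2 $ 2 * n1 = 0" "A $ 2 $ 1 * m2 + A $ 2 $ 2 * n2 = - 1"
    by (simp_all add: matrix_matrix_mult_def sum_2 mat_def)
  have "det A * m1 = A $ 2 $ 2 * (A $ 1 $ 1 * m1 + A $ 1 $ 2 * n1) - A $ 1 $ 2 * (A $ 2 $ 1 * m1 + A $ 2 $ 2 * n1)"
    "det A * m2 = A $ 2 $ 2 * (A $ 1 $ 1 * m2 + A $ 1 $ 2 * n2) - A $ 1 $ 2 * (A $ 2 $ 1 * m2 + A $ 2 $ 2 * n2)"
    "det A * n1 = A $ 1 $ 1 * (A $ 2 $ 1 * m1 + A $ 2 $ 2 * n1) - A $ 2 $ 1 * (A $ 1 $ 1 * m1 + A $ 1 $ 2 * n1)"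
    "det A * n2 = A $ 1 $ 1 * (A $ 2 $ 1 * m2 + A $ 2 $ 2 * n2) - A $ 2 $ 1 * (A $ 1 $ 1 * m2 + A $ 1 $ 2 * n2)"
    by (simp_all add: det_2 algebra_simps)
  then have "det A * m1 = - A $ 2 $ 2" "det A * m2 = A $ 1 $ 2" "det A * n1 = A $ 2 $ 1" "det A * n2 = - A $ 1 $ 1"
    unfolding * by simp_all
  then show "m1 = - det A * A $ 2 $ 2" "m2 = det A * A $ 1 $ 2"
    "n1 = det A * A $ 2 $ 1" "n2 = - det A * A $ 1 $ 1"
    using det_A by auto
qed

lemma cohomology_identity:
  assumes m: "- matrix_inv A = mat2 m1 m2 n1 n2" and cong: "mat_cong A (mat2 1 0 0 1) 2"
  shows "mod2_cohomology_presented_by TG {Zeta 1, Zeta 2, Zeta 3}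
    (rels_1 ((1 + m1) div 2) (m2 div 2) (n1 div 2) (1 + (n2 - 1) div 2))"
proof -
  have "odd (A $ 1 $ 1)" "even (A $ 1 $ 2)" "even (A $ 2 $ 1)" "odd (A $ 2 $ 2)"
    using cong by (simp_all add: mat_cong_2_iff)
  then obtain a b c d where A: "A $ 1 $ 1 = 1 + 2 * a" "A $ 1 $ 2 = 2 * b" "A $ 2 $ 1 = 2 * c" "A $ 2 $ 2 = 1 + 2 * d"
    by (metis oddE evenE add.commute)
  have det: "det A = 1 + 2 * (a + d + 2 * (a * d - b * c))" by (simp add: det_2 A algebra_simps)
  show ?thesis
  proof (rule presentation_1[OF A])
    \<comment> \<open>The Bocksteins come from \<theta>, the stated coefficients from its inverse.
      The determinant fixes the parity of a + d, and this exchanges the two diagonal coefficients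
      correctly.\<close>
    have "even ((1 + m1) div 2 + a) \<and> even (m2 div 2 + b) \<and> even (n1 div 2 + c)
        \<and> even (1 + (n2 - 1) div 2 + d)"
      using det_A
    proof
      assume D: "det A = 1"
      then have "a + d = 2 * (b * c - a * d)" using det by simp
      then have "even (a + d)" by simp
      then show ?thesis unfolding matrix_inv_entries[OF m] D A by simp presburger
    next
      assume D: "det A = - 1"
      then have "1 + a + d = 2 * (b * c - a * d)" using det by simp
      then have "even (1 + a + d)" by (metis dvd_triv_left)
      then show ?thesis unfolding matrix_inv_entries[OF m] D A by simp presburger
    qed
    then show "even ((1 + m1) div 2 + a)" "even (m2 div 2 + b)" "even (n1 div 2 + c)"
      "even (1 + (n2 - 1) div 2 + d)" by auto
  qed
qed

text \<open>The Bockstein of the invariant form (1, 1) has coordinates (column sum - 1)/2. Modulo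
  the image of \<theta>^* - 1, spanned by (1, 1), only the sum of these coordinates counts.\<close>

lemma cohomology_swap:
  assumes m: "- matrix_inv A = mat2 m1 m2 n1 n2" and cong: "mat_cong A (mat2 0 1 1 0) 2"
  shows "mod2_cohomology_presented_by TG {Zeta 1, Zeta 2, Xi 1, Xi 2}
    (rels_2 (1 + (A $ 1 $ 1 + A $ 2 $ 2 + m2 + n1) div 2) s)"
proof (rule presentation_2[where ?c1.0 = 1 and ?d1.0 = 1 and ?c2.0 = 1 and ?d2.0 = 0])
  have par: "even (A $ 1 $ 1)" "odd (A $ 1 $ 2)" "odd (A $ 2 $ 1)" "even (A $ 2 $ 2)"
    using cong by (simp_all add: mat_cong_2_iff)
  then have ent: "ent 1 1 = 0" "ent 1 2 = 1" "ent 2 1 = 1" "ent 2 2 = 0"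
    by (simp_all add: ent_def of_int_bit_even of_int_bit_odd)
  show "(c = 0 \<and> d = 0) \<or> (c = 1 \<and> d = 1)" if "fixed c d" for c d
    using that by (cases c; cases d) (simp_all add: fixed_def ent)
  show "fixed 1 1" by (simp add: fixed_def ent)
  show image: "crossed 1 1 \<in> B" using crossed_coboundary[of 1 0] by (simp add: ent)
  show "crossed 1 0 \<notin> B" by (auto simp: ent bit_add_eq_0_iff elim!: crossed_coboundaryD)
  show "1 * 1 + 0 * 1 = (1::bit)" by simp
  have "odd (A $ 1 $ 1 + A $ 2 $ 1)" "odd (A $ 1 $ 2 + A $ 2 $ 2)" using par by simp_all
  then obtain c d where cd: "A $ 1 $ 1 + A $ 2 $ 1 = 1 + 2 * c" "A $ 1 $ 2 + A $ 2 $ 2 = 1 + 2 * d"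
    by (metis oddE add.commute)
  define K where "K = 1 + (A $ 1 $ 1 + A $ 2 $ 2 + m2 + n1) div 2"
  \<comment> \<open>K + c + d is the sum of all four entries if the determinant is 1 and the trace
    if it is -1; both are even.\<close>
  have "even (K + (c + d))"
    using det_A
  proof
    assume "det A = 1"
    then show ?thesis using cd unfolding K_def matrix_inv_entries[OF m] by simp presburger
  next
    assume "det A = - 1"
    then show ?thesis using cd par unfolding K_def matrix_inv_entries[OF m] by simp presburger
  qed
  then have K: "of_int K = (of_int c + of_int d :: bit)"
    using of_int_bit_even[of "K + (c + d)"] by (simp add: bit_add_eq_0_iff)
  have "(\<lambda>xs. cup_product (form 1 1) (form 1 1) xs + crossed (of_int c) (of_int d) xs) \<in> B"
    using form_cup_self[of 1 1 c d] cd by simp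
  from coboundaries_add[OF this coboundary_scaleI[OF image, of "of_int d"]]
  show "(\<lambda>xs. cup_product (form 1 1) (form 1 1) xs
      + of_int (1 + (A $ 1 $ 1 + A $ 2 $ 2 + m2 + n1) div 2) * crossed 1 0 xs) \<in> B"
    unfolding K_def[symmetric]
    by (rule coboundary_eqI) (simp only: K crossed_split[of "of_int c"] crossed_split[of 1 1], simp add: algebra_simps)
qed

text \<open>The form (1, 0) is invariant and spans the image of \<theta>^* - 1, so only the second
  coordinate of its Bockstein, half of \<gamma>, survives. The upper triangular case exchanges the
  coordinates.\<close>

lemma cohomology_lower:
  assumes cong: "mat_cong A (mat2 1 0 1 1) 2"
  shows "mod2_cohomology_presented_by TG {Zeta 1, Zeta 2, Xi 1, Xi 2} (rels_2 (A $ 1 $ 2 div 2) s)"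
proof (rule presentation_2[where ?c1.0 = 1 and ?d1.0 = 0 and ?c2.0 = 0 and ?d2.0 = 1])
  have par: "odd (A $ 1 $ 1)" "even (A $ 1 $ 2)" "odd (A $ 2 $ 1)" "odd (A $ 2 $ 2)"
    using cong by (simp_all add: mat_cong_2_iff)
  then have ent: "ent 1 1 = 1" "ent 1 2 = 0" "ent 2 1 = 1" "ent 2 2 = 1"
    by (simp_all add: ent_def of_int_bit_even of_int_bit_odd)
  show "(c = 0 \<and> d = 0) \<or> (c = 1 \<and> d = 0)" if "fixed c d" for c d
    using that by (cases c; cases d) (simp_all add: fixed_def ent)
  show "fixed 1 0" by (simp add: fixed_def ent)
  show image: "crossed 1 0 \<in> B" using crossed_coboundary[of 0 1] by (simp add: ent)
  show "crossed 0 1 \<notin> B" by (auto simp: ent elim!: crossed_coboundaryD)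
  show "0 * 0 + 1 * 1 = (1::bit)" by simp
  obtain c d where cd: "A $ 1 $ 1 = 1 + 2 * c" "A $ 1 $ 2 = 2 * d"
    using par by (metis oddE evenE add.commute)
  have "(\<lambda>xs. cup_product (form 1 0) (form 1 0) xs + crossed (of_int c) (of_int d) xs) \<in> B"
    using form_cup_self[of 1 0 c d] cd by simp
  from coboundaries_add[OF this coboundary_scaleI[OF image, of "of_int c"]]
  show "(\<lambda>xs. cup_product (form 1 0) (form 1 0) xs + of_int (A $ 1 $ 2 div 2) * crossed 0 1 xs) \<in> B"
    by (rule coboundary_eqI) (simp add: cd crossed_split[of "of_int c"] algebra_simps)
qed

lemma cohomology_upper:
  assumes cong: "mat_cong A (mat2 1 1 0 1) 2"
  shows "mod2_cohomology_presented_by TG {Zeta 1, Zeta 2, Xi 1, Xi 2} (rels_2 (A $ 2 $ 1 div 2) s)"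
proof (rule presentation_2[where ?c1.0 = 0 and ?d1.0 = 1 and ?c2.0 = 1 and ?d2.0 = 0])
  have par: "odd (A $ 1 $ 1)" "odd (A $ 1 $ 2)" "even (A $ 2 $ 1)" "odd (A $ 2 $ 2)"
    using cong by (simp_all add: mat_cong_2_iff)
  then have ent: "ent 1 1 = 1" "ent 1 2 = 1" "ent 2 1 = 0" "ent 2 2 = 1"
    by (simp_all add: ent_def of_int_bit_even of_int_bit_odd)
  show "(c = 0 \<and> d = 0) \<or> (c = 0 \<and> d = 1)" if "fixed c d" for c d
    using that by (cases c; cases d) (simp_all add: fixed_def ent)
  show "fixed 0 1" by (simp add: fixed_def ent)
  show image: "crossed 0 1 \<in> B" using crossed_coboundary[of 1 0] by (simp add: ent)
  show "crossed 1 0 \<notin> B" by (auto simp: ent elim!: crossed_coboundaryD)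
  show "1 * 1 + 0 * 0 = (1::bit)" by simp
  obtain c d where cd: "A $ 2 $ 1 = 2 * c" "A $ 2 $ 2 = 1 + 2 * d"
    using par by (metis oddE evenE add.commute)
  have "(\<lambda>xs. cup_product (form 0 1) (form 0 1) xs + crossed (of_int c) (of_int d) xs) \<in> B"
    using form_cup_self[of 0 1 c d] cd by simp
  from coboundaries_add[OF this coboundary_scaleI[OF image, of "of_int d"]]
  show "(\<lambda>xs. cup_product (form 0 1) (form 0 1) xs + of_int (A $ 2 $ 1 div 2) * crossed 1 0 xs) \<in> B"
    by (rule coboundary_eqI) (simp add: cd crossed_split[of "of_int c"] algebra_simps)
qed

lemma cohomology_order_3:
  assumes "mat_cong A (mat2 1 1 1 0) 2 \<or> mat_cong A (mat2 0 1 1 1) 2"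
  shows "mod2_cohomology_presented_by TG {Zeta 1, Xi 1} rels_3"
proof (rule presentation_3)
  have ent: "ent 1 2 = 1 \<and> ent 2 1 = 1 \<and> ent 2 2 = ent 1 1 + 1"
    using assms
  proof
    assume "mat_cong A (mat2 1 1 1 0) 2"
    then have "odd (A $ 1 $ 1)" "odd (A $ 1 $ 2)" "odd (A $ 2 $ 1)" "even (A $ 2 $ 2)"
      by (simp_all add: mat_cong_2_iff)
    then show ?thesis by (simp add: ent_def of_int_bit_even of_int_bit_odd)
  next
    assume "mat_cong A (mat2 0 1 1 1) 2"
    then have "even (A $ 1 $ 1)" "odd (A $ 1 $ 2)" "odd (A $ 2 $ 1)" "odd (A $ 2 $ 2)"
      by (simp_all add: mat_cong_2_iff)
    then show ?thesis by (simp add: ent_def of_int_bit_even of_int_bit_odd)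
  qed
  show "c = 0 \<and> d = 0" if "fixed c d" for c d
    using that by (cases c; cases d; cases "ent 1 1") (simp_all add: fixed_def ent)
  \<comment> \<open>The witness is the inverse of \<theta>^* - 1 applied to (c, d); modulo 2 that
    matrix has determinant 1.\<close>
  show "crossed c d \<in> B" for c d
    using crossed_coboundary[of "d + ent 1 1 * c" "c + ent 2 2 * d"]
    by (cases c; cases d; cases "ent 1 1") (simp_all add: ent crossed_0 zero_coboundary)
qed

end

(* In the second case the relation added by "insert" is not in the printed list. Without it, when
   the coefficient of xi_1 in zeta_1^2 is even (e.g. theta = [[0,1],[1,0]]), the presented ring has
   dimension 2 in degree 3, but H^3(G, Z_2) has dimension 1; when that coefficient is odd, it follows
   from the printed relations. *)
theorem theorem7:
  fixes \<theta> :: "int^2^2"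
    and \<alpha> \<beta> \<gamma> \<delta> m\<^sub>1 m\<^sub>2 n\<^sub>1 n\<^sub>2 S\<^sub>1 S\<^sub>2 :: int
  assumes "\<theta> = mat2 \<alpha> \<gamma>
                   \<beta> \<delta>"
    and "invertible \<theta>"
    and "- matrix_inv \<theta> = mat2 m\<^sub>1 m\<^sub>2
                              n\<^sub>1 n\<^sub>2"
    and "S\<^sub>1 = S_alpha_gamma (det \<theta>) \<alpha> \<gamma>"
    and "S\<^sub>2 = S_beta_delta (det \<theta>) \<beta> \<delta>"
  shows
    "(mat_cong \<theta> (mat2 1 0
                        0 1) 2 \<longrightarrow>
       mod2_cohomology_presented_by (torus_bundle_group \<theta>) {Zeta 1, Zeta 2, Zeta 3}
         {\<zeta> 1 ^ 2 \<doteq> of_int ((1 + m\<^sub>1) div 2) * \<zeta> 1 * \<zeta> 3 + of_int (m\<^sub>2 div 2) * \<zeta> 2 * \<zeta> 3,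
          \<zeta> 2 ^ 2 \<doteq> of_int (n\<^sub>1 div 2) * \<zeta> 1 * \<zeta> 3 + of_int (1 + (n\<^sub>2 - 1) div 2) * \<zeta> 2 * \<zeta> 3,
          \<zeta> 3 ^ 2 \<doteq> 0})
   \<and> (mat_cong \<theta> (mat2 0 1
                        1 0) 2 \<longrightarrow>
       mod2_cohomology_presented_by (torus_bundle_group \<theta>) {Zeta 1, Zeta 2, Xi 1, Xi 2}
         (insert (\<zeta> 2 * \<xi> 1 \<doteq> 0)
         {\<zeta> 1 ^ 2 \<doteq> of_int (1 + (\<alpha> + \<delta> + m\<^sub>2 + n\<^sub>1) div 2) * \<xi> 1,
          \<zeta> 2 ^ 2 \<doteq> 0,
          \<zeta> 1 * \<zeta> 2 \<doteq> 0,
          \<zeta> 1 * \<xi> 1 \<doteq> \<zeta> 2 * \<xi> 2,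
          \<zeta> 1 * \<xi> 2 \<doteq> of_int (S\<^sub>1 + S\<^sub>2) * \<zeta> 1 * \<xi> 1,
          \<xi> 1 ^ 2 \<doteq> 0,
          \<xi> 2 ^ 2 \<doteq> 0,
          \<xi> 1 * \<xi> 2 \<doteq> 0}))
   \<and> (mat_cong \<theta> (mat2 1 1
                        1 0) 2 \<longrightarrow>
       mod2_cohomology_presented_by (torus_bundle_group \<theta>) {Zeta 1, Xi 1}
         {\<zeta> 1 ^ 2 \<doteq> 0,
          \<xi> 1 ^ 2 \<doteq> 0})
   \<and> (mat_cong \<theta> (mat2 1 0
                        1 1) 2 \<longrightarrow>
       mod2_cohomology_presented_by (torus_bundle_group \<theta>) {Zeta 1, Zeta 2, Xi 1, Xi 2}
         {\<zeta> 1 ^ 2 \<doteq> of_int (\<gamma> div 2) * \<xi> 1,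
          \<zeta> 2 ^ 2 \<doteq> 0,
          \<zeta> 1 * \<zeta> 2 \<doteq> 0,
          \<zeta> 1 * \<xi> 2 \<doteq> of_int S\<^sub>1 * \<zeta> 1 * \<xi> 1,
          \<zeta> 2 * \<xi> 1 \<doteq> 0,
          \<zeta> 2 * \<xi> 2 \<doteq> \<zeta> 1 * \<xi> 1,
          \<xi> 1 ^ 2 \<doteq> 0,
          \<xi> 2 ^ 2 \<doteq> 0,
          \<xi> 1 * \<xi> 2 \<doteq> 0})
   \<and> (mat_cong \<theta> (mat2 1 1
                        0 1) 2 \<longrightarrow>
       mod2_cohomology_presented_by (torus_bundle_group \<theta>) {Zeta 1, Zeta 2, Xi 1, Xi 2}
         {\<zeta> 1 ^ 2 \<doteq> of_int (\<beta> div 2) * \<xi> 1,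
          \<zeta> 2 ^ 2 \<doteq> 0,
          \<zeta> 1 * \<zeta> 2 \<doteq> 0,
          \<zeta> 1 * \<xi> 2 \<doteq> of_int S\<^sub>2 * \<zeta> 1 * \<xi> 1,
          \<zeta> 2 * \<xi> 1 \<doteq> 0,
          \<zeta> 2 * \<xi> 2 \<doteq> \<zeta> 1 * \<xi> 1,
          \<xi> 1 ^ 2 \<doteq> 0,
          \<xi> 2 ^ 2 \<doteq> 0,
          \<xi> 1 * \<xi> 2 \<doteq> 0})
   \<and> (mat_cong \<theta> (mat2 0 1
                        1 1) 2 \<longrightarrow>
       mod2_cohomology_presented_by (torus_bundle_group \<theta>) {Zeta 1, Xi 1}
         {\<zeta> 1 ^ 2 \<doteq> 0,
          \<xi> 1 ^ 2 \<doteq> 0})"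
proof -
  interpret torus_bundle \<theta> by unfold_locales (fact assms(2))
  have entries: "\<alpha> = \<theta> $ 1 $ 1" "\<gamma> = \<theta> $ 1 $ 2" "\<beta> = \<theta> $ 2 $ 1" "\<delta> = \<theta> $ 2 $ 2"
    using assms(1) by simp_all
  \<comment> \<open>In characteristic two a relation and its reversal are the same polynomial, so
    both lists agree up to order.\<close>
  have swap: "insert (\<zeta> 2 * \<xi> 1 \<doteq> 0)
         {\<zeta> 1 ^ 2 \<doteq> of_int a * \<xi> 1, \<zeta> 2 ^ 2 \<doteq> 0, \<zeta> 1 * \<zeta> 2 \<doteq> 0, \<zeta> 1 * \<xi> 1 \<doteq> \<zeta> 2 * \<xi> 2,
          \<zeta> 1 * \<xi> 2 \<doteq> of_int b * \<zeta> 1 * \<xi> 1, \<xi> 1 ^ 2 \<doteq> 0, \<xi> 2 ^ 2 \<doteq> 0, \<xi> 1 * \<xi> 2 \<doteq> 0}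
      = rels_2 a b" for a b
  proof -
    have "(\<zeta> 1 * \<xi> 1 \<doteq> \<zeta> 2 * \<xi> 2) = (\<zeta> 2 * \<xi> 2 \<doteq> \<zeta> 1 * \<xi> 1)" by (simp add: add.commute)
    then show ?thesis
      by (intro equalityI subsetI; elim insertE emptyE; simp only: insert_iff simp_thms)
  qed
  \<comment> \<open>The free parameter s of the involution cases is instantiated here with the
    required values of S.\<close>
  show ?thesis
    unfolding swap unfolding entries
    by (intro conjI impI cohomology_identity[OF assms(3)] cohomology_swap[OF assms(3)]
        cohomology_lower cohomology_upper; (rule cohomology_order_3)?; simp)
qed

end
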